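(* Let $D\subset\mathbb{C}^n$ be a bounded convex domain and let $X\subset D$ be a subset of $D$ which is 1-Bloch in $D$. Then $X$ is degenerate in $D$.
   Context: $\mathbb{D}=\{\zeta\in\mathbb{C}:|\zeta|<1\}$. A domain is a connected open set. For a domain $D$, $k_D$ denotes the Kobayashi distance of $D$ (for $D=\mathbb{D}$ this is the Poincaré distance $k_{\mathbb{D}}$). Bloch radius: for a domain $D$, $z\in D$ and $r\ge 0$, put $B_D(z,r)=\{w\in D: k_D(w,z)<r\}$. For $X\subset D$ the Bloch radius of $X$ in $D$ is $R(X)=\sup\{r\ge 0: B_D(z,r)\subset X \text{ for some } z\in D\}$. A subset (or subdomain) $X$ of $D$ is a Bloch subset (Bloch subdomain) of $D$ if $R(X)<+\infty$. Lempert projection devices: let $D\subset\mathbb{C}^n$ be a bounded convex domain. A complex geodesic of $D$ is a holomorphic map $\varphi:\mathbb{D}\to D$ which is an isometry between $k_{\mathbb{D}}$ and $k_D$. A Lempert projection associated to $\varphi$ is a holomorphic map $\rho_\varphi:D\to D$ with $\rho_\varphi(D)=\varphi(\mathbb{D})$, $\rho_\varphi\circ\rho_\varphi=\rho_\varphi$, $\rho_\varphi(z)=z$ for all $z\in\varphi(\mathbb{D})$, and such that for every $\zeta\in\mathbb{D}$ the fiber $\rho_\varphi^{-1}(\varphi(\zeta))$ is the intersection of $D$ with a complex (affine) hyperplane. Put $\tilde\rho_\varphi:=\varphi^{-1}\circ\rho_\varphi:D\to\mathbb{D}$ (the left inverse of $\varphi$). A triple $(\varphi,\rho_\varphi,\tilde\rho_\varphi)$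 of this kind is a Lempert projection device. 1-Bloch: a subset $X\subset D$ is 1-Bloch in $D$ if there exists $C>0$ such that for every Lempert projection device $(\varphi,\rho_\varphi,\tilde\rho_\varphi)$ of $D$ the set $\tilde\rho_\varphi(X)$ is contained in a Bloch subdomain $U_\varphi$ of $\mathbb{D}$ with Bloch radius (in $\mathbb{D}$) $R(U_\varphi)<C$. Degenerate: given a sequence $\{f_j\}_{j\ge1}$ of holomorphic self-maps of $D$, the associated holomorphic iterated function system is $\{F_j\}$ with $F_j:=f_j\circ\cdots\circ f_1$. A subset $X\subset D$ is degenerate in $D$ if for every sequence of holomorphic maps $f_j:D\to D$ with $f_j(D)\subset X$ for all $j$, all the limits of $\{F_j\}$ are constant; here a limit is a map $D\to\mathbb{C}^n$ that is the limit of a subsequence of $\{F_j\}$ in the compact-open topology (uniformly on compact subsets of $D$). *)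

theory Defs
  imports "HOL-Complex_Analysis.Complex_Analysis"
begin

abbreviation unit_disc :: "complex set" ("\<bbbD>")
  where "\<bbbD> \<equiv> ball 0 1"

definition is_domain :: "'a::topological_space set \<Rightarrow> bool"
  where "is_domain D \<longleftrightarrow> open D \<and> connected D"


section \<open>Holomorphic maps\<close>

text \<open>Holomorphic maps in several variables: the real Frechet derivative exists at every point
  and is complex linear, i.e. given by a complex Jacobian matrix.\<close>

definition holomorphic_map_on :: "(complex^'n \<Rightarrow> complex^'m) \<Rightarrow> (complex^'n) set \<Rightarrow> bool"
  where "holomorphic_map_on f D \<longleftrightarrow>
    (\<forall>z\<in>D. \<exists>J :: complex^'n^'m. (f has_derivative (\<lambda>v. J *v v)) (at z within D))"

definition holomorphic_self_map :: "(complex^'n) set \<Rightarrow> (complex^'n \<Rightarrow> complex^'n) \<Rightarrow> bool"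
  where "holomorphic_self_map D f \<longleftrightarrow> holomorphic_map_on f D \<and> f ` D \<subseteq> D"

definition holomorphic_disc :: "(complex^'n) set \<Rightarrow> (complex \<Rightarrow> complex^'n) \<Rightarrow> bool"
  where "holomorphic_disc D \<phi> \<longleftrightarrow>
    (\<forall>i. (\<lambda>\<zeta>. \<phi> \<zeta> $ i) holomorphic_on \<bbbD>) \<and> \<phi> ` \<bbbD> \<subseteq> D"


section \<open>Poincare and Kobayashi distances\<close>

text \<open>The normalisation is that of curvature \<open>- 4\<close>:
  the distance of \<open>0\<close> and \<open>\<zeta>\<close> is
  \<open>1/2 * ln ((1 + \<bar>\<zeta>\<bar>) / (1 - \<bar>\<zeta>\<bar>))\<close>.
  Any other one rescales all the distances below by the same constant.\<close>

definition poincare_dist :: "complex \<Rightarrow> complex \<Rightarrow> real"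
  where "poincare_dist \<zeta> \<omega> = artanh (cmod (Moebius_function 0 \<omega> \<zeta>))"

text \<open>The infimum of the lengths of all chains of holomorphic discs in \<open>D\<close> joining
  \<open>z\<close> to \<open>w\<close>. Any two points of a domain are joined by such a chain,
  so that the infimum is over a nonempty set of nonnegative reals.\<close>

definition kobayashi_dist :: "(complex^'n) set \<Rightarrow> complex^'n \<Rightarrow> complex^'n \<Rightarrow> real"
  where "kobayashi_dist D z w =
    Inf {(\<Sum>j<m. poincare_dist (\<zeta> j) (\<omega> j)) | (m::nat) p \<phi> \<zeta> \<omega>.
      p 0 = z \<and> p m = w \<and>
      (\<forall>j<m. holomorphic_disc D (\<phi> j) \<and> \<zeta> j \<in> \<bbbD> \<and> \<omega> j \<in> \<bbbD> \<and>
              \<phi> j (\<zeta> j) = p j \<and> \<phi> j (\<omega> j) = p (Suc j))}"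


section \<open>Bloch radius\<close>

text \<open>The argument \<open>k\<close> stands for the Kobayashi distance of \<open>D\<close>:
  \<^const>\<open>poincare_dist\<close> for the unit disc,
  \<open>kobayashi_dist D\<close> for a domain in \<open>\<complex>\<^sup>n\<close>.\<close>

definition dist_ball :: "('a \<Rightarrow> 'a \<Rightarrow> real) \<Rightarrow> 'a set \<Rightarrow> 'a \<Rightarrow> real \<Rightarrow> 'a set"
  where "dist_ball k D z r = {w \<in> D. k w z < r}"

definition bloch_radius :: "('a \<Rightarrow> 'a \<Rightarrow> real) \<Rightarrow> 'a set \<Rightarrow> 'a set \<Rightarrow> ereal"
  where "bloch_radius k D X = Sup {ereal r | r. r \<ge> 0 \<and> (\<exists>z\<in>D. dist_ball k D z r \<subseteq> X)}"

definition bloch_subdomain ::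
  "('a::topological_space \<Rightarrow> 'a \<Rightarrow> real) \<Rightarrow> 'a set \<Rightarrow> 'a set \<Rightarrow> bool"
  where "bloch_subdomain k D U \<longleftrightarrow> is_domain U \<and> U \<subseteq> D \<and> bloch_radius k D U < \<infinity>"


section \<open>Lempert projection devices\<close>

definition complex_geodesic :: "(complex^'n) set \<Rightarrow> (complex \<Rightarrow> complex^'n) \<Rightarrow> bool"
  where "complex_geodesic D \<phi> \<longleftrightarrow> holomorphic_disc D \<phi> \<and>
    (\<forall>\<zeta>\<in>\<bbbD>. \<forall>\<omega>\<in>\<bbbD>. kobayashi_dist D (\<phi> \<zeta>) (\<phi> \<omega>) = poincare_dist \<zeta> \<omega>)"

definition complex_hyperplane :: "(complex^'n) set \<Rightarrow> bool"
  where "complex_hyperplane H \<longleftrightarrow>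
    (\<exists>a b. a \<noteq> 0 \<and> H = {z. (\<Sum>i\<in>UNIV. a $ i * z $ i) = b})"

definition lempert_projection ::
  "(complex^'n) set \<Rightarrow> (complex \<Rightarrow> complex^'n) \<Rightarrow> (complex^'n \<Rightarrow> complex^'n) \<Rightarrow> bool"
  where "lempert_projection D \<phi> \<rho> \<longleftrightarrow>
    holomorphic_self_map D \<rho> \<and> \<rho> ` D = \<phi> ` \<bbbD> \<and>
    (\<forall>z\<in>D. \<rho> (\<rho> z) = \<rho> z) \<and>
    (\<forall>z\<in>\<phi> ` \<bbbD>. \<rho> z = z) \<and>
    (\<forall>\<zeta>\<in>\<bbbD>. \<exists>H. complex_hyperplane H \<and> {z\<in>D. \<rho> z = \<phi> \<zeta>} = D \<inter> H)"

definition lempert_device ::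
  "(complex^'n) set \<Rightarrow> (complex \<Rightarrow> complex^'n) \<Rightarrow> (complex^'n \<Rightarrow> complex^'n)
    \<Rightarrow> (complex^'n \<Rightarrow> complex) \<Rightarrow> bool"
  where "lempert_device D \<phi> \<rho> \<rho>' \<longleftrightarrow>
    complex_geodesic D \<phi> \<and> lempert_projection D \<phi> \<rho> \<and>
    (\<forall>z\<in>D. \<rho>' z = inv_into \<bbbD> \<phi> (\<rho> z))"

definition one_bloch :: "(complex^'n) set \<Rightarrow> (complex^'n) set \<Rightarrow> bool"
  where "one_bloch D X \<longleftrightarrow>
    (\<exists>C::real. C > 0 \<and> (\<forall>\<phi> \<rho> \<rho>'. lempert_device D \<phi> \<rho> \<rho>' \<longrightarrow>
      (\<exists>U. bloch_subdomain poincare_dist \<bbbD> U \<and> \<rho>' ` X \<subseteq> U \<and>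
           bloch_radius poincare_dist \<bbbD> U < ereal C)))"


section \<open>Iterated function systems\<close>

text \<open>Indices start at \<open>0\<close>, so that \<open>ifs f j = f j \<circ> \<dots> \<circ> f 0\<close>.\<close>

primrec ifs :: "(nat \<Rightarrow> 'a \<Rightarrow> 'a) \<Rightarrow> nat \<Rightarrow> 'a \<Rightarrow> 'a"
  where
    "ifs f 0 = f 0"
  | "ifs f (Suc j) = f (Suc j) \<circ> ifs f j"

definition subsequential_limit ::
  "'a::topological_space set \<Rightarrow> (nat \<Rightarrow> 'a \<Rightarrow> 'b::metric_space) \<Rightarrow> ('a \<Rightarrow> 'b) \<Rightarrow> bool"
  where "subsequential_limit D F G \<longleftrightarrow>
    (\<exists>r :: nat \<Rightarrow> nat. strict_mono r \<and>
      (\<forall>K. compact K \<and> K \<subseteq> D \<longrightarrow> uniform_limit K (\<lambda>j. F (r j)) G sequentially))"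

definition degenerate :: "(complex^'n) set \<Rightarrow> (complex^'n) set \<Rightarrow> bool"
  where "degenerate D X \<longleftrightarrow>
    (\<forall>f. (\<forall>j. holomorphic_self_map D (f j) \<and> f j ` D \<subseteq> X) \<longrightarrow>
      (\<forall>G. subsequential_limit D (ifs f) G \<longrightarrow> G constant_on D))"

end

theory Submission
  imports Defs
begin

text \<open>
Let \<open>F j\<close> be the iterates, and let \<open>z\<close> and \<open>w\<close> be points of \<open>D\<close> that no \<open>F j\<close> identifies. For every
\<open>j\<close> there is a complex geodesic \<open>\<phi> j\<close> with \<open>\<phi> j 0 = F j z\<close> and \<open>\<phi> j (r j) = F j w\<close>, where
\<open>0 < r j < 1\<close>, and a Lempert projection onto it with left inverse \<open>\<rho> j\<close>
(\<open>lempert_device_exists\<close>). The map \<open>g j = \<rho> (j + 1) \<circ> f (j + 1) \<circ> \<phi> j\<close> is then a holomorphic self-map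
of the disc that fixes \<open>0\<close> and takes \<open>r j\<close> to \<open>r (j + 1)\<close>, so that the \<open>r j\<close> decrease by the Schwarz
lemma. Its image lies in \<open>\<rho> (j + 1) (X)\<close>, hence in a domain of Bloch radius below \<open>C\<close>, and therefore
omits a point \<open>p j\<close> with \<open>|p j| \<le> tanh C\<close>. If the \<open>r j\<close> did not tend to \<open>0\<close>, a limit of the \<open>g j\<close>
would be a rotation by the equality case of the Schwarz lemma, while by Hurwitz's theorem it would
omit a limit of the \<open>p j\<close>, which is again a point of the disc: a contradiction
(\<open>omitting_iteration_tendsto_0\<close>). So \<open>r j \<rightarrow> 0\<close>, and the Schwarz lemma for \<open>\<phi> j\<close> gives
\<open>F j z - F j w \<rightarrow> 0\<close>: every limit takes the same value at \<open>z\<close> and at \<open>w\<close>.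

Most of the work is the existence of enough Lempert projection devices, which is Lempert's theorem for
bounded convex domains. It is obtained by duality. Move \<open>z\<close> to \<open>0\<close> and write \<open>E\<close> for the domain and
\<open>w\<close> for the other point. Among the holomorphic discs \<open>\<phi>\<close> in \<open>E\<close> with \<open>\<phi> 0 = 0\<close> and \<open>\<phi> r = w\<close>, Montel's
theorem yields one with the least possible \<open>r\<close> (\<open>extremal_disc_exists\<close>). By minimality no disc that
is holomorphic up to the unit circle and takes \<open>0\<close> to \<open>0\<close> and \<open>r\<close> to \<open>w\<close> maps the circle into \<open>E\<close>
(\<open>extremal_disc_touches\<close>). The Hahn-Banach theorem turns this into a functional \<open>L\<close> on the continuous
maps of the circle whose real part is at most \<open>1\<close> on the maps into \<open>E\<close> and at least \<open>1\<close> on these discs,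
and which annihilates the holomorphic maps that vanish at \<open>0\<close> and \<open>r\<close>
(\<open>dual_functional_exists\<close>).

Multiplied by \<open>|\<tau> - r|^2\<close>, the functional \<open>L\<close> becomes integration against a holomorphic map \<open>h\<close>, the
dual map. Testing \<open>L\<close> on the maps from \<open>\<phi>\<close> towards a point \<open>z\<close> of \<open>E\<close>, weighted by Poisson
kernels, gives an inequality inside the disc (\<open>dual_inequality\<close>) which expresses that the real part
of \<open><h \<zeta>, z - \<phi> \<zeta>> / \<zeta>\<close> has boundary values \<open>\<le> 0\<close>: at \<open>\<phi> \<zeta>\<close> the domain \<open>E\<close> lies on one side of the
real hyperplane defined by \<open>h \<zeta> / \<zeta>\<close>. So the function \<open>\<zeta> \<mapsto> <h \<zeta>, z - \<phi> \<zeta>>\<close> should have exactly one zero in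
the disc, and \<open>\<rho> z\<close> is this zero; its fibres are hyperplane sections by construction, and
\<open>\<rho> (\<phi> \<zeta>) = \<zeta>\<close>.

The inequality is not strict, and a zero might sit on the boundary. After subtracting \<open>\<eta> * \<zeta>\<close> with
\<open>\<eta> > 0\<close> the function points strictly inwards on circles near the boundary, and Rouche's theorem yields
one simple zero. It depends holomorphically on \<open>z\<close> and is \<open>0\<close> for \<open>z = 0\<close>; normality and the maximum
principle keep it away from the unit circle as \<open>\<eta>\<close> tends to \<open>0\<close> (\<open>single_zero_of_dual_map\<close>). A
holomorphic retraction onto a disc makes that disc a geodesic, since holomorphic maps into the unit disc
contract every chain of discs (\<open>kobayashi_dist_retract\<close>).
\<close>

section \<open>The Poincare distance of the disc\<close>

definition pseudo_dist :: "complex \<Rightarrow> complex \<Rightarrow> real"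
  where "pseudo_dist a b = cmod (Moebius_function 0 b a)"

lemma poincare_dist_eq: "poincare_dist a b = artanh (pseudo_dist a b)"
  by (simp add: poincare_dist_def pseudo_dist_def)

lemma pseudo_dist_nonneg: "0 \<le> pseudo_dist a b" by (simp add: pseudo_dist_def)

lemma pseudo_dist_lt_1: "a \<in> \<bbbD> \<Longrightarrow> b \<in> \<bbbD> \<Longrightarrow> pseudo_dist a b < 1"
  by (simp add: pseudo_dist_def Moebius_function_norm_lt_1)

lemma pseudo_dist_commute: "pseudo_dist a b = pseudo_dist b a"
proof -
  have "1 - cnj a * b = cnj (1 - cnj b * a)" by simp
  then have "cmod (1 - cnj a * b) = cmod (1 - cnj b * a)" by (metis complex_mod_cnj)
  then show ?thesis by (simp add: pseudo_dist_def Moebius_function_simple norm_divide norm_minus_commute)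
qed

lemma artanh_real_mono: "0 \<le> x \<Longrightarrow> x \<le> y \<Longrightarrow> y < 1 \<Longrightarrow> artanh x \<le> artanh (y::real)"
  by (auto simp: artanh_def intro!: divide_right_mono frac_le)

lemma artanh_real_add:
  assumes "0 \<le> x" "x < 1" "0 \<le> y" "y < (1::real)"
  shows "artanh ((x + y) / (1 + x * y)) = artanh x + artanh y"
proof -
  have pos: "0 < 1 + x * y" using assms by (simp add: add_pos_nonneg)
  have "1 + (x + y) / (1 + x * y) = (1 + x) * (1 + y) / (1 + x * y)"
    "1 - (x + y) / (1 + x * y) = (1 - x) * (1 - y) / (1 + x * y)"
    using pos by (simp_all add: field_simps)
  then have "(1 + (x + y) / (1 + x * y)) / (1 - (x + y) / (1 + x * y)) = ((1 + x) / (1 - x)) * ((1 + y) / (1 - y))"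
    using pos by simp
  moreover have "ln (((1 + x) / (1 - x)) * ((1 + y) / (1 - y))) = ln ((1 + x) / (1 - x)) + ln ((1 + y) / (1 - y))"
    using assms by (intro ln_mult_pos) auto
  ultimately show ?thesis unfolding artanh_def by (simp only: add_divide_distrib)
qed

text \<open>Conjugating by the automorphisms that move \<open>b\<close> and \<open>f b\<close> to \<open>0\<close> reduces this to the Schwarz lemma.\<close>

theorem Schwarz_Pick:
  assumes f: "f holomorphic_on \<bbbD>" "f ` \<bbbD> \<subseteq> \<bbbD>" and a: "a \<in> \<bbbD>" and b: "b \<in> \<bbbD>"
  shows "pseudo_dist (f a) (f b) \<le> pseudo_dist a b"
proof -
  have fb: "f b \<in> \<bbbD>" using f b by blast
  define g where "g = (\<lambda>\<zeta>. Moebius_function 0 (f b) (f (Moebius_function 0 (- b) \<zeta>)))"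
  have M: "Moebius_function 0 (- b) ` \<bbbD> \<subseteq> \<bbbD>" using b by (auto intro!: Moebius_function_norm_lt_1)
  have "(f \<circ> Moebius_function 0 (- b)) holomorphic_on \<bbbD>"
    by (rule holomorphic_on_compose_gen[OF Moebius_function_holomorphic f(1) M]) (use b in simp)
  moreover have "(f \<circ> Moebius_function 0 (- b)) ` \<bbbD> \<subseteq> \<bbbD>" using f(2) M by fastforce
  ultimately have g: "g holomorphic_on \<bbbD>"
    using holomorphic_on_compose_gen[OF _ Moebius_function_holomorphic[of "f b" 0]] fb
    by (fastforce simp: g_def o_def)
  have "cmod (g (Moebius_function 0 b a)) \<le> cmod (Moebius_function 0 b a)"
  proof (rule Schwarz_Lemma(1)[OF g])
    show "g 0 = 0" by (simp add: g_def Moebius_function_of_zero Moebius_function_eq_zero)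
    show "cmod (g z) < 1" if "cmod z < 1" for z
    proof -
      have "f (Moebius_function 0 (- b) z) \<in> \<bbbD>" using M f(2) that by fastforce
      then show ?thesis unfolding g_def using fb by (intro Moebius_function_norm_lt_1) auto
    qed
    show "cmod (Moebius_function 0 b a) < 1" using a b by (intro Moebius_function_norm_lt_1) auto
  qed
  moreover have "Moebius_function 0 (- b) (Moebius_function 0 b a) = a"
    using a b by (intro Moebius_function_compose) auto
  ultimately show ?thesis by (simp add: g_def pseudo_dist_def)
qed

lemma poincare_dist_contraction:
  assumes f: "f holomorphic_on \<bbbD>" "f ` \<bbbD> \<subseteq> \<bbbD>" and a: "a \<in> \<bbbD>" and b: "b \<in> \<bbbD>"
  shows "poincare_dist (f a) (f b) \<le> poincare_dist a b"
  unfolding poincare_dist_eq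
  by (intro artanh_real_mono Schwarz_Pick[OF assms] pseudo_dist_nonneg pseudo_dist_lt_1 a b)

text \<open>The right-hand side is the sum in the addition law of \<open>tanh\<close>. The estimate comes from the identity
\<open>1 - (pseudo_dist x y)^2 = (1 - |x|^2) (1 - |y|^2) / |1 - cnj y * x|^2\<close> and \<open>|1 - cnj y * x| \<le> 1 + |x| |y|\<close>.\<close>

lemma pseudo_dist_le_sum:
  assumes x: "x \<in> \<bbbD>" and y: "y \<in> \<bbbD>"
  shows "pseudo_dist x y \<le> (cmod x + cmod y) / (1 + cmod x * cmod y)"
proof -
  define A where "A = cmod x"
  define B where "B = cmod y"
  have AB: "0 \<le> A" "A < 1" "0 \<le> B" "B < 1" using x y by (auto simp: A_def B_def)
  have pos: "0 < 1 + A * B" using AB by (simp add: add_pos_nonneg)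
  define N where "N = cmod (1 - cnj y * x)"
  have "cmod (cnj y * x) = B * A" by (simp add: norm_mult A_def B_def)
  moreover have "B * A < 1 * 1" using AB by (intro mult_strict_mono') auto
  ultimately have "1 - cnj y * x \<noteq> 0" by (metis norm_one right_minus_eq less_irrefl mult_1)
  then have N: "0 < N" by (simp add: N_def)
  have N_le: "N \<le> 1 + A * B"
    unfolding N_def using norm_triangle_ineq4[of 1 "cnj y * x"] by (simp add: norm_mult A_def B_def mult.commute)
  have "(cmod (x - y))\<^sup>2 = N\<^sup>2 - (1 - A\<^sup>2) * (1 - B\<^sup>2)"
    unfolding N_def A_def B_def cmod_power2 by (simp add: algebra_simps power2_eq_square)
  moreover have "pseudo_dist x y = cmod (x - y) / N"
    unfolding pseudo_dist_def Moebius_function_simple norm_divide N_def ..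
  ultimately have "(pseudo_dist x y)\<^sup>2 = 1 - (1 - A\<^sup>2) * (1 - B\<^sup>2) / N\<^sup>2"
    using N by (simp add: power_divide diff_divide_distrib)
  also have "\<dots> \<le> 1 - (1 - A\<^sup>2) * (1 - B\<^sup>2) / (1 + A * B)\<^sup>2"
    using AB N N_le by (intro diff_left_mono divide_left_mono power_mono mult_nonneg_nonneg mult_pos_pos)
      (auto simp: power_le_one)
  also have "\<dots> = ((A + B) / (1 + A * B))\<^sup>2"
  proof -
    have "(1 + A * B)\<^sup>2 - (1 - A\<^sup>2) * (1 - B\<^sup>2) = (A + B)\<^sup>2"
      by (simp add: power2_eq_square algebra_simps)
    moreover have "(1 + A * B)\<^sup>2 \<noteq> 0" using pos by simp
    ultimately show ?thesis by (simp add: power_divide diff_divide_distrib[symmetric] diff_divide_eq_iff)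
  qed
  finally have "pseudo_dist x y \<le> (A + B) / (1 + A * B)"
    by (rule power2_le_imp_le) (use AB pos in simp)
  then show ?thesis by (simp only: A_def B_def)
qed

text \<open>An automorphism of the disc moves the middle point to \<open>0\<close>; there the estimate of the pseudo-hyperbolic
distance and the addition law of \<open>artanh\<close> apply.\<close>

lemma poincare_dist_triangle:
  assumes a: "a \<in> \<bbbD>" and b: "b \<in> \<bbbD>" and c: "c \<in> \<bbbD>"
  shows "poincare_dist a c \<le> poincare_dist a b + poincare_dist b c"
proof -
  define x where "x = Moebius_function 0 b a"
  define y where "y = Moebius_function 0 b c"
  have xy: "x \<in> \<bbbD>" "y \<in> \<bbbD>" using assms by (auto simp: x_def y_def intro!: Moebius_function_norm_lt_1)
  have inv: "Moebius_function 0 (- b) x = a" "Moebius_function 0 (- b) y = c"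
    unfolding x_def y_def using assms by (auto intro!: Moebius_function_compose)
  have "pseudo_dist a c \<le> pseudo_dist x y"
    unfolding inv[symmetric]
    by (rule Schwarz_Pick[OF Moebius_function_holomorphic _ xy])
       (use b in \<open>auto intro!: Moebius_function_norm_lt_1\<close>)
  also have "\<dots> \<le> (cmod x + cmod y) / (1 + cmod x * cmod y)" by (rule pseudo_dist_le_sum[OF xy])
  finally have le: "pseudo_dist a c \<le> (cmod x + cmod y) / (1 + cmod x * cmod y)" .
  have "poincare_dist a c \<le> artanh ((cmod x + cmod y) / (1 + cmod x * cmod y))"
    unfolding poincare_dist_eq
  proof (rule artanh_real_mono[OF pseudo_dist_nonneg le])
    have "0 < (1 - cmod x) * (1 - cmod y)" using xy by simp
    then have "cmod x + cmod y < 1 + cmod x * cmod y" by (simp add: algebra_simps)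
    moreover have "0 < 1 + cmod x * cmod y" by (simp add: add_pos_nonneg)
    ultimately show "(cmod x + cmod y) / (1 + cmod x * cmod y) < 1" by simp
  qed
  also have "\<dots> = artanh (cmod x) + artanh (cmod y)" using xy by (intro artanh_real_add) auto
  also have "\<dots> = poincare_dist a b + poincare_dist b c"
  proof -
    have "pseudo_dist a b = cmod x" "pseudo_dist b c = cmod y"
      using pseudo_dist_commute[of b c] by (simp_all add: x_def y_def pseudo_dist_def)
    then show ?thesis unfolding poincare_dist_eq by simp
  qed
  finally show ?thesis .
qed

lemma poincare_dist_self: "poincare_dist a a = 0"
  by (simp add: poincare_dist_def Moebius_function_eq_zero)

lemma poincare_dist_zero: "poincare_dist a 0 = artanh (cmod a)"
  by (simp add: poincare_dist_def Moebius_function_simple)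

section \<open>Separation of a point from a convex set\<close>

definition sublinear :: "('a::real_vector \<Rightarrow> real) \<Rightarrow> bool"
  where "sublinear q \<longleftrightarrow>
    (\<forall>x y. q (x + y) \<le> q x + q y) \<and> (\<forall>t\<ge>0. \<forall>x. q (t *\<^sub>R x) = t * q x)"

lemma sublinear_add: "sublinear q \<Longrightarrow> q (x + y) \<le> q x + q y"
  and sublinear_scale: "sublinear q \<Longrightarrow> 0 \<le> t \<Longrightarrow> q (t *\<^sub>R x) = t * q x"
  by (auto simp: sublinear_def)

lemma sublinear_zero: "sublinear q \<Longrightarrow> q 0 = 0"
  using sublinear_scale[of q 0 0] by simp

lemma sublinear_minus: "sublinear q \<Longrightarrow> - q (- x) \<le> q x"
  using sublinear_add[of q x "- x"] sublinear_zero[of q] by simp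

text \<open>The function \<open>s y = inf {q (y + t * x) - t * q x | t \<ge> 0}\<close> is the largest sublinear function below \<open>q\<close>
with \<open>s (- x) \<le> - q x\<close>. A linear function below it agrees with \<open>q\<close> at \<open>x\<close>.\<close>

lemma sublinear_lower_at:
  fixes q :: "'a::real_vector \<Rightarrow> real"
  assumes q: "sublinear q"
  obtains s where "sublinear s" "\<And>y. s y \<le> q y" "s (- x) \<le> - q x"
proof -
  define e where "e = (\<lambda>y t. q (y + t *\<^sub>R x) - t * q x)"
  define s where "s = (\<lambda>y. INF t\<in>{0..}. e y t)"
  have lower: "- q (- y) \<le> e y t" if "0 \<le> t" for y t
    using sublinear_add[OF q, of "y + t *\<^sub>R x" "- y"] sublinear_scale[OF q that, of x]
    by (simp add: e_def)
  have bdd: "bdd_below (e y ` {0..})" for y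
    by (rule bdd_belowI2[of _ "- q (- y)"]) (use lower in auto)
  have s_le: "s y \<le> e y t" if "0 \<le> t" for y t
    unfolding s_def by (rule cINF_lower[OF bdd]) (use that in auto)
  have le_s: "a \<le> s y" if "\<And>t. 0 \<le> t \<Longrightarrow> a \<le> e y t" for a y
    unfolding s_def by (rule cINF_greatest) (use that in auto)
  have add: "s (y + z) \<le> s y + s z" for y z
  proof -
    have "s (y + z) \<le> e y t + e z u" if "0 \<le> t" "0 \<le> u" for t u
    proof -
      have "s (y + z) \<le> e (y + z) (t + u)" using s_le that by simp
      also have "\<dots> \<le> e y t + e z u"
        using sublinear_add[OF q, of "y + t *\<^sub>R x" "z + u *\<^sub>R x"]
        by (simp add: e_def algebra_simps)
      finally show ?thesis .
    qed
    then have "s (y + z) - e y t \<le> s z" if "0 \<le> t" for t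
      by (intro le_s) (use that in \<open>auto simp: algebra_simps\<close>)
    then have "s (y + z) - s z \<le> s y"
      by (intro le_s) (auto simp: algebra_simps)
    then show ?thesis by simp
  qed
  have half: "s (c *\<^sub>R y) \<le> c * s y" if "0 < c" for c y
  proof -
    have "s (c *\<^sub>R y) / c \<le> e y t" if "0 \<le> t" for t
    proof -
      have "s (c *\<^sub>R y) \<le> e (c *\<^sub>R y) (c * t)" using s_le that \<open>0 < c\<close> by simp
      also have "\<dots> = c * e y t"
        using sublinear_scale[OF q, of c "y + t *\<^sub>R x"] \<open>0 < c\<close>
        by (simp add: e_def algebra_simps)
      finally show ?thesis using \<open>0 < c\<close> by (simp add: field_simps)
    qed
    then have "s (c *\<^sub>R y) / c \<le> s y" by (rule le_s)
    then show ?thesis using that by (simp add: field_simps)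
  qed
  have zero: "s 0 = 0"
    by (auto simp: s_def e_def sublinear_scale[OF q])
  have scale: "s (c *\<^sub>R y) = c * s y" if "0 \<le> c" for c y
  proof (cases "c = 0")
    case False
    with that have c: "0 < c" by simp
    have "s y \<le> inverse c * s (c *\<^sub>R y)"
      using half[of "inverse c" "c *\<^sub>R y"] c by simp
    then have "c * s y \<le> s (c *\<^sub>R y)"
      using c by (simp add: field_simps)
    with half[OF c, of y] show ?thesis by simp
  qed (use zero in simp)
  show ?thesis
  proof
    show "sublinear s" using add scale by (auto simp: sublinear_def)
    show "s y \<le> q y" for y using s_le[of 0 y] by (simp add: e_def)
    show "s (- x) \<le> - q x"
      using s_le[of 1 "- x"] sublinear_zero[OF q] by (simp add: e_def)
  qed
qed

text \<open>A sublinear function that is minimal among those below \<open>q\<close> is odd, because lowering it at a point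
leaves it unchanged; an odd sublinear function is linear. Zorn's lemma provides the minimal one.\<close>

lemma exists_linear_le_sublinear:
  fixes q :: "'a::real_vector \<Rightarrow> real"
  assumes q: "sublinear q"
  obtains l where "linear l" "\<And>x. l x \<le> q x"
proof -
  define A where "A = {p. sublinear p \<and> p \<le> q}"
  have "\<exists>m\<in>A. \<forall>a\<in>A. m \<ge> a \<longrightarrow> a = m"
  proof (rule predicate_Zorn)
    show "partial_order_on A (relation_of (\<ge>) A)"
      by (rule partial_order_on_relation_ofI) auto
  next
    fix C assume C: "C \<in> Chains (relation_of (\<ge>) A)"
    show "\<exists>u\<in>A. \<forall>a\<in>C. u \<le> a"
    proof (cases "C = {}")
      case True
      then show ?thesis using q by (auto simp: A_def)
    next
      case False
      have CA: "C \<subseteq> A" and tot: "\<And>a b. a \<in> C \<Longrightarrow> b \<in> C \<Longrightarrow> a \<le> b \<or> b \<le> a"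
        using C by (auto simp: Chains_def relation_of_def)
      define u where "u = (\<lambda>x. INF p\<in>C. p x)"
      have bdd: "bdd_below ((\<lambda>p. p x) ` C)" for x
      proof (rule bdd_belowI2[of _ "- q (- x)"])
        fix p assume "p \<in> C"
        then have p: "sublinear p" "p \<le> q" using CA by (auto simp: A_def)
        show "- q (- x) \<le> p x"
          using sublinear_minus[OF p(1), of x] p(2)[unfolded le_fun_def, rule_format, of "- x"]
          by linarith
      qed
      have u_le: "u x \<le> p x" if "p \<in> C" for p x
        unfolding u_def by (rule cINF_lower[OF bdd that])
      have le_u: "a \<le> u x" if "\<And>p. p \<in> C \<Longrightarrow> a \<le> p x" for a x
        unfolding u_def by (rule cINF_greatest[OF False that])
      have "u (x + y) \<le> u x + u y" for x y
      proof -
        have "u (x + y) \<le> p x + p' y" if "p \<in> C" "p' \<in> C" for p p'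
        proof -
          obtain p'' where p'': "p'' \<in> C" "p'' \<le> p" "p'' \<le> p'"
            using tot \<open>p \<in> C\<close> \<open>p' \<in> C\<close> by blast
          have "u (x + y) \<le> p'' (x + y)" using u_le p'' by blast
          also have "\<dots> \<le> p'' x + p'' y" using CA p'' by (auto simp: A_def intro: sublinear_add)
          also have "\<dots> \<le> p x + p' y" using p'' by (auto simp: le_fun_def intro: add_mono)
          finally show ?thesis .
        qed
        then have *: "u (x + y) - p x \<le> p' y" if "p \<in> C" "p' \<in> C" for p p'
          using that by (metis add.commute diff_le_eq)
        have "u (x + y) - p x \<le> u y" if "p \<in> C" for p
          by (rule le_u) (rule *[OF that])
        then have "u (x + y) - u y \<le> u x"
          by (intro le_u) (auto simp: algebra_simps)
        then show ?thesis by simp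
      qed
      moreover have "u (t *\<^sub>R x) = t * u x" if "0 \<le> t" for t x
      proof (cases "t = 0")
        case True
        have "(\<lambda>p. p (0::'a)) ` C = {0::real}"
        proof -
          have "p 0 = 0" if "p \<in> C" for p
            using that CA by (auto simp: A_def sublinear_zero)
          then have "(\<lambda>p. p (0::'a)) ` C = (\<lambda>p. 0) ` C" by (intro image_cong) auto
          then show ?thesis using False by auto
        qed
        then show ?thesis using True by (simp add: u_def)
      next
        case t: False
        with that have t: "0 < t" by simp
        have eq: "p (t *\<^sub>R x) = t * p x" if "p \<in> C" for p
          using that CA t by (auto simp: A_def sublinear_scale)
        have "u (t *\<^sub>R x) \<le> t * p x" if "p \<in> C" for p
          using u_le[OF that, of "t *\<^sub>R x"] eq[OF that] by simp
        then have "u (t *\<^sub>R x) / t \<le> u x"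
          by (intro le_u) (use t in \<open>auto simp: field_simps\<close>)
        moreover have "t * u x \<le> p (t *\<^sub>R x)" if "p \<in> C" for p
          using t u_le[OF that, of x] eq[OF that] by simp
        then have "t * u x \<le> u (t *\<^sub>R x)" by (rule le_u)
        ultimately show ?thesis using t by (simp add: field_simps)
      qed
      moreover have "u \<le> q"
      proof -
        obtain p where "p \<in> C" using False by auto
        then have "u \<le> p" "p \<le> q" using u_le CA by (auto simp: A_def le_fun_def)
        then show ?thesis by simp
      qed
      ultimately have "u \<in> A" by (auto simp: A_def sublinear_def)
      then show ?thesis using u_le by (auto simp: le_fun_def)
    qed
  qed
  then obtain m where m: "sublinear m" "m \<le> q" and min: "\<And>a. a \<in> A \<Longrightarrow> a \<le> m \<Longrightarrow> a = m"
    by (auto simp: A_def)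
  have minus: "m (- x) = - m x" for x
  proof -
    obtain s where s: "sublinear s" "\<And>y. s y \<le> m y" "s (- x) \<le> - m x"
      using sublinear_lower_at[OF m(1)] by blast
    have "s \<le> m" using s(2) by (simp add: le_fun_def)
    moreover have "s \<in> A" using s(1) \<open>s \<le> m\<close> m(2) by (auto simp: A_def)
    ultimately have "s = m" using min by blast
    then show ?thesis using s(3) sublinear_minus[OF m(1), of x] by simp
  qed
  have "linear m"
  proof (rule linearI)
    show "m (x + y) = m x + m y" for x y
      using sublinear_add[OF m(1), of x y] sublinear_add[OF m(1), of "- x" "- y"] minus[of "x + y"]
      by (simp add: minus)
    show "m (t *\<^sub>R x) = t *\<^sub>R m x" for t x
    proof (cases "0 \<le> t")
      case False
      then have "m (t *\<^sub>R x) = - m ((- t) *\<^sub>R x)" using minus[of "(- t) *\<^sub>R x"] by simp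
      also have "\<dots> = t * m x" using sublinear_scale[OF m(1), of "- t" x] False by simp
      finally show ?thesis by simp
    qed (use sublinear_scale[OF m(1)] in simp)
  qed
  with m(2) that show ?thesis by (auto simp: le_fun_def)
qed

text \<open>The point \<open>x0\<close> has Minkowski functional at least \<open>1\<close>, and a linear function below this functional can be
chosen to agree with it at \<open>x0\<close>.\<close>

lemma separate_point_from_absorbing_convex:
  fixes C :: "'a::real_vector set"
  assumes conv: "convex C" and zero: "0 \<in> C" and x0: "x0 \<notin> C"
    and absorb: "\<And>x. \<exists>t>0. x /\<^sub>R t \<in> C"
  obtains l :: "'a \<Rightarrow> real" where "linear l" "\<And>x. x \<in> C \<Longrightarrow> l x \<le> 1" "1 \<le> l x0"
proof -
  define T where "T = (\<lambda>x. {t. 0 < t \<and> x /\<^sub>R t \<in> C})"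
  \<comment> \<open>The Minkowski functional of \<open>C\<close>.\<close>
  define g where "g = (\<lambda>x. Inf (T x))"
  have ne: "T x \<noteq> {}" for x using absorb[of x] by (auto simp: T_def)
  have bdd: "bdd_below (T x)" for x by (rule bdd_belowI[of _ 0]) (auto simp: T_def)
  have g_le: "g x \<le> t" if "t \<in> T x" for x t
    unfolding g_def using bdd that by (rule cInf_lower[rotated])
  have le_g: "a \<le> g x" if "\<And>t. t \<in> T x \<Longrightarrow> a \<le> t" for a x
    unfolding g_def using ne that by (rule cInf_greatest)
  have g0: "g 0 = 0"
  proof (rule antisym)
    show "g 0 \<le> 0"
      by (rule field_le_epsilon) (use g_le[of _ 0] zero in \<open>auto simp: T_def\<close>)
    show "0 \<le> g 0" by (rule le_g) (auto simp: T_def)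
  qed
  have add: "t + u \<in> T (x + y)" if "t \<in> T x" "u \<in> T y" for t u x y
  proof -
    have pos: "0 < t" "0 < u" using that by (auto simp: T_def)
    have "(t / (t + u)) *\<^sub>R (x /\<^sub>R t) + (u / (t + u)) *\<^sub>R (y /\<^sub>R u) \<in> C"
      using that pos by (intro convexD[OF conv]) (auto simp: T_def simp flip: add_divide_distrib)
    moreover have "(t / (t + u)) *\<^sub>R (x /\<^sub>R t) + (u / (t + u)) *\<^sub>R (y /\<^sub>R u) = (x + y) /\<^sub>R (t + u)"
      using pos by (simp add: scaleR_add_right inverse_eq_divide)
    ultimately show ?thesis using pos by (simp add: T_def)
  qed
  have half: "g (c *\<^sub>R x) \<le> c * g x" if c: "0 < c" for c x
  proof -
    have "g (c *\<^sub>R x) / c \<le> t" if "t \<in> T x" for t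
    proof -
      have "c * t \<in> T (c *\<^sub>R x)" using that c by (simp add: T_def field_simps)
      then show ?thesis using g_le[of "c * t" "c *\<^sub>R x"] c by (simp add: field_simps)
    qed
    then have "g (c *\<^sub>R x) / c \<le> g x" by (rule le_g)
    then show ?thesis using c by (simp add: field_simps)
  qed
  have "sublinear g"
    unfolding sublinear_def
  proof (intro conjI allI impI)
    fix x y
    have "g (x + y) - t \<le> g y" if "t \<in> T x" for t
      by (rule le_g) (metis add.commute diff_le_eq g_le[OF add[OF that]])
    then have "g (x + y) - g y \<le> g x" by (intro le_g) (auto simp: algebra_simps)
    then show "g (x + y) \<le> g x + g y" by simp
  next
    fix c :: real and x assume "0 \<le> c"
    show "g (c *\<^sub>R x) = c * g x"
    proof (cases "c = 0")
      case False
      with \<open>0 \<le> c\<close> have c: "0 < c" by simp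
      have "g x \<le> inverse c * g (c *\<^sub>R x)"
        using half[of "inverse c" "c *\<^sub>R x"] c by simp
      then have "c * g x \<le> g (c *\<^sub>R x)" using c by (simp add: field_simps)
      with half[OF c, of x] show ?thesis by simp
    qed (use g0 in simp)
  qed
  then obtain s where s: "sublinear s" "\<And>y. s y \<le> g y" "s (- x0) \<le> - g x0"
    using sublinear_lower_at by blast
  obtain l where l: "linear l" "\<And>x. l x \<le> s x"
    using exists_linear_le_sublinear[OF s(1)] by blast
  show ?thesis
  proof (rule that[of l])
    show "linear l" by fact
    show "l x \<le> 1" if "x \<in> C" for x
    proof -
      have "g x \<le> 1" using g_le[of 1 x] that by (simp add: T_def)
      then show ?thesis using l(2)[of x] s(2)[of x] by linarith
    qed
    have "1 \<le> g x0"
    proof (rule le_g)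
      fix t assume t: "t \<in> T x0"
      show "1 \<le> t"
      proof (rule ccontr)
        assume "\<not> 1 \<le> t"
        with t have "t *\<^sub>R (x0 /\<^sub>R t) + (1 - t) *\<^sub>R 0 \<in> C"
          by (intro convexD[OF conv _ zero]) (auto simp: T_def)
        then show False using t x0 by (simp add: T_def)
      qed
    qed
    moreover have "l (- x0) = - l x0" using l(1) by (simp add: linear_neg)
    ultimately show "1 \<le> l x0" using l(2)[of "- x0"] s(3) by linarith
  qed
qed

section \<open>Holomorphic discs in complex Euclidean space\<close>

definition vec_holomorphic_on :: "(complex \<Rightarrow> complex^'n) \<Rightarrow> complex set \<Rightarrow> bool"
  where "vec_holomorphic_on f S \<longleftrightarrow> (\<forall>i. (\<lambda>z. f z $ i) holomorphic_on S)"

text \<open>The pairing is bilinear, not Hermitian, so that it is holomorphic in both arguments and for \<open>a \<noteq> 0\<close>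
the level sets of \<open>cdot a\<close> are the complex hyperplanes.\<close>

definition cdot :: "complex^'n \<Rightarrow> complex^'n \<Rightarrow> complex"
  where "cdot a z = (\<Sum>i\<in>UNIV. a $ i * z $ i)"

lemma cdot_simps [simp]:
  "cdot a (x + y) = cdot a x + cdot a y" "cdot a (x - y) = cdot a x - cdot a y"
  "cdot a (- x) = - cdot a x" "cdot a 0 = 0" "cdot 0 x = 0"
  "cdot a (c *s x) = c * cdot a x" "cdot (c *s a) x = c * cdot a x" "cdot a (t *\<^sub>R x) = of_real t * cdot a x"
  by (simp_all add: cdot_def algebra_simps sum.distrib sum_subtractf sum_negf sum_distrib_left
      scaleR_conv_of_real[where 'a=complex])

lemma inner_eq_Re_cdot: "a \<bullet> z = Re (cdot (\<chi> i. cnj (a $ i)) z)" for a z :: "complex^'n"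
  by (simp add: inner_vec_def cdot_def inner_complex_def)

lemma vec_holomorphic_on_subset:
  "vec_holomorphic_on f S \<Longrightarrow> T \<subseteq> S \<Longrightarrow> vec_holomorphic_on f T"
  by (auto simp: vec_holomorphic_on_def intro: holomorphic_on_subset)

lemma vec_holomorphic_on_imp_continuous_on:
  "vec_holomorphic_on f S \<Longrightarrow> continuous_on S f"
  using continuous_on_vec_lambda[of S "\<lambda>i z. f z $ i"]
  by (auto simp: vec_holomorphic_on_def dest: holomorphic_on_imp_continuous_on)

lemma holomorphic_on_cdot [holomorphic_intros]:
  assumes "vec_holomorphic_on f S" "vec_holomorphic_on g S"
  shows "(\<lambda>z. cdot (f z) (g z)) holomorphic_on S"
  using assms unfolding cdot_def vec_holomorphic_on_def by (intro holomorphic_intros) auto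

lemma vec_holomorphic_on_const: "vec_holomorphic_on (\<lambda>z. a) S"
  by (simp add: vec_holomorphic_on_def)

lemma vec_holomorphic_on_compose:
  assumes "vec_holomorphic_on f T" "g holomorphic_on S" "g ` S \<subseteq> T"
  shows "vec_holomorphic_on (\<lambda>z. f (g z)) S"
  using assms holomorphic_on_compose_gen[of g S _ T]
  by (auto simp: vec_holomorphic_on_def o_def)

lemma vec_holomorphic_on_add:
  "vec_holomorphic_on f S \<Longrightarrow> vec_holomorphic_on g S \<Longrightarrow> vec_holomorphic_on (\<lambda>z. f z + g z) S"
  by (auto simp: vec_holomorphic_on_def intro!: holomorphic_intros)

lemma vec_holomorphic_on_diff:
  "vec_holomorphic_on f S \<Longrightarrow> vec_holomorphic_on g S \<Longrightarrow> vec_holomorphic_on (\<lambda>z. f z - g z) S"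
  by (auto simp: vec_holomorphic_on_def intro!: holomorphic_intros)

lemma vec_holomorphic_on_scale:
  "c holomorphic_on S \<Longrightarrow> vec_holomorphic_on g S \<Longrightarrow> vec_holomorphic_on (\<lambda>z. c z *s g z) S"
  by (auto simp: vec_holomorphic_on_def intro!: holomorphic_intros)

lemma norm_complex_scale: "norm (c *s x) = norm c * norm x" for x :: "complex^'n"
  by (simp add: norm_vec_def L2_set_right_distrib norm_mult)

lemma scaleR_eq_complex_scale: "x *\<^sub>R v = of_real x *s v" for v :: "complex^'n"
  by (simp add: vec_eq_iff scaleR_conv_of_real[where 'a=complex])

lemma sum_scale_axis: "(\<Sum>i\<in>UNIV. v $ i *s axis i 1) = v" for v :: "complex^'n"
proof (rule vec_eq_iff[THEN iffD2, rule_format])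
  fix j
  have "(\<Sum>i\<in>UNIV. v $ i *s axis i 1) $ j = (\<Sum>i\<in>UNIV. if i = j then v $ j else 0)"
    unfolding sum_component by (rule sum.cong) (auto simp: axis_def)
  then show "(\<Sum>i\<in>UNIV. v $ i *s axis i 1) $ j = v $ j" by simp
qed

lemma open_convex_complex_line_slice:
  fixes E :: "(complex^'n) set"
  assumes "open E" "convex E"
  shows "open {t. t *s w \<in> E}" "convex {t. t *s w \<in> E}"
proof -
  have lin: "linear (\<lambda>t. t *s w)"
    by (rule linearI) (simp_all add: vec_eq_iff algebra_simps scaleR_conv_of_real[where 'a=complex])
  have eq: "{t. t *s w \<in> E} = (\<lambda>t. t *s w) -` E" by auto
  have "continuous_on UNIV (\<lambda>t. t *s w)"
    using lin linear_continuous_on linear_conv_bounded_linear by blast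
  then show "open {t. t *s w \<in> E}" unfolding eq using assms(1) by (simp add: open_vimage)
  show "convex {t. t *s w \<in> E}" unfolding eq by (rule convex_linear_vimage[OF lin assms(2)])
qed

lemma uniform_limit_at_convergent_points:
  fixes g :: "complex \<Rightarrow> complex"
  assumes un: "uniform_limit K F g sequentially" and g: "continuous_on K g"
    and a: "a \<longlonglongrightarrow> b" "\<And>n. a n \<in> K" "b \<in> K"
  shows "(\<lambda>n. F n (a n)) \<longlonglongrightarrow> g b"
proof -
  have "(\<lambda>n. g (a n)) \<longlonglongrightarrow> g b"
    by (rule continuous_on_tendsto_compose[OF g a(1,3)]) (use a(2) in simp)
  moreover have "(\<lambda>n. F n (a n) - g (a n)) \<longlonglongrightarrow> 0"
  proof (rule tendstoI)
    fix e :: real assume "0 < e"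
    from uniform_limitD[OF un this]
    show "\<forall>\<^sub>F n in sequentially. dist (F n (a n) - g (a n)) 0 < e"
      by eventually_elim (use a(2) in \<open>simp add: dist_norm\<close>)
  qed
  ultimately show ?thesis using tendsto_add by fastforce
qed

text \<open>Montel's theorem for one coordinate after the other.\<close>

lemma vec_Montel:
  fixes F :: "nat \<Rightarrow> complex \<Rightarrow> complex^'n"
  assumes "open S" and hol: "\<And>n. vec_holomorphic_on (F n) S"
    and bound: "\<And>n z. z \<in> S \<Longrightarrow> norm (F n z) \<le> B"
  obtains g r where "vec_holomorphic_on g S" "strict_mono (r :: nat \<Rightarrow> nat)"
    "\<And>z. z \<in> S \<Longrightarrow> (\<lambda>n. F (r n) z) \<longlonglongrightarrow> g z"
    "\<And>K i. compact K \<Longrightarrow> K \<subseteq> S \<Longrightarrow>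
       uniform_limit K (\<lambda>n z. F (r n) z $ i) (\<lambda>z. g z $ i) sequentially"
proof -
  have "\<exists>g r. strict_mono (r :: nat \<Rightarrow> nat) \<and> (\<forall>i\<in>I. g i holomorphic_on S \<and>
      (\<forall>K. compact K \<longrightarrow> K \<subseteq> S \<longrightarrow> uniform_limit K (\<lambda>n z. F (r n) z $ i) (g i) sequentially))"
    if "finite I" for I
    using that
  proof induction
    case empty
    show ?case by (auto intro: strict_mono_id)
  next
    case (insert j I)
    then obtain g and r :: "nat \<Rightarrow> nat" where r: "strict_mono r"
      and g: "\<And>i. i \<in> I \<Longrightarrow> g i holomorphic_on S"
      and lim: "\<And>i K. i \<in> I \<Longrightarrow> compact K \<Longrightarrow> K \<subseteq> S \<Longrightarrow>
          uniform_limit K (\<lambda>n z. F (r n) z $ i) (g i) sequentially"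
      by blast
    let ?H = "range (\<lambda>n z. F (r n) z $ j)"
    obtain h q where h: "h holomorphic_on S" "strict_mono (q :: nat \<Rightarrow> nat)"
      "\<And>K. \<lbrakk>compact K; K \<subseteq> S\<rbrakk> \<Longrightarrow> uniform_limit K ((\<lambda>n z. F (r n) z $ j) \<circ> q) h sequentially"
    proof (rule Montel[of S ?H "\<lambda>n z. F (r n) z $ j"])
      show "open S" by fact
      show "h holomorphic_on S" if "h \<in> ?H" for h
        using that hol by (auto simp: vec_holomorphic_on_def)
      show "\<exists>B. \<forall>h\<in>?H. \<forall>z\<in>K. cmod (h z) \<le> B" if "compact K" "K \<subseteq> S" for K
        using bound that by (intro exI[of _ B]) (auto intro!: order_trans[OF Finite_Cartesian_Product.norm_nth_le])
    qed auto
    have "uniform_limit K (\<lambda>n z. F ((r \<circ> q) n) z $ i) ((g(j := h)) i) sequentially"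
      if "compact K" "K \<subseteq> S" "i \<in> insert j I" for i K
    proof (cases "i = j")
      case True
      then show ?thesis using h(3)[OF that(1,2)] by (simp add: o_def)
    next
      case False
      then show ?thesis
        using filterlim_compose[OF lim[of i K] filterlim_subseq[OF h(2)]] that by auto
    qed
    moreover have "strict_mono (r \<circ> q)" using r h(2) by (rule strict_mono_o)
    ultimately show ?case using g h(1) by (intro exI[of _ "g(j := h)"] exI[of _ "r \<circ> q"]) (auto simp del: o_apply)
  qed
  from this[OF finite[of UNIV]] obtain g and r :: "nat \<Rightarrow> nat" where r: "strict_mono r"
      and g: "\<And>i. g i holomorphic_on S"
      and lim: "\<And>i K. compact K \<Longrightarrow> K \<subseteq> S \<Longrightarrow>
          uniform_limit K (\<lambda>n z. F (r n) z $ i) (g i) sequentially"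
    by (simp del: o_apply) blast
  show ?thesis
  proof (rule that[of "\<lambda>z. \<chi> i. g i z" r])
    show "(\<lambda>n. F (r n) z) \<longlonglongrightarrow> (\<chi> i. g i z)" if "z \<in> S" for z
    proof (rule vec_tendstoI)
      show "(\<lambda>n. F (r n) z $ i) \<longlonglongrightarrow> (\<chi> i. g i z) $ i" for i
        using tendsto_uniform_limitI[OF lim[of "{z}" i], of z] that by simp
    qed
  qed (use r g lim in \<open>auto simp: vec_holomorphic_on_def\<close>)
qed

lemma vec_Schwarz:
  fixes \<phi> :: "complex \<Rightarrow> complex^'n"
  assumes hol: "vec_holomorphic_on \<phi> \<bbbD>" and "\<phi> 0 = 0"
    and bound: "\<And>z. z \<in> \<bbbD> \<Longrightarrow> norm (\<phi> z) < M" and z: "z \<in> \<bbbD>"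
  shows "norm (\<phi> z) \<le> real CARD('n) * M * cmod z"
proof -
  have M: "0 < M" using bound[of 0] by (auto intro: le_less_trans[OF norm_ge_zero])
  have "cmod (\<phi> z $ i) \<le> M * cmod z" for i
  proof -
    have "cmod ((\<lambda>z. \<phi> z $ i / M) z) \<le> cmod z"
    proof (rule Schwarz_Lemma(1))
      show "(\<lambda>z. \<phi> z $ i / M) holomorphic_on \<bbbD>"
        using hol M by (auto simp: vec_holomorphic_on_def intro!: holomorphic_intros)
      show "cmod (\<phi> z $ i / M) < 1" if "cmod z < 1" for z
        using bound[of z] Finite_Cartesian_Product.norm_nth_le[of "\<phi> z" i] that M
        by (simp add: norm_divide divide_less_eq)
    qed (use assms in auto)
    then show ?thesis using M by (simp add: norm_divide field_simps)
  qed
  then have "(\<Sum>i\<in>UNIV. cmod (\<phi> z $ i)) \<le> (\<Sum>i\<in>(UNIV::'n set). M * cmod z)"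
    by (intro sum_mono)
  then show ?thesis using L2_set_le_sum[of UNIV "\<lambda>i. cmod (\<phi> z $ i)"]
    by (simp add: norm_vec_def)
qed

text \<open>A real half-space that contains \<open>C\<close> but not \<open>\<psi> z\<close> is given by the real part of a complex
linear form, so the maximum principle applies.\<close>

lemma vec_maximum_principle_convex:
  fixes \<psi> :: "complex \<Rightarrow> complex^'n"
  assumes hol: "vec_holomorphic_on \<psi> (cball 0 1)" and C: "convex C" "closed C"
    and bdry: "\<psi> ` sphere 0 1 \<subseteq> C" and z: "z \<in> cball 0 1"
  shows "\<psi> z \<in> C"
proof (rule ccontr)
  assume "\<psi> z \<notin> C"
  then obtain a b where ab: "a \<bullet> \<psi> z < b" "\<And>x. x \<in> C \<Longrightarrow> b < a \<bullet> x"
    using separating_hyperplane_closed_point[OF C] by blast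
  define u where "u = (\<lambda>z. - cdot (\<chi> i. cnj (a $ i)) (\<psi> z))"
  have u: "u holomorphic_on cball 0 1"
    unfolding u_def by (intro holomorphic_intros vec_holomorphic_on_const hol)
  have Re_u: "Re (u z) = - (a \<bullet> \<psi> z)" for z by (simp add: u_def inner_eq_Re_cdot)
  have "Re (u z) \<le> - b"
  proof (rule maximum_real_frontier[of u "cball 0 1"])
    show "u holomorphic_on interior (cball 0 1)"
      by (rule holomorphic_on_subset[OF u]) auto
    show "continuous_on (closure (cball 0 1)) u"
      using holomorphic_on_imp_continuous_on[OF u] by simp
    show "Re (u x) \<le> - b" if "x \<in> frontier (cball 0 1)" for x
      using ab(2)[of "\<psi> x"] bdry that by (auto simp: Re_u frontier_cball image_subset_iff)
  qed (use z in auto)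
  then show False using ab(1) by (simp add: Re_u)
qed

text \<open>If \<open>\<phi>\<close> met the boundary of \<open>E\<close>, a supporting real hyperplane there would give a holomorphic function
whose real part attains its maximum; it would be constant, and \<open>\<phi> z0\<close> would lie on the supporting
hyperplane as well.\<close>

lemma vec_holomorphic_into_closure:
  fixes \<phi> :: "complex \<Rightarrow> complex^'n"
  assumes hol: "vec_holomorphic_on \<phi> S" and S: "open S" "connected S"
    and E: "open E" "convex E" and clo: "\<phi> ` S \<subseteq> closure E"
    and z0: "z0 \<in> S" "\<phi> z0 \<in> E"
  shows "\<phi> ` S \<subseteq> E"
proof (rule ccontr)
  assume "\<not> \<phi> ` S \<subseteq> E"
  then obtain z1 where z1: "z1 \<in> S" "\<phi> z1 \<notin> E" by auto
  then have "E \<inter> {\<phi> z1} = {}" by auto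
  then obtain a b where a: "a \<noteq> 0" and aE: "\<And>x. x \<in> E \<Longrightarrow> a \<bullet> x \<le> b" and b: "b \<le> a \<bullet> \<phi> z1"
    using separating_hyperplane_sets[OF \<open>convex E\<close>, of "{\<phi> z1}"] z0 by auto
  have aclo: "a \<bullet> x \<le> b" if "x \<in> closure E" for x
  proof -
    have "closure E \<subseteq> {x. a \<bullet> x \<le> b}"
      by (rule closure_minimal) (use aE in \<open>auto simp: closed_halfspace_le\<close>)
    then show ?thesis using that by auto
  qed
  define u where "u = (\<lambda>z. exp (cdot (\<chi> i. cnj (a $ i)) (\<phi> z)))"
  have norm_u: "norm (u z) = exp (a \<bullet> \<phi> z)" for z
    by (simp add: u_def inner_eq_Re_cdot)
  have "u constant_on S"
  proof (rule maximum_modulus_principle[OF _ S \<open>open S\<close> order_refl z1(1)])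
    show "u holomorphic_on S"
      unfolding u_def by (intro holomorphic_intros vec_holomorphic_on_const hol)
    show "norm (u z) \<le> norm (u z1)" if "z \<in> S" for z
      using aclo[of "\<phi> z"] clo that b by (auto simp: norm_u)
  qed
  then have "u z0 = u z1" using z0 z1 by (auto simp: constant_on_def)
  then have "exp (a \<bullet> \<phi> z0) = exp (a \<bullet> \<phi> z1)" by (metis norm_u)
  then have eq: "b \<le> a \<bullet> \<phi> z0" using b by simp
  obtain e where e: "0 < e" "cball (\<phi> z0) e \<subseteq> E"
    using E(1) z0(2) open_contains_cball by blast
  have "\<phi> z0 + (e / norm a) *\<^sub>R a \<in> cball (\<phi> z0) e" using a e by (simp add: dist_norm)
  then have "a \<bullet> (\<phi> z0 + (e / norm a) *\<^sub>R a) \<le> b" using aE e by blast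
  moreover have "a \<bullet> ((e / norm a) *\<^sub>R a) > 0" using a e by simp
  ultimately show False using eq by (simp add: inner_add_right)
qed

section \<open>Extremal discs\<close>

definition disc_joining :: "(complex^'n) set \<Rightarrow> complex^'n \<Rightarrow> real \<Rightarrow> (complex \<Rightarrow> complex^'n) \<Rightarrow> bool"
  where "disc_joining E w r \<phi> \<longleftrightarrow>
    vec_holomorphic_on \<phi> \<bbbD> \<and> \<phi> ` \<bbbD> \<subseteq> E \<and> \<phi> 0 = 0 \<and> \<phi> (of_real r) = w"

text \<open>The complex line through \<open>0\<close> and \<open>w\<close> cuts \<open>E\<close> in a convex plane domain; its Riemann map, normalised by a
Moebius transformation and a rotation, is such a disc.\<close>

lemma disc_joining_exists:
  fixes E :: "(complex^'n) set"
  assumes E: "open E" "convex E" "bounded E" and 0: "0 \<in> E" and w: "w \<in> E" "w \<noteq> 0"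
  obtains r \<phi> where "0 < r" "r < 1" "disc_joining E w r \<phi>"
proof -
  define S where "S = {t. t *s w \<in> E}"
  have S: "open S" "convex S" unfolding S_def by (rule open_convex_complex_line_slice[OF E(1,2)])+
  have "0 \<in> S" "1 \<in> S" using 0 w by (auto simp: S_def)
  have "S \<noteq> UNIV"
  proof
    assume "S = UNIV"
    then have all: "t *s w \<in> E" for t by (auto simp: S_def)
    obtain B where B: "\<And>x. x \<in> E \<Longrightarrow> norm x \<le> B" using E(3) bounded_iff by blast
    define t where "t = (\<bar>B\<bar> + 1) / norm w"
    have "norm (of_real t *s w) = \<bar>B\<bar> + 1"
      using w unfolding norm_complex_scale norm_of_real t_def by simp
    then show False using B[OF all[of "of_real t"]] by linarith
  qed
  moreover have "simply_connected S" using S(2) by (rule convex_imp_simply_connected)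
  ultimately obtain f g where f: "f holomorphic_on S" and g: "g holomorphic_on \<bbbD>"
    and fS: "\<And>z. z \<in> S \<Longrightarrow> f z \<in> \<bbbD> \<and> g (f z) = z" and gS: "\<And>z. z \<in> \<bbbD> \<Longrightarrow> g z \<in> S"
    using Riemann_mapping_theorem[of S] S(1) \<open>0 \<in> S\<close> by blast
  obtain F G where F: "F (f 0) = 0" "F ` \<bbbD> \<subseteq> \<bbbD>" and G: "G holomorphic_on \<bbbD>" "G ` \<bbbD> \<subseteq> \<bbbD>"
    and GF: "\<And>z. z \<in> \<bbbD> \<Longrightarrow> G (F z) = z"
    using ball_biholomorphism_exists[of "f 0"] fS \<open>0 \<in> S\<close> by metis
  define b where "b = F (f 1)"
  have b: "cmod b < 1" using subsetD[OF F(2), of "F (f 1)"] fS[OF \<open>1 \<in> S\<close>] by (auto simp: b_def)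
  have gG0: "g (G 0) = 0" using GF[of "f 0"] F fS[OF \<open>0 \<in> S\<close>] by simp
  have gG1: "g (G b) = 1" using GF[of "f 1"] F fS[OF \<open>1 \<in> S\<close>] by (simp add: b_def)
  have "b \<noteq> 0" using gG0 gG1 by auto
  define u where "u = b / of_real (cmod b)"
  have u: "cmod u = 1" "u * of_real (cmod b) = b"
    using \<open>b \<noteq> 0\<close> by (auto simp: u_def norm_divide)
  define \<phi> where "\<phi> = (\<lambda>\<zeta>. g (G (u * \<zeta>)) *s w)"
  have uD: "(\<lambda>\<zeta>. u * \<zeta>) ` \<bbbD> \<subseteq> \<bbbD>" using u by (auto simp: norm_mult)
  have "(\<lambda>\<zeta>. G (u * \<zeta>)) holomorphic_on \<bbbD>"
    using holomorphic_on_compose_gen[OF _ G(1) uD] by (auto simp: o_def intro!: holomorphic_intros)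
  moreover have "(\<lambda>\<zeta>. G (u * \<zeta>)) ` \<bbbD> \<subseteq> \<bbbD>" using G(2) uD by (auto simp: image_subset_iff)
  ultimately have hol: "(\<lambda>\<zeta>. g (G (u * \<zeta>))) holomorphic_on \<bbbD>"
    using holomorphic_on_compose_gen[OF _ g] by (auto simp: o_def)
  show ?thesis
  proof
    show "0 < cmod b" "cmod b < 1" using b \<open>b \<noteq> 0\<close> by auto
    have "\<phi> ` \<bbbD> \<subseteq> E"
      using gS \<open>(\<lambda>\<zeta>. G (u * \<zeta>)) ` \<bbbD> \<subseteq> \<bbbD>\<close> by (fastforce simp: \<phi>_def S_def)
    moreover have "vec_holomorphic_on \<phi> \<bbbD>"
      unfolding \<phi>_def by (rule vec_holomorphic_on_scale[OF hol vec_holomorphic_on_const])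
    ultimately show "disc_joining E w (cmod b) \<phi>"
      by (simp add: disc_joining_def \<phi>_def gG0 gG1 u)
  qed
qed

text \<open>The Schwarz lemma bounds \<open>r\<close> from below by a multiple of \<open>norm w\<close>, and a minimising sequence of discs has
a locally uniform limit. The limit maps into the closure of \<open>E\<close> and takes \<open>0\<close> into \<open>E\<close>, hence maps into \<open>E\<close>.\<close>

lemma extremal_disc_exists:
  fixes E :: "(complex^'n) set"
  assumes E: "open E" "convex E" "bounded E" and 0: "0 \<in> E" and w: "w \<in> E" "w \<noteq> 0"
  obtains r \<phi> where "0 < r" "r < 1" "disc_joining E w r \<phi>"
    "\<And>s \<psi>. 0 < s \<Longrightarrow> s < r \<Longrightarrow> \<not> disc_joining E w s \<psi>"
proof -
  define S where "S = {r. 0 < r \<and> r < 1 \<and> (\<exists>\<phi>. disc_joining E w r \<phi>)}"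
  obtain B where "\<forall>x\<in>E. norm x \<le> B" using E(3) bounded_iff by blast
  then have B: "norm x < \<bar>B\<bar> + 1" if "x \<in> E" for x using that by force
  define c where "c = norm w / (real CARD('n) * (\<bar>B\<bar> + 1))"
  have c: "0 < c" using w by (simp add: c_def)
  have c_le: "c \<le> s" if "s \<in> S" for s
  proof -
    obtain \<psi> where s: "0 < s" "s < 1" and \<psi>: "disc_joining E w s \<psi>" using \<open>s \<in> S\<close> by (auto simp: S_def)
    have "norm (\<psi> (of_real s)) \<le> real CARD('n) * (\<bar>B\<bar> + 1) * cmod (of_real s)"
      by (rule vec_Schwarz) (use \<psi> s B in \<open>auto simp: disc_joining_def image_subset_iff\<close>)
    then have "norm w \<le> s * (real CARD('n) * (\<bar>B\<bar> + 1))"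
      using \<psi> s by (simp add: disc_joining_def mult.commute)
    moreover have "0 < real CARD('n) * (\<bar>B\<bar> + 1)" by (intro mult_pos_pos) auto
    ultimately show ?thesis unfolding c_def by (simp add: divide_le_eq)
  qed
  obtain s0 \<phi>0 where "0 < s0" "s0 < 1" "disc_joining E w s0 \<phi>0"
    using disc_joining_exists[OF E 0 w] by blast
  then have "S \<noteq> {}" by (auto simp: S_def)
  have bdd: "bdd_below S" using c_le by (rule bdd_belowI)
  define r where "r = Inf S"
  have r_le: "r \<le> s" if "s \<in> S" for s unfolding r_def using bdd that by (rule cInf_lower[rotated])
  have "c \<le> r" unfolding r_def using \<open>S \<noteq> {}\<close> c_le by (rule cInf_greatest)
  then have "0 < r" using c by simp
  have "r < 1" using \<open>S \<noteq> {}\<close> r_le by (fastforce simp: S_def)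
  have "\<exists>s\<in>S. s < r + inverse (real (Suc k))" for k
    using cInf_lessD[OF \<open>S \<noteq> {}\<close>, of "r + inverse (real (Suc k))"] by (auto simp: r_def)
  then obtain s where s: "\<And>k. s k \<in> S" "\<And>k. s k < r + inverse (real (Suc k))" by metis
  then obtain F where F: "\<And>k. disc_joining E w (s k) (F k)" unfolding S_def by (auto, metis)
  have s_lim: "s \<longlonglongrightarrow> r"
  proof (rule tendsto_sandwich[of "\<lambda>_. r" _ _ "\<lambda>k. r + inverse (real (Suc k))"])
    show "(\<lambda>k. r + inverse (real (Suc k))) \<longlonglongrightarrow> r"
      using tendsto_add[OF tendsto_const LIMSEQ_inverse_real_of_nat, of r] by simp
  qed (use s r_le in \<open>auto intro!: always_eventually less_imp_le\<close>)
  obtain g q where g: "vec_holomorphic_on g \<bbbD>" and q: "strict_mono (q :: nat \<Rightarrow> nat)"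
    and pt: "\<And>z. z \<in> \<bbbD> \<Longrightarrow> (\<lambda>n. F (q n) z) \<longlonglongrightarrow> g z"
    and un: "\<And>K i. compact K \<Longrightarrow> K \<subseteq> \<bbbD> \<Longrightarrow>
       uniform_limit K (\<lambda>n z. F (q n) z $ i) (\<lambda>z. g z $ i) sequentially"
  proof (rule vec_Montel[of \<bbbD> F "\<bar>B\<bar> + 1"])
    show "norm (F n z) \<le> \<bar>B\<bar> + 1" if "z \<in> \<bbbD>" for n z
      using B[of "F n z"] F[of n] that by (auto simp: disc_joining_def image_subset_iff)
  qed (use F in \<open>auto simp: disc_joining_def\<close>)
  have g0: "g 0 = 0"
    using LIMSEQ_unique[OF pt[of 0], of 0] F by (simp add: disc_joining_def)
  have gr: "g (of_real r) = w"
  proof -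
    define R where "R = (1 + r) / 2"
    have R: "r < R" "R < 1" using \<open>r < 1\<close> by (auto simp: R_def)
    have sq: "(\<lambda>n. s (q n)) \<longlonglongrightarrow> r" using LIMSEQ_subseq_LIMSEQ[OF s_lim q] by (simp add: o_def)
    from order_tendstoD(2)[OF sq R(1)] obtain N where N: "\<And>n. N \<le> n \<Longrightarrow> s (q n) < R"
      unfolding eventually_sequentially by blast
    have R_sub: "cball 0 R \<subseteq> \<bbbD>" using R by (auto simp: subset_iff)
    have "g (of_real r) $ i = w $ i" for i
    proof -
      have "(\<lambda>n. F (q (n + N)) (of_real (s (q (n + N)))) $ i) \<longlonglongrightarrow> g (of_real r) $ i"
      proof (rule uniform_limit_at_convergent_points[where K = "cball 0 R" and g = "\<lambda>z. g z $ i"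
            and F = "\<lambda>n z. F (q (n + N)) z $ i"])
        show "uniform_limit (cball 0 R) (\<lambda>n z. F (q (n + N)) z $ i) (\<lambda>z. g z $ i) sequentially"
          using filterlim_compose[OF un[OF compact_cball R_sub] filterlim_add_const_nat_at_top] .
        show "continuous_on (cball 0 R) (\<lambda>z. g z $ i)"
          using g R_sub unfolding vec_holomorphic_on_def
          by (blast intro: holomorphic_on_imp_continuous_on holomorphic_on_subset)
        show "(\<lambda>n. complex_of_real (s (q (n + N)))) \<longlonglongrightarrow> of_real r"
          by (intro tendsto_of_real LIMSEQ_ignore_initial_segment sq)
        show "complex_of_real (s (q (n + N))) \<in> cball 0 R" for n
          using N[of "n + N"] s(1)[of "q (n + N)"] by (simp add: S_def)
      qed (use R \<open>0 < r\<close> in simp)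
      moreover have "F (q n) (of_real (s (q n))) = w" for n using F by (simp add: disc_joining_def)
      ultimately show ?thesis by (simp add: LIMSEQ_const_iff)
    qed
    then show ?thesis by (simp add: vec_eq_iff)
  qed
  have "g ` \<bbbD> \<subseteq> E"
  proof (rule vec_holomorphic_into_closure[where ?z0.0 = 0, OF g open_ball connected_ball E(1,2)])
    show "g ` \<bbbD> \<subseteq> closure E"
    proof safe
      fix z :: complex assume z: "z \<in> \<bbbD>"
      show "g z \<in> closure E"
        unfolding closure_sequential
        using pt[OF z] F z by (intro exI[of _ "\<lambda>n. F (q n) z"]) (auto simp: disc_joining_def image_subset_iff)
    qed
  qed (use g0 0 in auto)
  show ?thesis
  proof (rule that[of r g])
    show "disc_joining E w r g" using g g0 gr \<open>g ` \<bbbD> \<subseteq> E\<close> by (simp add: disc_joining_def)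
    show "\<not> disc_joining E w s \<psi>" if "0 < s" "s < r" for s \<psi>
      using r_le[of s] that \<open>r < 1\<close> by (auto simp: S_def)
  qed fact+
qed

text \<open>A disc whose boundary lies in \<open>E\<close> has room left: adding a small linear term \<open>\<zeta> * v\<close> makes it reach \<open>w\<close> at a
parameter below \<open>r\<close>.\<close>

lemma extremal_disc_touches:
  fixes E :: "(complex^'n) set"
  assumes E: "open E" "convex E" and r: "0 < r" "r < 1"
    and minimal: "\<And>s \<psi>. 0 < s \<Longrightarrow> s < r \<Longrightarrow> \<not> disc_joining E w s \<psi>"
    and \<psi>: "vec_holomorphic_on \<psi> (cball 0 1)" "\<psi> 0 = 0" "\<psi> (of_real r) = w"
  shows "\<not> \<psi> ` sphere 0 1 \<subseteq> E"
proof
  assume bdry: "\<psi> ` sphere 0 1 \<subseteq> E"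
  have cont: "continuous_on (cball 0 1) \<psi>" using \<psi>(1) by (rule vec_holomorphic_on_imp_continuous_on)
  define C where "C = convex hull (\<psi> ` sphere 0 1)"
  have "compact (\<psi> ` sphere 0 1)"
    by (intro compact_continuous_image continuous_on_subset[OF cont]) auto
  then have "compact C" unfolding C_def by (rule compact_convex_hull)
  have "C \<subseteq> E" unfolding C_def using bdry E(2) by (rule hull_minimal)
  obtain e where e: "0 < e" "(\<Union>x\<in>C. ball x e) \<subseteq> E"
    using compact_subset_open_imp_ball_epsilon_subset[OF \<open>compact C\<close> E(1) \<open>C \<subseteq> E\<close>] by blast
  have \<psi>C: "\<psi> z \<in> C" if "z \<in> cball 0 1" for z
    by (rule vec_maximum_principle_convex[OF \<psi>(1) _ _ _ that])
       (use \<open>compact C\<close> in \<open>auto simp: C_def hull_inc convex_convex_hull intro: compact_imp_closed\<close>)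
  have "continuous (at r within {0<..<1}) (\<lambda>s. \<psi> (of_real s))"
  proof -
    have "continuous_on {0<..<1} (\<lambda>s::real. \<psi> (of_real s))"
      by (rule continuous_on_compose2[OF cont]) (auto intro: continuous_intros)
    then show ?thesis using r by (simp add: continuous_on_eq_continuous_within)
  qed
  moreover have "0 < e * r / 2" using e r by simp
  ultimately obtain d where d: "0 < d"
    "\<And>s. s \<in> {0<..<1} \<Longrightarrow> dist s r < d \<Longrightarrow> dist (\<psi> (of_real s)) (\<psi> (of_real r)) < e * r / 2"
    unfolding continuous_within_eps_delta by meson
  define s where "s = max (r / 2) (r - d / 2)"
  have s: "0 < s" "s < r" "r / 2 \<le> s" "dist s r < d" using r d(1) by (auto simp: s_def dist_real_def)
  \<comment> \<open>The linear term that moves \<open>\<psi> s\<close> to \<open>w\<close>.\<close>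
  define v where "v = (w - \<psi> (of_real s)) /\<^sub>R s"
  have "norm (w - \<psi> (of_real s)) < e * r / 2"
    using d(2)[of s] s r \<psi>(3) by (simp add: dist_norm norm_minus_commute)
  also have "\<dots> \<le> e * s" using s e by (simp add: field_simps)
  finally have "norm (w - \<psi> (of_real s)) < e * s" .
  moreover have "norm v = norm (w - \<psi> (of_real s)) / s"
    using s(1) unfolding v_def by (simp add: divide_inverse_commute del: scaleR_right_diff_distrib)
  ultimately have v: "norm v < e" using s(1) by (simp add: divide_less_eq)
  define \<theta> where "\<theta> = (\<lambda>\<zeta>. \<psi> \<zeta> + \<zeta> *s v)"
  have "disc_joining E w s \<theta>"
    unfolding disc_joining_def
  proof (intro conjI)
    show "vec_holomorphic_on \<theta> \<bbbD>"
      unfolding \<theta>_def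
      by (intro vec_holomorphic_on_add vec_holomorphic_on_scale vec_holomorphic_on_const
          vec_holomorphic_on_subset[OF \<psi>(1)] holomorphic_intros) auto
    show "\<theta> ` \<bbbD> \<subseteq> E"
    proof safe
      fix z :: complex assume z: "z \<in> \<bbbD>"
      have "norm (z *s v) \<le> norm v"
        unfolding norm_complex_scale using z by (intro mult_left_le_one_le) auto
      then have "\<theta> z \<in> ball (\<psi> z) e" using v by (simp add: \<theta>_def dist_norm)
      then show "\<theta> z \<in> E" using e(2) \<psi>C[of z] z by (auto simp: subset_iff)
    qed
    show "\<theta> 0 = 0" using \<psi>(2) by (simp add: \<theta>_def)
    show "\<theta> (of_real s) = w"
      using s(1) by (simp add: \<theta>_def v_def flip: scaleR_eq_complex_scale)
  qed
  then show False using minimal s by blast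
qed

section \<open>The dual functional of an extremal disc\<close>

text \<open>The functional separates the continuous maps of the unit circle into \<open>E\<close> from the boundary values of
the discs that are holomorphic up to the circle and take \<open>0\<close> to \<open>0\<close> and \<open>r\<close> to \<open>w\<close>. These boundary values
form the affine space of \<open>\<tau> \<mapsto> \<tau> * w / r\<close> plus the annihilated maps, so \<open>ge_1\<close> bounds \<open>L\<close> from below on all of it.\<close>

locale dual_functional =
  fixes E :: "(complex^'n) set" and w :: "complex^'n" and r :: real
    and L :: "(complex \<Rightarrow> complex^'n) \<Rightarrow> complex"
  assumes r: "0 < r" "r < 1"
    and add: "\<And>f g. continuous_on (sphere 0 1) f \<Longrightarrow> continuous_on (sphere 0 1) g \<Longrightarrow>
      L (\<lambda>\<tau>. f \<tau> + g \<tau>) = L f + L g"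
    and scale: "\<And>f c. continuous_on (sphere 0 1) f \<Longrightarrow> L (\<lambda>\<tau>. c *s f \<tau>) = c * L f"
    and bounded: "\<exists>K>0. \<forall>f B. continuous_on (sphere 0 1) f \<longrightarrow> 0 < B \<longrightarrow>
      (\<forall>\<tau>\<in>sphere 0 1. norm (f \<tau>) \<le> B) \<longrightarrow> cmod (L f) \<le> K * B"
    and annihilates: "\<And>a. vec_holomorphic_on a (cball 0 1) \<Longrightarrow> a 0 = 0 \<Longrightarrow> a (of_real r) = 0 \<Longrightarrow> L a = 0"
    and le_1: "\<And>f. continuous_on (sphere 0 1) f \<Longrightarrow> f ` sphere 0 1 \<subseteq> E \<Longrightarrow> Re (L f) \<le> 1"
    and ge_1: "1 \<le> Re (L (\<lambda>\<tau>. \<tau> *s (w /\<^sub>R r)))"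

lemma continuous_on_complex_scale [continuous_intros]:
  fixes f :: "'a::topological_space \<Rightarrow> complex" and g :: "'a \<Rightarrow> complex^'n"
  shows "continuous_on S f \<Longrightarrow> continuous_on S g \<Longrightarrow> continuous_on S (\<lambda>x. f x *s g x)"
  unfolding vector_scalar_mult_def by (intro continuous_intros)

text \<open>The maps \<open>f\<close> for which \<open>f + a\<close> takes the circle into \<open>E\<close>, for some \<open>a\<close> vanishing at \<open>0\<close> and \<open>r\<close>, form an absorbing
convex set. It does not contain the disc \<open>\<tau> \<mapsto> \<tau> * w / r\<close> since every disc through \<open>0\<close> and \<open>w\<close> touches the complement
of \<open>E\<close>. The real part of \<open>L\<close> is a separating functional; it vanishes on the maps \<open>a\<close> because they span lines
inside the convex set.\<close>

lemma dual_functional_exists: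
  fixes E :: "(complex^'n) set"
  assumes E: "open E" "convex E" and 0: "0 \<in> E" and r: "0 < r" "r < 1"
    and touch: "\<And>\<psi>. vec_holomorphic_on \<psi> (cball 0 1) \<Longrightarrow> \<psi> 0 = 0 \<Longrightarrow> \<psi> (of_real r) = w \<Longrightarrow>
      \<not> \<psi> ` sphere 0 1 \<subseteq> E"
  obtains L where "dual_functional E w r L"
proof -
  \<comment> \<open>Maps of the circle are encoded as bounded continuous functions of the angle; only values on the unit circle matter.\<close>
  define bc :: "(complex \<Rightarrow> complex^'n) \<Rightarrow> (real \<Rightarrow>\<^sub>C (complex^'n))"
    where "bc = (\<lambda>f. Bcontfun (\<lambda>t. f (cis t)))"
  have bc: "apply_bcontfun (bc f) t = f (cis t)" if "continuous_on (sphere 0 1) f" for f t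
  proof -
    have "(\<lambda>t. f (cis t)) \<in> bcontfun"
    proof -
      have "compact (f ` sphere 0 1)" using that by (intro compact_continuous_image) auto
      then obtain B where "\<forall>y\<in>f ` sphere 0 1. norm y \<le> B"
        using compact_imp_bounded bounded_iff by blast
      then have "norm (f x) \<le> B" if "x \<in> sphere 0 1" for x using that by blast
      moreover have "continuous_on UNIV (\<lambda>t. f (cis t))"
        by (rule continuous_on_compose2[OF that]) (auto intro!: continuous_intros)
      ultimately show ?thesis by (intro bcontfun_normI[of _ B]) auto
    qed
    then show ?thesis by (simp add: bc_def Bcontfun_inverse)
  qed
  define ann where "ann = (\<lambda>a :: complex \<Rightarrow> complex^'n.
    vec_holomorphic_on a (cball 0 1) \<and> a 0 = 0 \<and> a (of_real r) = 0)"
  have ann_cont: "continuous_on (sphere 0 1) a" if "ann a" for a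
    using that unfolding ann_def
    by (auto intro: continuous_on_subset[OF vec_holomorphic_on_imp_continuous_on])
  have ann_scale: "ann (\<lambda>\<tau>. c *s a \<tau>)" if "ann a" for a c
    using that by (auto simp: ann_def intro!: vec_holomorphic_on_scale)
  have ann_add: "ann (\<lambda>\<tau>. a \<tau> + b \<tau>)" if "ann a" "ann b" for a b
    using that by (auto simp: ann_def intro!: vec_holomorphic_on_add)
  define C where "C = {F. \<exists>a. ann a \<and> (\<forall>t. apply_bcontfun F t + a (cis t) \<in> E)}"
  have "convex C"
  proof (rule convexI)
    fix F G :: "real \<Rightarrow>\<^sub>C (complex^'n)" and u v :: real
    assume FG: "F \<in> C" "G \<in> C" and uv: "0 \<le> u" "0 \<le> v" "u + v = 1"
    obtain a where a: "ann a" "\<And>t. apply_bcontfun F t + a (cis t) \<in> E" using FG(1) by (auto simp: C_def)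
    obtain b where b: "ann b" "\<And>t. apply_bcontfun G t + b (cis t) \<in> E" using FG(2) by (auto simp: C_def)
    have "apply_bcontfun (u *\<^sub>R F + v *\<^sub>R G) t + (of_real u *s a (cis t) + of_real v *s b (cis t)) \<in> E" for t
    proof -
      have "u *\<^sub>R (apply_bcontfun F t + a (cis t)) + v *\<^sub>R (apply_bcontfun G t + b (cis t)) \<in> E"
        using a(2) b(2) uv by (intro convexD[OF E(2)]) auto
      then show ?thesis by (simp add: scaleR_eq_complex_scale[symmetric] algebra_simps plus_bcontfun.rep_eq scaleR_bcontfun.rep_eq)
    qed
    moreover have "ann (\<lambda>\<tau>. of_real u *s a \<tau> + of_real v *s b \<tau>)" using a b by (intro ann_add ann_scale)
    ultimately show "u *\<^sub>R F + v *\<^sub>R G \<in> C" unfolding C_def by blast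
  qed
  obtain d where d: "0 < d" "cball 0 d \<subseteq> E" using E(1) 0 open_contains_cball by blast
  have ann0: "ann (\<lambda>_. 0)" by (simp add: ann_def vec_holomorphic_on_const)
  have smallC: "F \<in> C" if "\<And>t. norm (apply_bcontfun F t) \<le> d" for F
    using that d(2) ann0 unfolding C_def by (auto intro!: exI[of _ "\<lambda>_. 0"])
  define x0 where "x0 = bc (\<lambda>\<tau>. \<tau> *s (w /\<^sub>R r))"
  have x0: "apply_bcontfun x0 t = cis t *s (w /\<^sub>R r)" for t
    unfolding x0_def by (rule bc) (intro continuous_intros)
  have "x0 \<notin> C"
  proof
    assume "x0 \<in> C"
    then obtain a where a: "ann a" "\<And>t. apply_bcontfun x0 t + a (cis t) \<in> E" by (auto simp: C_def)
    define \<psi> where "\<psi> = (\<lambda>\<tau>. \<tau> *s (w /\<^sub>R r) + a \<tau>)"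
    have "\<not> \<psi> ` sphere 0 1 \<subseteq> E"
    proof (rule touch)
      show "vec_holomorphic_on \<psi> (cball 0 1)"
        using a(1) unfolding \<psi>_def ann_def
        by (intro vec_holomorphic_on_add vec_holomorphic_on_scale vec_holomorphic_on_const holomorphic_intros) auto
      show "\<psi> 0 = 0" using a(1) by (simp add: \<psi>_def ann_def)
      show "\<psi> (of_real r) = w" using a(1) r by (simp add: \<psi>_def ann_def flip: scaleR_eq_complex_scale)
    qed
    moreover have "\<psi> \<tau> \<in> E" if "\<tau> \<in> sphere 0 1" for \<tau>
    proof -
      have "\<tau> = cis (Arg \<tau>)" using that rcis_cmod_Arg[of \<tau>] by (simp add: rcis_def)
      then show ?thesis using a(2)[of "Arg \<tau>"] unfolding x0 \<psi>_def by metis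
    qed
    ultimately show False by auto
  qed
  moreover have "0 \<in> C" by (rule smallC) (use d in auto)
  moreover have "\<exists>t>0. F /\<^sub>R t \<in> C" for F :: "real \<Rightarrow>\<^sub>C (complex^'n)"
  proof -
    define t where "t = (norm F + 1) / d"
    have t: "0 < t" "norm F \<le> d * t" using d by (auto simp: t_def add_nonneg_pos)
    have "norm (apply_bcontfun (F /\<^sub>R t) x) \<le> d" for x
    proof -
      have "norm (apply_bcontfun F x) \<le> d * t" using norm_bounded[of F x] t(2) by simp
      then show ?thesis using t(1) by (simp add: scaleR_bcontfun.rep_eq field_simps)
    qed
    then show ?thesis using t(1) smallC by blast
  qed
  ultimately obtain l :: "(real \<Rightarrow>\<^sub>C (complex^'n)) \<Rightarrow> real"
    where l: "linear l" and lC: "\<And>x. x \<in> C \<Longrightarrow> l x \<le> 1" and lx0: "1 \<le> l x0"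
    using separate_point_from_absorbing_convex[OF \<open>convex C\<close>] by metis
  \<comment> \<open>The complex linear functional with real part \<open>l\<close>.\<close>
  define L where "L = (\<lambda>f. Complex (l (bc f)) (- l (bc (\<lambda>\<tau>. \<i> *s f \<tau>))))"
  have cs: "continuous_on (sphere 0 1) (\<lambda>\<tau>. c *s f \<tau>)" if "continuous_on (sphere 0 1) f"
    for f :: "complex \<Rightarrow> complex^'n" and c using that by (intro continuous_intros)
  have l_add: "l (bc (\<lambda>\<tau>. f \<tau> + g \<tau>)) = l (bc f) + l (bc g)"
    if "continuous_on (sphere 0 1) f" "continuous_on (sphere 0 1) g" for f g
  proof -
    have "bc (\<lambda>\<tau>. f \<tau> + g \<tau>) = bc f + bc g"
      using that by (intro bcontfun_eqI) (simp add: bc plus_bcontfun.rep_eq continuous_on_add)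
    then show ?thesis using l by (simp add: linear_add)
  qed
  have l_scale: "l (bc (\<lambda>\<tau>. of_real x *s f \<tau>)) = x * l (bc f)"
    if "continuous_on (sphere 0 1) f" for f x
  proof -
    have "bc (\<lambda>\<tau>. of_real x *s f \<tau>) = x *\<^sub>R bc f"
      by (intro bcontfun_eqI) (simp add: bc[OF that] bc[OF cs[OF that]] scaleR_bcontfun.rep_eq scaleR_eq_complex_scale)
    then show ?thesis using l by (simp add: linear_cmul)
  qed
  have l_cscale: "l (bc (\<lambda>\<tau>. c *s f \<tau>)) = Re c * l (bc f) + Im c * l (bc (\<lambda>\<tau>. \<i> *s f \<tau>))"
    if f: "continuous_on (sphere 0 1) f" for f c
  proof -
    have "(\<lambda>\<tau>. c *s f \<tau>) = (\<lambda>\<tau>. of_real (Re c) *s f \<tau> + of_real (Im c) *s (\<i> *s f \<tau>))"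
      by (rule ext) (simp add: vec_eq_iff complex_eq_iff)
    then show ?thesis
      using l_add[OF cs[OF f] cs[OF cs[OF f]]] l_scale[OF f] l_scale[OF cs[OF f]] by simp
  qed
  have l_bound: "l (bc f) \<le> B / d"
    if "continuous_on (sphere 0 1) f" "0 < B" "\<And>\<tau>. \<tau> \<in> sphere 0 1 \<Longrightarrow> norm (f \<tau>) \<le> B" for f B
  proof -
    have "bc (\<lambda>\<tau>. of_real (d / B) *s f \<tau>) \<in> C"
    proof (rule smallC)
      fix t
      have "(d / B) * norm (f (cis t)) \<le> (d / B) * B" using that d by (intro mult_left_mono) auto
      then show "norm (apply_bcontfun (bc (\<lambda>\<tau>. of_real (d / B) *s f \<tau>)) t) \<le> d"
        unfolding bc[OF cs[OF that(1)]] norm_complex_scale norm_of_real using that d by simp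
    qed
    from lC[OF this] have "(d / B) * l (bc f) \<le> 1" unfolding l_scale[OF that(1)] .
    then show ?thesis using that d by (simp add: field_simps)
  qed
  have "dual_functional E w r L"
  proof
    show "L (\<lambda>\<tau>. f \<tau> + g \<tau>) = L f + L g"
      if "continuous_on (sphere 0 1) f" "continuous_on (sphere 0 1) g" for f g
      using l_add[OF that] l_add[OF cs[OF that(1), of \<i>] cs[OF that(2), of \<i>]]
      by (simp add: L_def complex_eq_iff)
    show "L (\<lambda>\<tau>. c *s f \<tau>) = c * L f" if "continuous_on (sphere 0 1) f" for f c
      using l_cscale[OF that, of c] l_cscale[OF that, of "\<i> * c"]
      by (simp add: L_def complex_eq_iff)
    show "\<exists>K>0. \<forall>f B. continuous_on (sphere 0 1) f \<longrightarrow> 0 < B \<longrightarrow>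
      (\<forall>\<tau>\<in>sphere 0 1. norm (f \<tau>) \<le> B) \<longrightarrow> cmod (L f) \<le> K * B"
    proof (intro exI[of _ "2 / d"] conjI allI impI)
      fix f :: "complex \<Rightarrow> complex^'n" and B :: real
      assume f: "continuous_on (sphere 0 1) f" "0 < B" "\<forall>\<tau>\<in>sphere 0 1. norm (f \<tau>) \<le> B"
      have b: "\<bar>l (bc g)\<bar> \<le> B / d"
        if g: "continuous_on (sphere 0 1) g" "\<And>\<tau>. \<tau> \<in> sphere 0 1 \<Longrightarrow> norm (g \<tau>) \<le> B" for g
      proof -
        have "l (bc (\<lambda>\<tau>. of_real (-1) *s g \<tau>)) \<le> B / d"
          by (rule l_bound[OF cs[OF g(1)] f(2)]) (use g(2) in \<open>simp add: norm_complex_scale del: of_real_minus\<close>)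
        moreover have "l (bc (\<lambda>\<tau>. of_real (-1) *s g \<tau>)) = - l (bc g)" using l_scale[OF g(1), of "-1"] by simp
        ultimately show ?thesis using l_bound[OF g(1) f(2) g(2)] by (simp add: abs_le_iff)
      qed
      have "cmod (L f) \<le> \<bar>l (bc f)\<bar> + \<bar>l (bc (\<lambda>\<tau>. \<i> *s f \<tau>))\<bar>"
        using cmod_le[of "L f"] by (simp add: L_def)
      also have "\<dots> \<le> B / d + B / d"
        using f by (intro add_mono b cs) (auto simp: norm_complex_scale)
      finally show "cmod (L f) \<le> 2 / d * B" by simp
    qed (use d in simp)
    show "L a = 0" if "vec_holomorphic_on a (cball 0 1)" "a 0 = 0" "a (of_real r) = 0" for a
    proof -
      have zero: "l (bc b) = 0" if b: "ann b" for b
      proof -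
        have "x * l (bc b) \<le> 1" for x
        proof -
          have "bc (\<lambda>\<tau>. of_real x *s b \<tau>) \<in> C"
            unfolding C_def using 0 ann_scale[OF b, of "of_real (- x)"] 
            by (auto simp: bc[OF cs[OF ann_cont[OF b]]] intro!: exI[of _ "\<lambda>\<tau>. of_real (- x) *s b \<tau>"])
          then show ?thesis using lC l_scale[OF ann_cont[OF b]] by metis
        qed
        from this[of "2 / l (bc b)"] show ?thesis by (cases "l (bc b) = 0") auto
      qed
      have "ann a" using that by (simp add: ann_def)
      then show ?thesis using zero ann_scale[of a \<i>] by (simp add: L_def complex_eq_iff)
    qed
    show "Re (L f) \<le> 1" if "continuous_on (sphere 0 1) f" "f ` sphere 0 1 \<subseteq> E" for f
    proof -
      have "bc f \<in> C" unfolding C_def using that(2) ann0 by (auto simp: bc[OF that(1)] intro!: exI[of _ "\<lambda>_. 0"])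
      then show ?thesis using lC by (simp add: L_def)
    qed
    show "1 \<le> Re (L (\<lambda>\<tau>. \<tau> *s (w /\<^sub>R r)))" using lx0 by (simp add: L_def x0_def)
  qed fact+
  then show ?thesis by (rule that)
qed

section \<open>The dual map\<close>

context dual_functional
begin

lemma cong:
  assumes f: "continuous_on (sphere 0 1) f" and eq: "\<And>\<tau>. \<tau> \<in> sphere 0 1 \<Longrightarrow> f \<tau> = g \<tau>"
  shows "L f = L g"
proof -
  have g: "continuous_on (sphere 0 1) g" using f eq continuous_on_cong by metis
  let ?d = "\<lambda>\<tau>. f \<tau> + (-1) *s g \<tau>"
  have d: "continuous_on (sphere 0 1) ?d" by (intro continuous_intros f g)
  obtain K where K: "K > 0" "\<And>f B. continuous_on (sphere 0 1) f \<Longrightarrow> 0 < B \<Longrightarrow>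
      (\<And>\<tau>. \<tau> \<in> sphere 0 1 \<Longrightarrow> norm (f \<tau>) \<le> B) \<Longrightarrow> cmod (L f) \<le> K * B"
    using bounded by meson
  have "cmod (L ?d) \<le> 0 + e" if "0 < e" for e
    using K(2)[OF d, of "e / K"] K(1) that eq by (simp add: vec_eq_iff norm_complex_scale)
  then have "cmod (L ?d) \<le> 0" by (rule field_le_epsilon)
  moreover have "L ?d = L f + (-1) * L g"
    by (simp only: add[OF f continuous_on_complex_scale[OF continuous_on_const g]] scale[OF g])
  ultimately show ?thesis by simp
qed

text \<open>The vector of the functionals that \<open>L\<close> induces on the coordinates, evaluated at the scalar function \<open>k\<close>.\<close>

definition scalar :: "(complex \<Rightarrow> complex) \<Rightarrow> complex^'n"
  where "scalar k = (\<chi> i. L (\<lambda>\<tau>. k \<tau> *s axis i 1))"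

lemma L_sum:
  assumes "finite I" "\<And>i. i \<in> I \<Longrightarrow> continuous_on (sphere 0 1) (f i)"
  shows "L (\<lambda>\<tau>. \<Sum>i\<in>I. f i \<tau>) = (\<Sum>i\<in>I. L (f i))"
  using assms
proof induction
  case empty
  show ?case using annihilates[of "\<lambda>_. 0"] by (simp add: vec_holomorphic_on_const)
next
  case (insert i I)
  then show ?case using add[of "f i" "\<lambda>\<tau>. \<Sum>i\<in>I. f i \<tau>"] by (simp add: continuous_on_sum)
qed

lemma L_scalar:
  assumes k: "continuous_on (sphere 0 1) k"
  shows "L (\<lambda>\<tau>. k \<tau> *s v) = cdot (scalar k) v"
proof -
  have "k \<tau> *s v = (\<Sum>i\<in>UNIV. v $ i *s (k \<tau> *s axis i 1))" for \<tau>
    using sum_scale_axis[of "k \<tau> *s v"] by (simp add: mult.commute)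
  then have "L (\<lambda>\<tau>. k \<tau> *s v) = L (\<lambda>\<tau>. \<Sum>i\<in>UNIV. v $ i *s (k \<tau> *s axis i 1))" by simp
  also have "\<dots> = (\<Sum>i\<in>UNIV. L (\<lambda>\<tau>. v $ i *s (k \<tau> *s axis i 1)))"
    by (rule L_sum) (auto intro!: continuous_intros k)
  also have "\<dots> = (\<Sum>i\<in>UNIV. v $ i * L (\<lambda>\<tau>. k \<tau> *s axis i 1))"
    by (intro sum.cong refl scale continuous_intros k)
  finally show ?thesis by (simp add: cdot_def scalar_def mult.commute)
qed

text \<open>Up to the factor \<open>1 - r * \<zeta>\<close> this is a Cauchy transform of \<open>L\<close> multiplied by \<open>(\<tau> - r) * \<tau>\<close>. If \<open>L\<close> is
integration against a vector measure, then \<open>\<zeta> \<mapsto> dual_map \<zeta> / \<zeta>\<close> represents the density of \<open>|\<tau> - r|^2 * L\<close>; the factor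
\<open>|\<tau> - r|^2\<close> cancels the pole at \<open>r\<close> that the annihilation of only those maps which vanish at \<open>r\<close> leaves.\<close>

definition dual_map :: "complex \<Rightarrow> complex^'n"
  where "dual_map \<zeta> = (1 - of_real r * \<zeta>) *s scalar (\<lambda>\<tau>. (\<tau> - of_real r) * \<tau> / (\<tau> - \<zeta>))"

text \<open>The difference quotients of the Cauchy kernel converge uniformly on the circle and \<open>L\<close> is bounded.\<close>

lemma Cauchy_transform_holomorphic:
  assumes p: "continuous_on (sphere 0 1) p"
  shows "(\<lambda>\<zeta>. L (\<lambda>\<tau>. (p \<tau> / (\<tau> - \<zeta>)) *s v)) holomorphic_on \<bbbD>"
proof -
  obtain K where K: "K > 0" "\<And>f B. continuous_on (sphere 0 1) f \<Longrightarrow> 0 < B \<Longrightarrow>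
      (\<And>\<tau>. \<tau> \<in> sphere 0 1 \<Longrightarrow> norm (f \<tau>) \<le> B) \<Longrightarrow> cmod (L f) \<le> K * B"
    using bounded by meson
  have "compact (p ` sphere 0 1)" using p by (intro compact_continuous_image) auto
  then obtain M where "\<forall>y\<in>p ` sphere 0 1. norm y \<le> M"
    using compact_imp_bounded bounded_iff by blast
  then have M: "cmod (p \<tau>) \<le> \<bar>M\<bar> + 1" if "\<tau> \<in> sphere 0 1" for \<tau>
  proof -
    have "cmod (p \<tau>) \<le> M" using \<open>\<forall>y\<in>_. _\<close> that by blast
    then show ?thesis by linarith
  qed
  define u where "u = (\<lambda>\<zeta>. L (\<lambda>\<tau>. (p \<tau> / (\<tau> - \<zeta>)) *s v))"
  have "(u has_field_derivative L (\<lambda>\<tau>. (p \<tau> / (\<tau> - \<zeta>)^2) *s v)) (at \<zeta>)" if \<zeta>: "\<zeta> \<in> \<bbbD>" for \<zeta>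
  proof -
    \<comment> \<open>Points within \<open>d\<close> of \<open>\<zeta>\<close> are at distance at least \<open>d\<close> from the circle.\<close>
    define d where "d = (1 - cmod \<zeta>) / 2"
    have d: "0 < d" using \<zeta> by (simp add: d_def)
    have far: "d \<le> cmod (\<tau> - \<xi>)" if "\<tau> \<in> sphere 0 1" "cmod (\<xi> - \<zeta>) < d" for \<tau> \<xi>
    proof -
      have "cmod \<tau> \<le> cmod (\<tau> - \<xi>) + cmod (\<xi> - \<zeta>) + cmod \<zeta>"
        using norm_triangle_ineq[of "\<tau> - \<xi>" "\<xi> - \<zeta>"] norm_triangle_ineq[of "\<tau> - \<zeta>" \<zeta>] by simp
      moreover have "cmod \<zeta> = 1 - 2 * d" by (simp add: d_def field_simps)
      ultimately show ?thesis using that by simp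
    qed
    have nz: "\<tau> - \<xi> \<noteq> 0" if "\<tau> \<in> sphere 0 1" "cmod (\<xi> - \<zeta>) < d" for \<tau> \<xi>
      using far[OF that] d by auto
    define B where "B = (\<bar>M\<bar> + 1) / d ^ 3 * (norm v + 1)"
    have B: "0 < B" using d by (simp add: B_def add_nonneg_pos)
    define D where "D = L (\<lambda>\<tau>. (p \<tau> / (\<tau> - \<zeta>)^2) *s v)"
    have est: "cmod ((u \<xi> - u \<zeta>) / (\<xi> - \<zeta>) - D) \<le> K * (B * cmod (\<xi> - \<zeta>))"
      if \<xi>: "cmod (\<xi> - \<zeta>) < d" "\<xi> \<noteq> \<zeta>" for \<xi>
    proof -
      have c: "continuous_on (sphere 0 1) (\<lambda>\<tau>. (p \<tau> / (\<tau> - \<xi>)) *s v)"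
        "continuous_on (sphere 0 1) (\<lambda>\<tau>. (p \<tau> / (\<tau> - \<zeta>)) *s v)"
        "continuous_on (sphere 0 1) (\<lambda>\<tau>. (p \<tau> / (\<tau> - \<zeta>)^2) *s v)"
        "continuous_on (sphere 0 1) (\<lambda>\<tau>. (p \<tau> * (\<xi> - \<zeta>) / ((\<tau> - \<zeta>)^2 * (\<tau> - \<xi>))) *s v)"
        using nz[of _ \<xi>] nz[of _ \<zeta>] \<xi> d by (auto intro!: continuous_intros p)
      have "(u \<xi> - u \<zeta>) / (\<xi> - \<zeta>) - D
         = (1 / (\<xi> - \<zeta>)) * L (\<lambda>\<tau>. (p \<tau> / (\<tau> - \<xi>)) *s v)
           + ((- 1 / (\<xi> - \<zeta>)) * L (\<lambda>\<tau>. (p \<tau> / (\<tau> - \<zeta>)) *s v)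
           + (-1) * L (\<lambda>\<tau>. (p \<tau> / (\<tau> - \<zeta>)^2) *s v))"
        by (simp add: u_def D_def diff_divide_distrib)
      also have "\<dots> = L (\<lambda>\<tau>. (1 / (\<xi> - \<zeta>)) *s ((p \<tau> / (\<tau> - \<xi>)) *s v)
          + ((- 1 / (\<xi> - \<zeta>)) *s ((p \<tau> / (\<tau> - \<zeta>)) *s v) + (-1) *s ((p \<tau> / (\<tau> - \<zeta>)^2) *s v)))"
        using c by (simp only: add scale continuous_on_complex_scale continuous_on_const continuous_on_add)
      also have "\<dots> = L (\<lambda>\<tau>. (p \<tau> * (\<xi> - \<zeta>) / ((\<tau> - \<zeta>)^2 * (\<tau> - \<xi>))) *s v)"
      proof (rule cong)
        fix \<tau> :: complex assume \<tau>: "\<tau> \<in> sphere 0 1"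
        have n: "\<tau> - \<xi> \<noteq> 0" "\<tau> - \<zeta> \<noteq> 0" "\<xi> - \<zeta> \<noteq> 0" using nz[of _ \<xi>] nz[of _ \<zeta>] \<xi> d \<tau> by auto
        have "(1 / (\<xi> - \<zeta>)) * (p \<tau> / (\<tau> - \<xi>)) + ((- 1 / (\<xi> - \<zeta>)) * (p \<tau> / (\<tau> - \<zeta>)) + (-1) * (p \<tau> / (\<tau> - \<zeta>)^2))
          = p \<tau> * (\<xi> - \<zeta>) / ((\<tau> - \<zeta>)^2 * (\<tau> - \<xi>))"
        proof -
          have "1 / (\<tau> - \<xi>) - 1 / (\<tau> - \<zeta>) = (\<xi> - \<zeta>) / ((\<tau> - \<xi>) * (\<tau> - \<zeta>))"
            using n by (simp add: field_simps)
          then have 1: "(1 / (\<xi> - \<zeta>)) * (1 / (\<tau> - \<xi>) - 1 / (\<tau> - \<zeta>)) = 1 / ((\<tau> - \<xi>) * (\<tau> - \<zeta>))"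
            using n by simp
          have 2: "1 / ((\<tau> - \<xi>) * (\<tau> - \<zeta>)) - 1 / (\<tau> - \<zeta>)^2 = (\<xi> - \<zeta>) / ((\<tau> - \<zeta>)^2 * (\<tau> - \<xi>))"
            using n by (simp add: divide_simps power2_eq_square) 
          have "(1 / (\<xi> - \<zeta>)) * (p \<tau> / (\<tau> - \<xi>)) + ((- 1 / (\<xi> - \<zeta>)) * (p \<tau> / (\<tau> - \<zeta>)) + (-1) * (p \<tau> / (\<tau> - \<zeta>)^2))
            = p \<tau> * ((1 / (\<xi> - \<zeta>)) * (1 / (\<tau> - \<xi>) - 1 / (\<tau> - \<zeta>)) - 1 / (\<tau> - \<zeta>)^2)"
            by (simp add: algebra_simps)
          then show ?thesis unfolding 1 2 by simp
        qed
        then show "(1 / (\<xi> - \<zeta>)) *s ((p \<tau> / (\<tau> - \<xi>)) *s v)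
          + ((- 1 / (\<xi> - \<zeta>)) *s ((p \<tau> / (\<tau> - \<zeta>)) *s v) + (-1) *s ((p \<tau> / (\<tau> - \<zeta>)^2) *s v))
          = (p \<tau> * (\<xi> - \<zeta>) / ((\<tau> - \<zeta>)^2 * (\<tau> - \<xi>))) *s v"
          by (simp only: vector_smult_assoc vector_sadd_rdistrib[symmetric])
      qed (intro continuous_on_add continuous_on_complex_scale[OF continuous_on_const] c)
      also have "cmod \<dots> \<le> K * (B * cmod (\<xi> - \<zeta>))"
      proof (rule K(2)[OF c(4)])
        show "0 < B * cmod (\<xi> - \<zeta>)" using B \<xi> by simp
        fix \<tau> :: complex assume \<tau>: "\<tau> \<in> sphere 0 1"
        have "d\<^sup>2 * d \<le> (cmod (\<tau> - \<zeta>))\<^sup>2 * cmod (\<tau> - \<xi>)"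
          using far[OF \<tau>, of \<zeta>] far[OF \<tau>, of \<xi>] \<xi> d by (intro mult_mono power_mono) auto
        then have "cmod (p \<tau> * (\<xi> - \<zeta>)) / ((cmod (\<tau> - \<zeta>))\<^sup>2 * cmod (\<tau> - \<xi>)) \<le> (\<bar>M\<bar> + 1) * cmod (\<xi> - \<zeta>) / (d\<^sup>2 * d)"
          using M[OF \<tau>] d by (intro frac_le) (auto simp: norm_mult intro: mult_right_mono)
        then have "cmod (p \<tau> * (\<xi> - \<zeta>) / ((\<tau> - \<zeta>)^2 * (\<tau> - \<xi>))) * norm v
            \<le> ((\<bar>M\<bar> + 1) * cmod (\<xi> - \<zeta>) / (d\<^sup>2 * d)) * (norm v + 1)"
          using d by (intro mult_mono) (auto simp: norm_divide norm_mult norm_power)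
        then show "norm ((p \<tau> * (\<xi> - \<zeta>) / ((\<tau> - \<zeta>)^2 * (\<tau> - \<xi>))) *s v) \<le> B * cmod (\<xi> - \<zeta>)"
          unfolding norm_complex_scale B_def by (simp add: power3_eq_cube power2_eq_square mult_ac)
      qed
      finally show ?thesis .
    qed
    have "(\<lambda>\<xi>. (u \<xi> - u \<zeta>) / (\<xi> - \<zeta>)) \<midarrow>\<zeta>\<rightarrow> D"
    proof (rule LIM_I)
      fix e :: real assume e: "0 < e"
      show "\<exists>s>0. \<forall>x. x \<noteq> \<zeta> \<and> cmod (x - \<zeta>) < s \<longrightarrow> cmod ((u x - u \<zeta>) / (x - \<zeta>) - D) < e"
      proof (intro exI[of _ "min d (e / (K * B))"] conjI allI impI)
        show "0 < min d (e / (K * B))" using d e K B by simp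
        fix x assume x: "x \<noteq> \<zeta> \<and> cmod (x - \<zeta>) < min d (e / (K * B))"
        then have "K * (B * cmod (x - \<zeta>)) < e" using K B by (simp add: field_simps)
        then show "cmod ((u x - u \<zeta>) / (x - \<zeta>) - D) < e" using est[of x] x by simp
      qed
    qed
    then show ?thesis by (simp add: has_field_derivative_iff D_def)
  qed
  then have "u holomorphic_on \<bbbD>" unfolding holomorphic_on_open[OF open_ball] by blast
  then show ?thesis unfolding u_def .
qed

lemma dual_map_holomorphic: "vec_holomorphic_on dual_map \<bbbD>"
proof -
  have "(\<lambda>\<zeta>. L (\<lambda>\<tau>. ((\<tau> - of_real r) * \<tau> / (\<tau> - \<zeta>)) *s axis i 1)) holomorphic_on \<bbbD>" for i
    by (rule Cauchy_transform_holomorphic) (intro continuous_intros)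
  then show ?thesis
    by (auto simp: vec_holomorphic_on_def dual_map_def scalar_def intro!: holomorphic_intros)
qed

text \<open>At \<open>\<zeta> = r\<close> the kernel \<open>(\<tau> - r) * \<tau> / (\<tau> - \<zeta>)\<close> reduces to \<open>\<tau>\<close>, on which \<open>L\<close> is known.\<close>

lemma dual_map_nonzero: "0 < Re (cdot (dual_map (of_real r)) w)"
proof -
  let ?k = "\<lambda>\<tau>. (\<tau> - of_real r) * \<tau> / (\<tau> - complex_of_real r)"
  have nz: "\<tau> - complex_of_real r \<noteq> 0" if "\<tau> \<in> sphere 0 1" for \<tau> using that r by auto
  have id: "continuous_on (sphere 0 1) (\<lambda>\<tau>::complex. \<tau>)" by (intro continuous_intros)
  have "cdot (scalar ?k) w = L (\<lambda>\<tau>. ?k \<tau> *s w)"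
    by (rule L_scalar[symmetric], intro continuous_intros) (use nz in blast)
  also have "\<dots> = L (\<lambda>\<tau>. of_real r *s (\<tau> *s (w /\<^sub>R r)))"
  proof (rule cong)
    show "continuous_on (sphere 0 1) (\<lambda>\<tau>. ?k \<tau> *s w)" by (intro continuous_intros) (use nz in blast)
    show "?k \<tau> *s w = of_real r *s (\<tau> *s (w /\<^sub>R r))" if "\<tau> \<in> sphere 0 1" for \<tau>
      using nz[OF that] r by (simp add: vec_eq_iff scaleR_conv_of_real[where 'a=complex])
  qed
  also have "\<dots> = of_real r * L (\<lambda>\<tau>. \<tau> *s (w /\<^sub>R r))" by (intro scale continuous_intros)
  finally have "cdot (scalar ?k) w = of_real r * L (\<lambda>\<tau>. \<tau> *s (w /\<^sub>R r))" .
  then have "cdot (dual_map (of_real r)) w = of_real ((1 - r * r) * r) * L (\<lambda>\<tau>. \<tau> *s (w /\<^sub>R r))"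
    unfolding dual_map_def cdot_simps by simp
  then have "Re (cdot (dual_map (of_real r)) w) = ((1 - r * r) * r) * Re (L (\<lambda>\<tau>. \<tau> *s (w /\<^sub>R r)))"
    by (metis Re_complex_of_real Im_complex_of_real mult_zero_left diff_zero times_complex.simps(1))
  moreover have "r * r < 1 * 1" using r by (intro mult_strict_mono) auto
  ultimately show ?thesis using ge_1 r by simp
qed

text \<open>\<open>|\<tau> - r|^2\<close> times the Poisson kernel of the disc at \<open>\<zeta>\<close>.\<close>

definition weight :: "complex \<Rightarrow> complex \<Rightarrow> real"
  where "weight \<zeta> \<tau> = (cmod (\<tau> - of_real r))\<^sup>2 * (1 - (cmod \<zeta>)\<^sup>2) / (cmod (\<tau> - \<zeta>))\<^sup>2"

text \<open>On the circle \<open>cnj \<tau> = 1 / \<tau>\<close>, so the weight is the restriction of a rational function of \<open>\<tau>\<close>.\<close>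

lemma weight_eq:
  assumes \<tau>: "\<tau> \<in> sphere 0 1" and \<zeta>: "\<zeta> \<in> \<bbbD>"
  shows "of_real (weight \<zeta> \<tau>)
    = (\<tau> - of_real r) * (1 - of_real r * \<tau>) * (1 / (\<tau> - \<zeta>) + cnj \<zeta> / (1 - cnj \<zeta> * \<tau>))"
proof -
  have \<tau>1: "\<tau> * cnj \<tau> = 1" using \<tau> complex_norm_square[of \<tau>] by simp
  then have "\<tau> \<noteq> 0" by auto
  have n1: "\<tau> - \<zeta> \<noteq> 0" using \<tau> \<zeta> by auto
  have n3: "1 - cnj \<zeta> * \<tau> = \<tau> * cnj (\<tau> - \<zeta>)" using \<tau>1 by (simp add: algebra_simps)
  have n2: "1 - cnj \<zeta> * \<tau> \<noteq> 0" unfolding n3 using n1 \<open>\<tau> \<noteq> 0\<close> by simp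
  have m: "1 - of_real r * \<tau> = \<tau> * cnj (\<tau> - of_real r)" using \<tau>1 by (simp add: algebra_simps)
  have "1 / (\<tau> - \<zeta>) + cnj \<zeta> / (1 - cnj \<zeta> * \<tau>) = (1 - \<zeta> * cnj \<zeta>) / ((\<tau> - \<zeta>) * (1 - cnj \<zeta> * \<tau>))"
    using n1 n2 by (simp add: add_frac_eq algebra_simps)
  then have "(\<tau> - of_real r) * (1 - of_real r * \<tau>) * (1 / (\<tau> - \<zeta>) + cnj \<zeta> / (1 - cnj \<zeta> * \<tau>))
     = (\<tau> - of_real r) * cnj (\<tau> - of_real r) * (1 - \<zeta> * cnj \<zeta>) / ((\<tau> - \<zeta>) * cnj (\<tau> - \<zeta>))"
    unfolding m n3 using \<open>\<tau> \<noteq> 0\<close> by simp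
  also have "\<dots> = of_real (weight \<zeta> \<tau>)"
    by (simp only: complex_norm_square[symmetric] weight_def of_real_divide of_real_mult of_real_diff of_real_1 of_real_power)
  finally show ?thesis by simp
qed

text \<open>By the rational form of the weight, \<open>weight \<zeta> * P\<close> is \<open>\<tau> - r\<close> times a function with a single pole, at \<open>\<zeta>\<close>. Splitting
off this pole and the value at \<open>0\<close> leaves a map that is annihilated by \<open>L\<close>; the two remaining terms are multiples of
fixed vectors, on which \<open>L\<close> is given by the dual map.\<close>

lemma L_weighted:
  assumes P: "vec_holomorphic_on P (cball 0 1)" and \<zeta>: "\<zeta> \<in> \<bbbD>" "\<zeta> \<noteq> 0"
  shows "L (\<lambda>\<tau>. of_real (weight \<zeta> \<tau>) *s P \<tau>)
    = cdot (dual_map \<zeta>) (P \<zeta>) / \<zeta> + (cnj \<zeta> - 1 / \<zeta>) * cdot (dual_map 0) (P 0)"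
proof -
  define G where "G = (\<lambda>\<tau>. (1 - of_real r * \<tau>) *s P \<tau>)"
  have G: "vec_holomorphic_on G (cball 0 1)"
    unfolding G_def by (intro vec_holomorphic_on_scale P holomorphic_intros)
  have nB: "1 - cnj \<zeta> * \<tau> \<noteq> 0" if "\<tau> \<in> cball 0 1" for \<tau>
  proof
    assume "1 - cnj \<zeta> * \<tau> = 0"
    then have "cmod (cnj \<zeta> * \<tau>) = 1" by simp
    moreover have "cmod (cnj \<zeta> * \<tau>) \<le> cmod \<zeta> * 1"
      unfolding norm_mult using that by (intro mult_mono) auto
    ultimately show False using \<zeta> by simp
  qed
  define K where "K = (\<lambda>\<tau>. (\<chi> i. if \<tau> = \<zeta> then deriv (\<lambda>z. G z $ i) \<zeta> else (G \<tau> $ i - G \<zeta> $ i) / (\<tau> - \<zeta>))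
     + (cnj \<zeta> / (1 - cnj \<zeta> * \<tau>)) *s G \<tau>)"
  have K: "vec_holomorphic_on K (cball 0 1)"
    unfolding K_def
  proof (intro vec_holomorphic_on_add vec_holomorphic_on_scale G)
    show "vec_holomorphic_on (\<lambda>\<tau>. \<chi> i. if \<tau> = \<zeta> then deriv (\<lambda>z. G z $ i) \<zeta> else (G \<tau> $ i - G \<zeta> $ i) / (\<tau> - \<zeta>)) (cball 0 1)"
      unfolding vec_holomorphic_on_def vec_lambda_beta
      by (intro allI pole_lemma) (use G \<zeta> in \<open>auto simp: vec_holomorphic_on_def\<close>)
    show "(\<lambda>z. cnj \<zeta> / (1 - cnj \<zeta> * z)) holomorphic_on cball 0 1"
      using nB by (intro holomorphic_intros) auto
  qed
  \<comment> \<open>The annihilated part: it vanishes at \<open>0\<close> and at \<open>r\<close>.\<close>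
  define a where "a = (\<lambda>\<tau>. (\<tau> - of_real r) *s (K \<tau> - K 0))"
  have a: "vec_holomorphic_on a (cball 0 1)"
    unfolding a_def by (intro vec_holomorphic_on_scale vec_holomorphic_on_diff K vec_holomorphic_on_const holomorphic_intros)
  have La: "L a = 0" by (rule annihilates[OF a]) (simp_all add: a_def)
  let ?k = "\<lambda>\<xi> \<tau>. (\<tau> - of_real r) * \<tau> / (\<tau> - \<xi>)"
  have ck: "continuous_on (sphere 0 1) (?k \<xi>)" if "\<xi> \<in> \<bbbD>" for \<xi>
    using that by (auto intro!: continuous_intros)
  have ca: "continuous_on (sphere 0 1) a"
    by (rule continuous_on_subset[OF vec_holomorphic_on_imp_continuous_on[OF a]]) auto
  let ?u = "((1 - of_real r * \<zeta>) / \<zeta>) *s P \<zeta>" and ?v = "(cnj \<zeta> - 1 / \<zeta>) *s P 0"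
  have "L (\<lambda>\<tau>. a \<tau> + (?k \<zeta> \<tau> *s ?u + ?k 0 \<tau> *s ?v)) = L (\<lambda>\<tau>. of_real (weight \<zeta> \<tau>) *s P \<tau>)"
  proof (rule cong)
    show "continuous_on (sphere 0 1) (\<lambda>\<tau>. a \<tau> + (?k \<zeta> \<tau> *s ?u + ?k 0 \<tau> *s ?v))"
      using ck[of \<zeta>] ck[of 0] \<zeta> by (intro continuous_on_add continuous_on_complex_scale ca continuous_on_const) auto
    fix \<tau> :: complex assume \<tau>: "\<tau> \<in> sphere 0 1"
    have n: "\<tau> - \<zeta> \<noteq> 0" "\<tau> \<noteq> 0" "\<zeta> \<noteq> \<tau>" "\<tau> \<noteq> \<zeta>" using \<tau> \<zeta> by auto
    have nB\<tau>: "1 - cnj \<zeta> * \<tau> \<noteq> 0" using nB \<tau> by auto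
    show "a \<tau> + (?k \<zeta> \<tau> *s ?u + ?k 0 \<tau> *s ?v) = of_real (weight \<zeta> \<tau>) *s P \<tau>"
    proof (rule vec_eq_iff[THEN iffD2, rule_format])
      fix i
      define p where "p = P \<tau> $ i"
      define p0 where "p0 = P 0 $ i"
      define pz where "pz = P \<zeta> $ i"
      define B where "B = cnj \<zeta> / (1 - cnj \<zeta> * \<tau>)"
      define s where "s = 1 - of_real r * \<tau>"
      define sz where "sz = 1 - of_real r * \<zeta>"
      define q where "q = \<tau> - of_real r"
      have K\<tau>: "K \<tau> $ i = (s * p - sz * pz) / (\<tau> - \<zeta>) + B * (s * p)"
        using n by (simp add: K_def G_def p_def pz_def B_def s_def sz_def algebra_simps diff_divide_distrib)
      have K0: "K 0 $ i = (sz * pz - p0) / \<zeta> + cnj \<zeta> * p0"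
        using \<zeta> by (simp add: K_def G_def pz_def p0_def sz_def diff_divide_distrib algebra_simps)
      have alg: "q * (((s * p - sz * pz) / (\<tau> - \<zeta>) + B * (s * p)) - ((sz * pz - p0) / \<zeta> + cnj \<zeta> * p0))
          + (q * \<tau> / (\<tau> - \<zeta>) * (sz / \<zeta> * pz) + q * ((cnj \<zeta> - 1 / \<zeta>) * p0))
        = q * s * (1 / (\<tau> - \<zeta>) + B) * p"
      proof -
        have e: "\<tau> / ((\<tau> - \<zeta>) * \<zeta>) = 1 / \<zeta> + 1 / (\<tau> - \<zeta>)" using n \<zeta> by (simp add: field_simps)
        have "q * \<tau> / (\<tau> - \<zeta>) * (sz / \<zeta> * pz) = q * sz * pz * (\<tau> / ((\<tau> - \<zeta>) * \<zeta>))" by simp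
        also have "\<dots> = q * sz * pz * (1 / \<zeta>) + q * sz * pz * (1 / (\<tau> - \<zeta>))" unfolding e by (simp only: distrib_left)
        finally show ?thesis by (simp add: algebra_simps diff_divide_distrib add_divide_distrib)
      qed
      have "(a \<tau> + (?k \<zeta> \<tau> *s ?u + ?k 0 \<tau> *s ?v)) $ i
        = q * (K \<tau> $ i - K 0 $ i) + (q * \<tau> / (\<tau> - \<zeta>) * (sz / \<zeta> * pz) + q * ((cnj \<zeta> - 1 / \<zeta>) * p0))"
        using n by (simp add: a_def q_def sz_def pz_def p0_def algebra_simps diff_divide_distrib)
      also have "\<dots> = q * s * (1 / (\<tau> - \<zeta>) + B) * p" unfolding K\<tau> K0 by (rule alg)
      also have "\<dots> = (of_real (weight \<zeta> \<tau>) *s P \<tau>) $ i"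
        using weight_eq[OF \<tau> \<zeta>(1)] by (simp add: q_def s_def B_def p_def)
      finally show "(a \<tau> + (?k \<zeta> \<tau> *s ?u + ?k 0 \<tau> *s ?v)) $ i = (of_real (weight \<zeta> \<tau>) *s P \<tau>) $ i" .
    qed
  qed
  moreover have "L (\<lambda>\<tau>. a \<tau> + (?k \<zeta> \<tau> *s ?u + ?k 0 \<tau> *s ?v))
      = L a + (cdot (scalar (?k \<zeta>)) ?u + cdot (scalar (?k 0)) ?v)"
  proof -
    have c: "continuous_on (sphere 0 1) (\<lambda>\<tau>. ?k \<zeta> \<tau> *s ?u)" "continuous_on (sphere 0 1) (\<lambda>\<tau>. ?k 0 \<tau> *s ?v)"
      by (intro continuous_on_complex_scale continuous_on_const ck; use \<zeta> in simp)+
    show ?thesis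
      using add[OF ca continuous_on_add[OF c]] add[OF c] L_scalar[OF ck[of \<zeta>], of ?u] L_scalar[OF ck[of 0], of ?v] \<zeta>
      by simp
  qed
  ultimately show ?thesis unfolding La
    unfolding dual_map_def cdot_simps by simp
qed

lemma weight_nonneg: "\<zeta> \<in> \<bbbD> \<Longrightarrow> 0 \<le> weight \<zeta> \<tau>"
  unfolding weight_def
  by (intro divide_nonneg_nonneg mult_nonneg_nonneg) (auto simp: power_le_one)

lemma continuous_on_weight:
  assumes "\<zeta> \<in> \<bbbD>"
  shows "continuous_on (sphere 0 1) (weight \<zeta>)"
proof -
  have "\<tau> \<noteq> \<zeta>" if "\<tau> \<in> sphere 0 1" for \<tau> using that assms by auto
  then show ?thesis unfolding weight_def by (intro continuous_intros) auto
qed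

text \<open>If \<open>\<phi>\<close> were holomorphic up to the circle and \<open>0 \<le> m \<le> 1\<close>, the map \<open>(1 - m) * \<phi> + m * z\<close> would take the circle into the
closure of \<open>E\<close>. As \<open>L\<close> has real part at least \<open>1\<close> at \<open>\<phi>\<close>, it follows that \<open>Re (L (m * (z - \<phi>))) \<le> 0\<close>; for \<open>m\<close> a multiple of
the weight this is the claim. In general \<open>\<phi>\<close> is replaced by the dilated discs \<open>\<phi> (s * \<zeta>)\<close>, corrected by a linear term
so that they still take \<open>r\<close> to \<open>w\<close>; the correction and the error tend to \<open>0\<close> as \<open>s\<close> tends to \<open>1\<close>.\<close>

lemma dual_inequality:
  assumes E: "open E" "convex E" "0 \<in> E" and \<phi>: "disc_joining E w r \<phi>"
    and z: "z \<in> E" and \<zeta>: "\<zeta> \<in> \<bbbD>" "\<zeta> \<noteq> 0"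
  shows "Re (cdot (dual_map \<zeta>) (z - \<phi> \<zeta>) / \<zeta> + (cnj \<zeta> - 1 / \<zeta>) * cdot (dual_map 0) z) \<le> 0"
proof -
  let ?side = "\<lambda>v. Re (cdot (dual_map \<zeta>) (z - v) / \<zeta> + (cnj \<zeta> - 1 / \<zeta>) * cdot (dual_map 0) z)"
  have \<phi>_hol: "vec_holomorphic_on \<phi> \<bbbD>" and \<phi>E: "\<And>\<xi>. \<xi> \<in> \<bbbD> \<Longrightarrow> \<phi> \<xi> \<in> E"
    and \<phi>0: "\<phi> 0 = 0" and \<phi>r: "\<phi> (of_real r) = w"
    using \<phi> by (auto simp: disc_joining_def)
  have \<phi>_cont: "continuous_on \<bbbD> \<phi>" using \<phi>_hol by (rule vec_holomorphic_on_imp_continuous_on)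
  obtain d where d: "0 < d" "cball 0 d \<subseteq> E" using E(1,3) open_contains_cball by blast
  have "bdd_above (weight \<zeta> ` sphere 0 1)"
    using compact_continuous_image[OF continuous_on_weight[OF \<zeta>(1)]]
    by (simp add: bounded_imp_bdd_above compact_imp_bounded)
  then obtain M where "\<forall>x\<in>weight \<zeta> ` sphere 0 1. x \<le> M" unfolding bdd_above_def by blast
  then have "weight \<zeta> \<tau> \<le> M" if "\<tau> \<in> sphere 0 1" for \<tau> using that by blast
  then have M: "0 < \<bar>M\<bar> + 1" "\<And>\<tau>. \<tau> \<in> sphere 0 1 \<Longrightarrow> weight \<zeta> \<tau> \<le> \<bar>M\<bar> + 1" by force+
  define u where "u = (\<lambda>s::real. (w - \<phi> (of_real (s * r))) /\<^sub>R r)"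
  \<comment> \<open>Dilated discs with the linear correction \<open>\<tau> * u s\<close>.\<close>
  define \<phi>s where "\<phi>s = (\<lambda>(s::real) \<tau>. \<phi> (of_real s * \<tau>) + \<tau> *s u s)"
  have hol: "vec_holomorphic_on (\<phi>s s) (cball 0 1)" if s: "0 < s" "s < 1" for s
  proof -
    have "of_real s * \<tau> \<in> \<bbbD>" if "\<tau> \<in> cball 0 1" for \<tau> :: complex
    proof -
      have "cmod (of_real s * \<tau>) \<le> s * 1" unfolding norm_mult using that s by (intro mult_mono) auto
      then show ?thesis using s by simp
    qed
    then show ?thesis unfolding \<phi>s_def
      by (intro vec_holomorphic_on_add vec_holomorphic_on_scale vec_holomorphic_on_const
          vec_holomorphic_on_compose[OF \<phi>_hol] holomorphic_intros) auto
  qed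
  have s0: "\<phi>s s 0 = 0" for s by (simp add: \<phi>s_def \<phi>0)
  have sr: "\<phi>s s (of_real r) = w" for s
    using r by (simp add: \<phi>s_def u_def flip: scaleR_eq_complex_scale)
  have L\<phi>s: "1 \<le> Re (L (\<phi>s s))" if s: "0 < s" "s < 1" for s
  proof -
    let ?l = "\<lambda>\<tau>. \<tau> *s (w /\<^sub>R r)"
    have "vec_holomorphic_on (\<lambda>\<tau>. \<phi>s s \<tau> - ?l \<tau>) (cball 0 1)"
      by (intro vec_holomorphic_on_diff hol s vec_holomorphic_on_scale vec_holomorphic_on_const holomorphic_intros)
    moreover have "\<phi>s s (of_real r) - ?l (of_real r) = 0"
      using r by (simp add: sr flip: scaleR_eq_complex_scale)
    ultimately have "L (\<lambda>\<tau>. \<phi>s s \<tau> - ?l \<tau>) = 0" by (intro annihilates) (auto simp: s0)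
    moreover have "L (\<lambda>\<tau>. (\<phi>s s \<tau> - ?l \<tau>) + ?l \<tau>) = L (\<lambda>\<tau>. \<phi>s s \<tau> - ?l \<tau>) + L ?l"
      by (intro add continuous_intros continuous_on_subset[OF vec_holomorphic_on_imp_continuous_on[OF hol[OF s]]]) auto
    ultimately show ?thesis using ge_1 by simp
  qed
  have main: "?side (\<phi>s s \<zeta>)
      \<le> (\<bar>M\<bar> + 1) * (norm (u s) / d)" if s: "0 < s" "s < 1" for s
  proof -
    define \<epsilon> where "\<epsilon> = norm (u s) / d"
    have \<epsilon>: "0 \<le> \<epsilon>" using d by (simp add: \<epsilon>_def)
    define \<mu> where "\<mu> = (\<lambda>\<tau>. weight \<zeta> \<tau> / (\<bar>M\<bar> + 1))"
    have lam: "0 \<le> \<mu> \<tau>" "\<mu> \<tau> \<le> 1" if "\<tau> \<in> sphere 0 1" for \<tau>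
      using weight_nonneg[OF \<zeta>(1), of \<tau>] M(2)[OF that] M(1) by (auto simp: \<mu>_def)
    have lam_cont: "continuous_on (sphere 0 1) (\<lambda>\<tau>. complex_of_real (\<mu> \<tau>))"
      unfolding \<mu>_def using M(1) by (intro continuous_intros continuous_on_weight[OF \<zeta>(1)]) auto
    have s_cont: "continuous_on (sphere 0 1) (\<phi>s s)"
      by (rule continuous_on_subset[OF vec_holomorphic_on_imp_continuous_on[OF hol[OF s]]]) auto
    define f where "f = (\<lambda>\<tau>. of_real (\<mu> \<tau>) *s (z - \<phi>s s \<tau>))"
    have f_cont: "continuous_on (sphere 0 1) f" unfolding f_def by (intro continuous_intros lam_cont s_cont)
    have "Re (L (\<lambda>\<tau>. of_real (inverse (1 + \<epsilon>)) *s (\<phi>s s \<tau> + f \<tau>))) \<le> 1"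
    proof (rule le_1)
      show "continuous_on (sphere 0 1) (\<lambda>\<tau>. of_real (inverse (1 + \<epsilon>)) *s (\<phi>s s \<tau> + f \<tau>))"
        by (intro continuous_intros s_cont f_cont)
      show "(\<lambda>\<tau>. of_real (inverse (1 + \<epsilon>)) *s (\<phi>s s \<tau> + f \<tau>)) ` sphere 0 1 \<subseteq> E"
      proof safe
        fix \<tau> :: complex assume \<tau>: "\<tau> \<in> sphere 0 1"
        have "of_real s * \<tau> \<in> \<bbbD>" using \<tau> s by (simp add: norm_mult)
        then have e1: "(1 - \<mu> \<tau>) *\<^sub>R \<phi> (of_real s * \<tau>) + \<mu> \<tau> *\<^sub>R z \<in> E"
          using lam[OF \<tau>] \<phi>E z by (intro convexD[OF E(2)]) auto
        \<comment> \<open>The correction moves the convex combination by \<open>y\<close>, which lies in \<open>\<epsilon> * E\<close>; so the sum lies in \<open>(1 + \<epsilon>) * E\<close>.\<close>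
        define y where "y = (1 - \<mu> \<tau>) *\<^sub>R (\<tau> *s u s)"
        have "norm y \<le> 1 * norm (u s)"
          unfolding y_def norm_scaleR norm_complex_scale using lam[OF \<tau>] \<tau> by (intro mult_mono) auto
        then have y: "norm y \<le> d * \<epsilon>" using d by (simp add: \<epsilon>_def)
        have "y = \<epsilon> *\<^sub>R (y /\<^sub>R \<epsilon>)" using y by (cases "\<epsilon> = 0") auto
        moreover have "y /\<^sub>R \<epsilon> \<in> E"
        proof (cases "\<epsilon> = 0")
          case False
          then have "norm (y /\<^sub>R \<epsilon>) \<le> d" using y \<epsilon> by (simp add: field_simps)
          then show ?thesis using d(2) by auto
        qed (use E(3) in simp)
        ultimately obtain y' where y': "y = \<epsilon> *\<^sub>R y'" "y' \<in> E" by blast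
        have "inverse (1 + \<epsilon>) *\<^sub>R ((1 - \<mu> \<tau>) *\<^sub>R \<phi> (of_real s * \<tau>) + \<mu> \<tau> *\<^sub>R z) + (\<epsilon> * inverse (1 + \<epsilon>)) *\<^sub>R y' \<in> E"
          by (rule convexD[OF E(2) e1 y'(2)]) (use \<epsilon> in \<open>auto simp: field_simps\<close>)
        moreover have "\<phi>s s \<tau> + f \<tau> = ((1 - \<mu> \<tau>) *\<^sub>R \<phi> (of_real s * \<tau>) + \<mu> \<tau> *\<^sub>R z) + \<epsilon> *\<^sub>R y'"
          unfolding y'(1)[symmetric] y_def \<phi>s_def f_def scaleR_eq_complex_scale[symmetric] by (simp add: algebra_simps)
        ultimately show "of_real (inverse (1 + \<epsilon>)) *s (\<phi>s s \<tau> + f \<tau>) \<in> E"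
          unfolding scaleR_eq_complex_scale[symmetric] by (simp add: scaleR_add_right mult.commute)
      qed
    qed
    moreover have "L (\<lambda>\<tau>. of_real (inverse (1 + \<epsilon>)) *s (\<phi>s s \<tau> + f \<tau>)) = of_real (inverse (1 + \<epsilon>)) * (L (\<phi>s s) + L f)"
      by (simp only: scale[OF continuous_on_add[OF s_cont f_cont]] add[OF s_cont f_cont])
    ultimately have "inverse (1 + \<epsilon>) * (Re (L (\<phi>s s)) + Re (L f)) \<le> 1"
      by (simp only: Re_complex_of_real Im_complex_of_real times_complex.simps plus_complex.simps; simp)
    then have "Re (L (\<phi>s s)) + Re (L f) \<le> 1 + \<epsilon>" using \<epsilon> by (simp add: field_simps)
    then have Lf: "Re (L f) \<le> \<epsilon>" using L\<phi>s[OF s] by simp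
    have "L (\<lambda>\<tau>. of_real (weight \<zeta> \<tau>) *s (z - \<phi>s s \<tau>)) = L (\<lambda>\<tau>. of_real (\<bar>M\<bar> + 1) *s f \<tau>)"
      using M(1) by (simp add: f_def \<mu>_def del: of_real_add)
    also have "\<dots> = of_real (\<bar>M\<bar> + 1) * L f" by (rule scale[OF f_cont])
    finally have "Re (L (\<lambda>\<tau>. of_real (weight \<zeta> \<tau>) *s (z - \<phi>s s \<tau>))) = (\<bar>M\<bar> + 1) * Re (L f)"
      by (simp only: Re_complex_of_real Im_complex_of_real times_complex.simps; simp)
    also have "\<dots> \<le> (\<bar>M\<bar> + 1) * \<epsilon>" using Lf M(1) by (intro mult_left_mono) auto
    finally have "Re (L (\<lambda>\<tau>. of_real (weight \<zeta> \<tau>) *s (z - \<phi>s s \<tau>))) \<le> (\<bar>M\<bar> + 1) * \<epsilon>" .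
    moreover have P: "vec_holomorphic_on (\<lambda>\<tau>. z - \<phi>s s \<tau>) (cball 0 1)"
      by (intro vec_holomorphic_on_diff vec_holomorphic_on_const hol s)
    ultimately show ?thesis unfolding L_weighted[OF P \<zeta>] s0 \<epsilon>_def by (simp only: diff_zero)
  qed
  have lim\<phi>: "((\<lambda>s::real. \<phi> (of_real (s * x) * \<xi>)) \<longlongrightarrow> \<phi> (of_real x * \<xi>)) (at_left 1)"
    if "of_real x * \<xi> \<in> \<bbbD>" for x :: real and \<xi>
  proof (rule continuous_on_tendsto_compose[OF \<phi>_cont])
    have "((\<lambda>s::real. of_real (s * x) * \<xi>) \<longlongrightarrow> of_real (1 * x) * \<xi>) (at_left 1)" by (intro tendsto_intros)
    then show "((\<lambda>s::real. of_real (s * x) * \<xi>) \<longlongrightarrow> of_real x * \<xi>) (at_left 1)" by simp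
    then show "\<forall>\<^sub>F s in at_left (1::real). of_real (s * x) * \<xi> \<in> \<bbbD>"
      using that by (intro topological_tendstoD) auto
  qed (use that in auto)
  have u_lim: "(u \<longlongrightarrow> 0) (at_left 1)"
  proof -
    have "(u \<longlongrightarrow> (w - \<phi> (of_real r * 1)) /\<^sub>R r) (at_left 1)"
      unfolding u_def using lim\<phi>[of r 1] r by (intro tendsto_intros) auto
    then show ?thesis by (simp add: \<phi>r)
  qed
  have \<phi>s_lim: "((\<lambda>s. \<phi>s s \<zeta>) \<longlongrightarrow> \<phi> \<zeta>) (at_left 1)"
  proof -
    have "((\<lambda>s. \<zeta> *s u s) \<longlongrightarrow> 0) (at_left 1)"
    proof (rule tendsto_norm_zero_cancel)
      have "((\<lambda>s. cmod \<zeta> * norm (u s)) \<longlongrightarrow> cmod \<zeta> * norm (0::complex^'n)) (at_left 1)"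
        by (intro tendsto_intros u_lim)
      then show "((\<lambda>s. norm (\<zeta> *s u s)) \<longlongrightarrow> 0) (at_left 1)" by (simp add: norm_complex_scale)
    qed
    then show ?thesis unfolding \<phi>s_def using tendsto_add[OF lim\<phi>[of 1 \<zeta>]] \<zeta> by fastforce
  qed
  have cdot_lim: "((\<lambda>s. cdot (dual_map \<zeta>) (z - \<phi>s s \<zeta>)) \<longlongrightarrow> cdot (dual_map \<zeta>) (z - \<phi> \<zeta>)) (at_left 1)"
    unfolding cdot_def by (intro tendsto_intros \<phi>s_lim)
  show ?thesis
  proof (rule tendsto_le)
    show "((\<lambda>s. ?side (\<phi>s s \<zeta>)) \<longlongrightarrow>
?side (\<phi> \<zeta>)) (at_left 1)"
      by (intro tendsto_intros cdot_lim) (use \<zeta> in auto)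
    have "((\<lambda>s. (\<bar>M\<bar> + 1) * (norm (u s) / d)) \<longlongrightarrow> (\<bar>M\<bar> + 1) * (norm (0::complex^'n) / d)) (at_left 1)"
      by (intro tendsto_intros u_lim) (use d in auto)
    then show "((\<lambda>s. (\<bar>M\<bar> + 1) * (norm (u s) / d)) \<longlongrightarrow> 0) (at_left 1)" by simp
    show "\<forall>\<^sub>F s in at_left 1. ?side (\<phi>s s \<zeta>)
        \<le> (\<bar>M\<bar> + 1) * (norm (u s) / d)"
    proof (rule eventually_mono[OF eventually_at_left_real])
      show "(0::real) < 1" by simp
      fix s :: real assume "s \<in> {0<..<1}"
      then have "0 < s" "s < 1" by auto
      then show "?side (\<phi>s s \<zeta>)
        \<le> (\<bar>M\<bar> + 1) * (norm (u s) / d)" by (rule main)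
    qed
  qed simp
qed

end

lemma extremal_disc_with_dual_map:
  fixes E :: "(complex^'n) set"
  assumes E: "open E" "convex E" "bounded E" and 0: "0 \<in> E" and w: "w \<in> E" "w \<noteq> 0"
  obtains r \<phi> h where "0 < r" "r < 1" "disc_joining E w r \<phi>"
    "vec_holomorphic_on h \<bbbD>" "0 < Re (cdot (h (of_real r)) w)"
    "\<And>z \<zeta>. z \<in> E \<Longrightarrow> \<zeta> \<in> \<bbbD> \<Longrightarrow> \<zeta> \<noteq> 0 \<Longrightarrow>
      Re (cdot (h \<zeta>) (z - \<phi> \<zeta>) / \<zeta> + (cnj \<zeta> - 1 / \<zeta>) * cdot (h 0) z) \<le> 0"
proof -
  obtain r \<phi> where r: "0 < r" "r < 1" and \<phi>: "disc_joining E w r \<phi>"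
    and min: "\<And>s \<psi>. 0 < s \<Longrightarrow> s < r \<Longrightarrow> \<not> disc_joining E w s \<psi>"
    using extremal_disc_exists[OF E 0 w] by blast
  obtain L where "dual_functional E w r L"
    using dual_functional_exists[OF E(1,2) 0 r extremal_disc_touches[OF E(1,2) r min]] by blast
  then interpret dual_functional E w r L .
  show ?thesis
    by (rule that[OF r \<phi> dual_map_holomorphic dual_map_nonzero])
       (rule dual_inequality[OF E(1,2) 0 \<phi>])
qed

section \<open>Counting zeros in discs\<close>

text \<open>The radius is explicit because zeros are counted on circles near the unit circle before passing to the disc itself.\<close>

definition single_simple_zero :: "(complex \<Rightarrow> complex) \<Rightarrow> real \<Rightarrow> bool"
  where "single_simple_zero f R \<longleftrightarrow>
    (\<exists>a\<in>ball 0 R. f a = 0 \<and> deriv f a \<noteq> 0 \<and> (\<forall>z\<in>ball 0 R. f z = 0 \<longrightarrow> z = a))"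

lemma single_simple_zero_exists: "single_simple_zero f R \<Longrightarrow> \<exists>a\<in>ball 0 R. f a = 0"
  unfolding single_simple_zero_def by blast

lemma single_simple_zero_unique:
  assumes "single_simple_zero f R" "a \<in> ball 0 R" "f a = 0" "b \<in> ball 0 R" "f b = 0"
  shows "a = b"
  using assms unfolding single_simple_zero_def by blast

lemma finite_zeros_cball:
  assumes "f holomorphic_on \<bbbD>" "R < 1" "z0 \<in> \<bbbD>" "f z0 \<noteq> 0"
  shows "finite {z \<in> cball 0 R. f z = 0}"
proof (cases "f constant_on \<bbbD>")
  case True
  then obtain c where c: "\<And>z. z \<in> \<bbbD> \<Longrightarrow> f z = c" by (auto simp: constant_on_def)
  have "f z \<noteq> 0" if "z \<in> cball 0 R" for z
    using c[of z] c[of z0] assms that by simp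
  then have "{z \<in> cball 0 R. f z = 0} = {}" by blast
  then show ?thesis by (simp only: finite.emptyI)
next
  case False
  have "finite {z \<in> cball 0 R. f z = 0}"
    by (rule holomorphic_compact_finite_zeros[OF assms(1) _ _ _ _ False])
       (use assms in \<open>auto simp: compact_cball\<close>)
  then show ?thesis .
qed

lemma sum_zorder_zeros_Rouche:
  assumes f: "f holomorphic_on \<bbbD>" and g: "g holomorphic_on \<bbbD>" and R: "0 < R" "R < 1"
    and less: "\<And>z. cmod z = R \<Longrightarrow> cmod (g z) < cmod (f z)"
  shows "finite {z \<in> ball 0 R. f z = 0}" "finite {z \<in> ball 0 R. f z + g z = 0}"
    "(\<Sum>p\<in>{z \<in> ball 0 R. f z + g z = 0}. zorder (\<lambda>z. f z + g z) p)
      = (\<Sum>p\<in>{z \<in> ball 0 R. f z = 0}. zorder f p)"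
proof -
  let ?h = "\<lambda>z. f z + g z"
  have h: "?h holomorphic_on \<bbbD>" by (intro holomorphic_intros f g)
  have nz: "f (of_real R) \<noteq> 0" "?h (of_real R) \<noteq> 0"
    using less[of "of_real R"] R by (auto simp: add_eq_0_iff)
  define R' where "R' = (R + 1) / 2"
  have R': "R < R'" "R' < 1" using R by (auto simp: R'_def)
  have fin: "finite {z \<in> cball 0 R'. f z = 0}" "finite {z \<in> cball 0 R'. ?h z = 0}"
    using finite_zeros_cball[OF f R'(2), of "of_real R"] finite_zeros_cball[OF h R'(2), of "of_real R"]
      nz R by auto
  show fin1: "finite {z \<in> ball 0 R. f z = 0}" and fin2: "finite {z \<in> ball 0 R. ?h z = 0}"
    using R' by (auto intro: finite_subset[OF _ fin(1)] finite_subset[OF _ fin(2)])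
  have finb: "finite {z \<in> ball 0 R'. f z = 0}" "finite {z \<in> ball 0 R'. ?h z = 0}"
    by (auto intro: finite_subset[OF _ fin(1)] finite_subset[OF _ fin(2)])
  have sub: "ball 0 R' \<subseteq> \<bbbD>" using R' by auto
  have eq: "(\<Sum>p\<in>{z \<in> ball 0 R'. ?h z = 0}. winding_number (circlepath 0 R) p * zorder ?h p)
      = (\<Sum>p\<in>{z \<in> ball 0 R'. f z = 0}. winding_number (circlepath 0 R) p * zorder f p)"
  proof (rule Rouche_theorem)
    show "f holomorphic_on ball 0 R'" "g holomorphic_on ball 0 R'"
      using f g sub by (auto intro: holomorphic_on_subset)
    show "path_image (circlepath 0 R) \<subseteq> ball 0 R'" using R R' by auto
    show "\<forall>z\<in>path_image (circlepath 0 R). cmod (g z) < cmod (f z)"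
      using less R by auto
    show "\<forall>z. z \<notin> ball 0 R' \<longrightarrow> winding_number (circlepath 0 R) z = 0"
    proof (intro allI impI)
      fix z :: complex assume "z \<notin> ball 0 R'"
      then show "winding_number (circlepath 0 R) z = 0"
        using R R' by (intro winding_number_zero_outside[of _ "cball 0 R"]) auto
    qed
  qed (use finb in auto)
  have red: "(\<Sum>p\<in>{z \<in> ball 0 R'. F z = 0}. winding_number (circlepath 0 R) p * zorder F p)
      = of_int (\<Sum>p\<in>{z \<in> ball 0 R. F z = 0}. zorder F p)"
    if fin: "finite {z \<in> ball 0 R'. F z = 0}" and nz: "\<And>z. cmod z = R \<Longrightarrow> F z \<noteq> 0" for F :: "complex \<Rightarrow> complex"
  proof -
    have "(\<Sum>p\<in>{z \<in> ball 0 R'. F z = 0}. winding_number (circlepath 0 R) p * zorder F p)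
       = (\<Sum>p\<in>{z \<in> ball 0 R. F z = 0}. winding_number (circlepath 0 R) p * zorder F p)"
    proof (rule sum.mono_neutral_right[OF fin])
      show "{z \<in> ball 0 R. F z = 0} \<subseteq> {z \<in> ball 0 R'. F z = 0}" using R' by auto
      show "\<forall>p\<in>{z \<in> ball 0 R'. F z = 0} - {z \<in> ball 0 R. F z = 0}.
          winding_number (circlepath 0 R) p * zorder F p = 0"
      proof
        fix p assume p: "p \<in> {z \<in> ball 0 R'. F z = 0} - {z \<in> ball 0 R. F z = 0}"
        then have "R < cmod p" using nz[of p] by force
        then have "winding_number (circlepath 0 R) p = 0"
          using R by (intro winding_number_zero_outside[of _ "cball 0 R"]) auto
        then show "winding_number (circlepath 0 R) p * zorder F p = 0" by simp
      qed
    qed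
    also have "\<dots> = (\<Sum>p\<in>{z \<in> ball 0 R. F z = 0}. of_int (zorder F p))"
      by (intro sum.cong) (auto simp: winding_number_circlepath)
    finally show ?thesis by simp
  qed
  have nzf: "f z \<noteq> 0" and nzh: "?h z \<noteq> 0" if "cmod z = R" for z
    using less[OF that] by (auto simp: add_eq_0_iff)
  have "of_int (\<Sum>p\<in>{z \<in> ball 0 R. ?h z = 0}. zorder ?h p)
      = (of_int (\<Sum>p\<in>{z \<in> ball 0 R. f z = 0}. zorder f p) :: complex)"
    using eq red[of f, OF finb(1) nzf] red[of ?h, OF finb(2) nzh] by (simp only:)
  then show "(\<Sum>p\<in>{z \<in> ball 0 R. ?h z = 0}. zorder ?h p)
      = (\<Sum>p\<in>{z \<in> ball 0 R. f z = 0}. zorder f p)"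
    by (simp only: of_int_eq_iff)
qed

text \<open>A zero of order \<open>n\<close> is factored as \<open>f w = g w * (w - p)^n\<close> with \<open>g p \<noteq> 0\<close>, whose derivative at \<open>p\<close> vanishes unless \<open>n = 1\<close>.\<close>

lemma zorder_of_zero:
  assumes f: "f holomorphic_on \<bbbD>" and p: "p \<in> \<bbbD>" "f p = 0" and nz: "w0 \<in> \<bbbD>" "f w0 \<noteq> 0"
  shows "1 \<le> zorder f p" "zorder f p = 1 \<longleftrightarrow> deriv f p \<noteq> 0"
proof -
  define g where "g = zor_poly f p"
  obtain r where n: "0 < zorder f p" and r: "0 < r" "cball p r \<subseteq> \<bbbD>" and g: "g holomorphic_on cball p r"
    and fg: "\<And>w. w \<in> cball p r \<Longrightarrow> f w = g w * (w - p) ^ nat (zorder f p)"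
    and gnz: "\<And>w. w \<in> cball p r \<Longrightarrow> g w \<noteq> 0"
  proof -
    have "\<exists>w\<in>\<bbbD>. f w \<noteq> 0" using nz by blast
    note ex = zorder_exist_zero[OF f open_ball connected_ball p(1) this]
    have "0 < zorder f p" using conjunct1[OF ex] p(2) by simp
    then show ?thesis using conjunct2[OF ex] that unfolding g_def by blast
  qed
  show "1 \<le> zorder f p" using n by simp
  define k where "k = nat (zorder f p) - 1"
  have k: "nat (zorder f p) = Suc k" using n by (simp add: k_def)
  have gp: "(g has_field_derivative deriv g p) (at p)"
    using g r(1) by (intro holomorphic_derivI[of _ "ball p r"] holomorphic_on_subset[OF g]) auto
  have "((\<lambda>w. g w * (w - p) ^ Suc k) has_field_derivative g p * 0 ^ k) (at p)"
    using DERIV_mult[OF gp DERIV_power[OF DERIV_diff[OF DERIV_ident DERIV_const[of p]], where n = "Suc k"]]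
    by (cases k) simp_all
  moreover have "eventually (\<lambda>w. f w = g w * (w - p) ^ Suc k) (nhds p)"
    using eventually_nhds_in_open[of "ball p r" p] r(1) by (auto elim!: eventually_mono simp: fg k)
  ultimately have "(f has_field_derivative g p * 0 ^ k) (at p)"
    by (simp add: DERIV_cong_ev[OF refl _ refl])
  then have "deriv f p = g p * 0 ^ k" by (rule DERIV_imp_deriv)
  then show "zorder f p = 1 \<longleftrightarrow> deriv f p \<noteq> 0"
    using gnz[of p] r(1) k n by (auto simp: power_0_left)
qed

text \<open>The number of zeros, counted with multiplicity, is \<open>1\<close> for \<open>f\<close> and hence for \<open>f + g\<close>; orders of zeros are at least \<open>1\<close>.\<close>

lemma single_simple_zero_Rouche:
  assumes f: "f holomorphic_on \<bbbD>" and g: "g holomorphic_on \<bbbD>" and R: "0 < R" "R < 1"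
    and less: "\<And>z. cmod z = R \<Longrightarrow> cmod (g z) < cmod (f z)" and one: "single_simple_zero f R"
  shows "single_simple_zero (\<lambda>z. f z + g z) R"
proof -
  let ?h = "\<lambda>z. f z + g z"
  have h: "?h holomorphic_on \<bbbD>" by (intro holomorphic_intros f g)
  have w0: "complex_of_real R \<in> \<bbbD>" using R by simp
  have nz: "f (of_real R) \<noteq> 0" "?h (of_real R) \<noteq> 0"
    using less[of "of_real R"] R by (auto simp: add_eq_0_iff)
  note rou = sum_zorder_zeros_Rouche[OF f g R less]
  obtain a where a: "a \<in> ball 0 R" "f a = 0" "deriv f a \<noteq> 0" "\<And>z. z \<in> ball 0 R \<Longrightarrow> f z = 0 \<Longrightarrow> z = a"
    using one unfolding single_simple_zero_def by blast
  have "{z \<in> ball 0 R. f z = 0} = {a}" by (rule set_eqI) (use a in \<open>blast\<close>)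
  moreover have "zorder f a = 1" using zorder_of_zero(2)[OF f _ a(2) w0 nz(1)] a(1,3) R by simp
  ultimately have sum: "(\<Sum>p\<in>{z \<in> ball 0 R. ?h z = 0}. zorder ?h p) = 1" using rou(3) by simp
  have ge: "1 \<le> zorder ?h p" if "p \<in> {z \<in> ball 0 R. ?h z = 0}" for p
    using zorder_of_zero(1)[OF h _ _ w0 nz(2), of p] that R by simp
  have "int (card {z \<in> ball 0 R. ?h z = 0}) \<le> (\<Sum>p\<in>{z \<in> ball 0 R. ?h z = 0}. zorder ?h p)"
    using sum_mono[OF ge, of "{z \<in> ball 0 R. ?h z = 0}" "\<lambda>x. x"] by simp
  then have "card {z \<in> ball 0 R. ?h z = 0} \<le> 1" using sum by simp
  moreover have "{z \<in> ball 0 R. ?h z = 0} \<noteq> {}"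
  proof
    assume "{z \<in> ball 0 R. ?h z = 0} = {}"
    then show False using sum by (simp only: sum.empty zero_neq_one)
  qed
  ultimately have "card {z \<in> ball 0 R. ?h z = 0} = 1"
    using rou(2) by (metis One_nat_def card_gt_0_iff le_antisym Suc_leI)
  then obtain b where b: "{z \<in> ball 0 R. ?h z = 0} = {b}" by (auto simp: card_1_singleton_iff)
  then have bb: "b \<in> ball 0 R" "?h b = 0" by auto
  have "deriv ?h b \<noteq> 0"
    using zorder_of_zero(2)[OF h _ bb(2) w0 nz(2)] bb(1) R sum b by simp
  then show ?thesis using b bb unfolding single_simple_zero_def by blast
qed

text \<open>On the circle the values of \<open>f z / z\<close> lie in a compact part of the left half-plane, which is contained in a disc
of radius \<open>K\<close> around \<open>- K\<close> for large \<open>K\<close>. So \<open>f\<close> is close enough to \<open>z \<mapsto> - K * z\<close> for Rouche's theorem.\<close>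

lemma single_simple_zero_inward:
  assumes f: "f holomorphic_on \<bbbD>" and R: "0 < R" "R < 1"
    and neg: "\<And>z. cmod z = R \<Longrightarrow> Re (f z * cnj z) < 0"
  shows "single_simple_zero f R"
proof -
  have "continuous_on (sphere 0 R) (\<lambda>z. cmod (f z))"
    by (intro continuous_intros holomorphic_on_imp_continuous_on holomorphic_on_subset[OF f]) (use R in auto)
  then have "compact ((\<lambda>z. cmod (f z)) ` sphere 0 R)" by (intro compact_continuous_image) auto
  then obtain B where "\<forall>x\<in>(\<lambda>z. cmod (f z)) ` sphere 0 R. norm x \<le> B"
    using compact_imp_bounded bounded_iff by blast
  then have B: "cmod (f z) \<le> B" if "cmod z = R" for z using that by simp
  have "continuous_on (sphere 0 R) (\<lambda>z. Re (f z * cnj z))"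
    by (intro continuous_intros holomorphic_on_imp_continuous_on holomorphic_on_subset[OF f]) (use R in auto)
  moreover have "sphere (0::complex) R \<noteq> {}" using R by simp
  ultimately obtain z0 where z0: "cmod z0 = R" "\<And>z. cmod z = R \<Longrightarrow> Re (f z * cnj z) \<le> Re (f z0 * cnj z0)"
    using continuous_attains_sup[of "sphere 0 R" "\<lambda>z. Re (f z * cnj z)"] by auto
  define m where "m = - Re (f z0 * cnj z0)"
  have m: "0 < m" "\<And>z. cmod z = R \<Longrightarrow> Re (f z * cnj z) \<le> - m"
    using neg[OF z0(1)] z0(2) by (simp_all only: m_def neg_0_less_iff_less minus_minus)
  \<comment> \<open>Large enough for \<open>B^2 < 2 * K * m\<close>, which makes \<open>|f z + K * z| < K * R\<close>.\<close>
  define K where "K = (B^2 + 1) / m"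
  have K: "0 < K" using m by (auto simp: K_def intro!: divide_pos_pos add_nonneg_pos)
  have "single_simple_zero (\<lambda>z. - of_real K * z) R"
    unfolding single_simple_zero_def using R K by (intro bexI[of _ 0]) auto
  then have "single_simple_zero (\<lambda>z. - of_real K * z + (f z + of_real K * z)) R"
  proof (rule single_simple_zero_Rouche[rotated -1])
    fix z :: complex assume z: "cmod z = R"
    have "(cmod (f z + of_real K * z))\<^sup>2 = (cmod (f z))\<^sup>2 + (K * R)\<^sup>2 + 2 * K * Re (f z * cnj z)"
      unfolding z[symmetric] cmod_power2 by (simp add: cmod_def algebra_simps power2_eq_square)
    also have "\<dots> \<le> B\<^sup>2 + (K * R)\<^sup>2 + 2 * K * (- m)"
      using B[OF z] m(2)[OF z] K R by (intro add_mono mult_left_mono power_mono) auto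
    also have "\<dots> < (K * R)\<^sup>2"
    proof -
      have "K * m = B\<^sup>2 + 1" using m(1) by (simp add: K_def)
      then have "B\<^sup>2 < 2 * K * m" using zero_le_power2[of B] by linarith
      then show ?thesis by simp
    qed
    finally have sq: "(cmod (f z + of_real K * z))\<^sup>2 < (K * R)\<^sup>2" .
    have "0 \<le> K * R" using K R by simp
    with sq have "cmod (f z + of_real K * z) < K * R" by (rule power_less_imp_less_base)
    then show "cmod (f z + of_real K * z) < cmod (- of_real K * z)" using K z by (simp add: norm_mult)
  qed (use R in \<open>auto intro!: holomorphic_intros f\<close>)
  then show ?thesis by simp
qed

section \<open>The left inverse of an extremal disc\<close>

lemma norm_cdot_le: "cmod (cdot a z) \<le> norm a * norm z"
proof -
  have "cmod (cdot a z) \<le> (\<Sum>i\<in>UNIV. \<bar>cmod (a $ i)\<bar> * \<bar>cmod (z $ i)\<bar>)"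
    unfolding cdot_def by (rule order_trans[OF norm_sum]) (simp add: norm_mult)
  also have "\<dots> \<le> norm a * norm z" unfolding norm_vec_def by (rule L2_set_mult_ineq)
  finally show ?thesis .
qed

lemma bounded_linear_cdot: "bounded_linear (cdot a)"
proof (rule bounded_linear_intro[of _ "norm a"])
  show "cdot a (t *\<^sub>R x) = t *\<^sub>R cdot a x" for t x
    by (simp only: cdot_simps scaleR_conv_of_real[where 'a=complex])
  show "cmod (cdot a x) \<le> norm x * norm a" for x
    using norm_cdot_le[of a x] by (simp add: mult.commute)
qed simp

text \<open>Caratheodory's form of differentiability, with a complex linear derivative.\<close>

lemma has_derivative_cdotI:
  assumes eq: "eventually (\<lambda>z. f z - f z0 = cdot (b z) (z - z0)) (at z0)"
    and lim: "(b \<longlongrightarrow> a) (at z0)"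
  shows "(f has_derivative cdot a) (at z0)"
proof -
  have "((\<lambda>z. norm (f z - f z0 - cdot a (z - z0)) / norm (z - z0)) \<longlongrightarrow> 0) (at z0)"
  proof (rule Lim_null_comparison)
    show "((\<lambda>z. norm (b z - a)) \<longlongrightarrow> 0) (at z0)"
      using tendsto_norm_zero[OF LIM_zero[OF lim]] .
    show "\<forall>\<^sub>F z in at z0. norm (norm (f z - f z0 - cdot a (z - z0)) / norm (z - z0)) \<le> norm (b z - a)"
      using eq
    proof eventually_elim
      case (elim z)
      have "f z - f z0 - cdot a (z - z0) = cdot (b z - a) (z - z0)"
        unfolding elim by (simp add: cdot_def algebra_simps sum_subtractf sum.distrib)
      then show ?case using norm_cdot_le[of "b z - a" "z - z0"] by (simp add: divide_le_eq)
    qed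
  qed
  then show ?thesis using bounded_linear_cdot by (simp add: has_derivative_iff_norm)
qed

text \<open>The implicit function theorem for an equation that is affine in \<open>z\<close>. A zero persists near \<open>\<rho> z0\<close> under small
changes of \<open>z\<close>, and by uniqueness it is \<open>\<rho> z\<close>; this gives continuity. Writing the equation for \<open>z0\<close> as
\<open>f \<zeta> = g \<zeta> * (\<zeta> - \<rho> z0)\<close> then gives a formula for \<open>\<rho> z - \<rho> z0\<close> that is linear in \<open>z - z0\<close> up to a continuous factor.\<close>

lemma single_zero_has_derivative:
  fixes E :: "(complex^'n) set"
  assumes h: "vec_holomorphic_on h \<bbbD>" and k: "k holomorphic_on \<bbbD>"
    and single: "\<And>z. z \<in> E \<Longrightarrow> single_simple_zero (\<lambda>\<zeta>. cdot (h \<zeta>) z - k \<zeta>) 1"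
    and \<rho>: "\<And>z. z \<in> E \<Longrightarrow> \<rho> z \<in> \<bbbD> \<and> cdot (h (\<rho> z)) z = k (\<rho> z)"
    and "open E" and z0: "z0 \<in> E"
  obtains a where "(\<rho> has_derivative cdot a) (at z0)"
proof -
  define f where "f = (\<lambda>\<zeta>. cdot (h \<zeta>) z0 - k \<zeta>)"
  define \<zeta>0 where "\<zeta>0 = \<rho> z0"
  have fz_hol: "(\<lambda>\<zeta>. cdot (h \<zeta>) z - k \<zeta>) holomorphic_on \<bbbD>" for z
    by (intro holomorphic_intros h k vec_holomorphic_on_const)
  have f_hol: "f holomorphic_on \<bbbD>" unfolding f_def by (rule fz_hol)
  have \<zeta>0: "\<zeta>0 \<in> \<bbbD>" "f \<zeta>0 = 0" using \<rho>[OF z0] by (auto simp: \<zeta>0_def f_def)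
  have unique: "\<xi> = \<rho> z" if "z \<in> E" "\<xi> \<in> \<bbbD>" "cdot (h \<xi>) z - k \<xi> = 0" for z \<xi>
  proof -
    have "cdot (h (\<rho> z)) z - k (\<rho> z) = 0" using \<rho>[OF \<open>z \<in> E\<close>] by simp
    then show ?thesis
      using single_simple_zero_unique[OF single[OF \<open>z \<in> E\<close>]] that \<rho>[OF \<open>z \<in> E\<close>] by blast
  qed
  have deriv_nz: "deriv f \<zeta>0 \<noteq> 0"
  proof -
    obtain a where a: "a \<in> \<bbbD>" "f a = 0" "deriv f a \<noteq> 0"
      using single[OF z0] unfolding single_simple_zero_def f_def by blast
    have "a = \<zeta>0" unfolding \<zeta>0_def using unique[OF z0 a(1)] a(2) by (simp add: f_def)
    then show ?thesis using a(3) by simp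
  qed
  have cont: "(\<rho> \<longlongrightarrow> \<zeta>0) (at z0)"
  proof (rule tendstoI)
    fix e :: real assume "0 < e"
    define e' where "e' = min (e / 2) ((1 - cmod \<zeta>0) / 2)"
    have e': "0 < e'" "e' < e" using \<open>0 < e\<close> \<zeta>0(1) by (auto simp: e'_def)
    have sub: "cball \<zeta>0 e' \<subseteq> \<bbbD>"
    proof
      fix \<xi> assume \<xi>: "\<xi> \<in> cball \<zeta>0 e'"
      have "cmod \<xi> \<le> cmod \<zeta>0 + cmod (\<xi> - \<zeta>0)" using norm_triangle_ineq[of \<zeta>0 "\<xi> - \<zeta>0"] by simp
      also have "\<dots> \<le> cmod \<zeta>0 + (1 - cmod \<zeta>0) / 2"
        using \<xi> by (simp add: e'_def dist_norm norm_minus_commute)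
      also have "\<dots> < 1" using \<zeta>0(1) by (simp add: field_simps)
      finally show "\<xi> \<in> \<bbbD>" by simp
    qed
    have "continuous_on (sphere \<zeta>0 e') (\<lambda>\<xi>. cmod (f \<xi>))"
      using sub sphere_cball
      by (intro continuous_intros holomorphic_on_imp_continuous_on holomorphic_on_subset[OF f_hol]) blast
    moreover have "sphere \<zeta>0 e' \<noteq> {}" using e' by simp
    ultimately obtain \<xi>0 where \<xi>0: "\<xi>0 \<in> sphere \<zeta>0 e'" "\<And>\<xi>. \<xi> \<in> sphere \<zeta>0 e' \<Longrightarrow> cmod (f \<xi>0) \<le> cmod (f \<xi>)"
      using continuous_attains_inf[OF compact_sphere, of \<zeta>0 e' "\<lambda>\<xi>. cmod (f \<xi>)"] by blast
    define m where "m = cmod (f \<xi>0)"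
    have m: "0 < m"
    proof -
      have "\<xi>0 \<in> \<bbbD>" using \<xi>0(1) sub sphere_cball by blast
      then have "f \<xi>0 \<noteq> 0" using unique[OF z0, of \<xi>0] \<xi>0(1) e' by (auto simp: f_def \<zeta>0_def)
      then show ?thesis by (simp add: m_def)
    qed
    have "continuous_on (cball \<zeta>0 e') h"
      by (rule continuous_on_subset[OF vec_holomorphic_on_imp_continuous_on[OF h] sub])
    then have "compact (h ` cball \<zeta>0 e')" by (intro compact_continuous_image) auto
    then obtain B0 where "\<forall>y\<in>h ` cball \<zeta>0 e'. norm y \<le> B0"
      using compact_imp_bounded bounded_iff by blast
    define B where "B = \<bar>B0\<bar> + 1"
    have "0 < B" by (simp add: B_def)
    have B: "norm (h \<xi>) \<le> B" if "\<xi> \<in> cball \<zeta>0 e'" for \<xi>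
    proof -
      have "norm (h \<xi>) \<le> B0" using \<open>\<forall>y\<in>_. _\<close> that by blast
      then show ?thesis unfolding B_def by linarith
    qed
    define d where "d = m / (2 * B)"
    have d: "0 < d" "B * d = m / 2" using m \<open>0 < B\<close> by (auto simp: d_def)
    have close: "dist (\<rho> z) \<zeta>0 < e" if z: "z \<in> E" "dist z z0 < d" for z
    proof -
      let ?g = "\<lambda>\<xi>. cdot (h \<xi>) z - k \<xi>"
      have diff: "cmod (?g \<xi> - f \<xi>) < m / 2" if \<xi>: "\<xi> \<in> cball \<zeta>0 e'" for \<xi>
      proof -
        have eq: "?g \<xi> - f \<xi> = cdot (h \<xi>) (z - z0)" by (simp add: f_def)
        have "cmod (?g \<xi> - f \<xi>) \<le> norm (h \<xi>) * norm (z - z0)" unfolding eq by (rule norm_cdot_le)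
        also have "\<dots> \<le> B * norm (z - z0)" using B[OF \<xi>] by (intro mult_right_mono) auto
        also have "\<dots> < B * d" using z(2) \<open>0 < B\<close> by (intro mult_strict_left_mono) (auto simp: dist_norm)
        finally show ?thesis using d(2) by simp
      qed
      obtain \<xi> where \<xi>: "\<xi> \<in> ball \<zeta>0 e'" "?g \<xi> = 0"
      proof (rule holomorphic_contract_to_zero[of \<zeta>0 e' ?g])
        show "?g holomorphic_on ball \<zeta>0 e'"
          by (rule holomorphic_on_subset[OF fz_hol]) (use sub ball_subset_cball in blast)
        show "continuous_on (cball \<zeta>0 e') ?g"
          by (rule holomorphic_on_imp_continuous_on[OF holomorphic_on_subset[OF fz_hol sub]])
        show "0 < e'" by fact
        fix \<xi> assume \<xi>: "cmod (\<zeta>0 - \<xi>) = e'"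
        have "cmod (?g \<zeta>0) < m / 2" using diff[of \<zeta>0] e' \<zeta>0(2) by simp
        moreover have "m \<le> cmod (f \<xi>)" unfolding m_def using \<xi> by (intro \<xi>0(2)) (simp add: dist_norm)
        moreover have "cmod (?g \<xi> - f \<xi>) < m / 2" using \<xi> by (intro diff) (simp add: dist_norm)
        moreover have "cmod (f \<xi>) \<le> cmod (?g \<xi>) + cmod (?g \<xi> - f \<xi>)"
          using norm_triangle_ineq4[of "?g \<xi>" "?g \<xi> - f \<xi>"] by simp
        ultimately show "cmod (?g \<zeta>0) < cmod (?g \<xi>)" by linarith
      qed
      have "\<xi> = \<rho> z" using \<xi> sub ball_subset_cball by (intro unique[OF z(1)]) blast+
      then show ?thesis using \<xi>(1) e'(2) by (simp add: dist_commute)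
    qed
    have "eventually (\<lambda>z. z \<in> E \<inter> ball z0 d) (at z0)"
      using \<open>open E\<close> z0 d by (intro eventually_at_in_open') auto
    then show "eventually (\<lambda>z. dist (\<rho> z) \<zeta>0 < e) (at z0)"
      by eventually_elim (use close in \<open>auto simp: dist_commute\<close>)
  qed
  have "(f has_field_derivative deriv f \<zeta>0) (at \<zeta>0)"
    using f_hol \<zeta>0(1) by (intro holomorphic_derivI) auto
  then obtain g where g: "\<And>\<xi>. f \<xi> - f \<zeta>0 = g \<xi> * (\<xi> - \<zeta>0)" "isCont g \<zeta>0" "g \<zeta>0 = deriv f \<zeta>0"
    unfolding CARAT_DERIV by blast
  define b where "b = (\<lambda>z. (- 1 / g (\<rho> z)) *s h (\<rho> z))"
  have g_lim: "((\<lambda>z. g (\<rho> z)) \<longlongrightarrow> deriv f \<zeta>0) (at z0)"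
    using isCont_tendsto_compose[OF g(2) cont] g(3) by simp
  have "isCont h \<zeta>0"
    using vec_holomorphic_on_imp_continuous_on[OF h] \<zeta>0(1) by (simp add: continuous_on_eq_continuous_at)
  then have h_lim: "((\<lambda>z. h (\<rho> z)) \<longlongrightarrow> h \<zeta>0) (at z0)" using isCont_tendsto_compose cont by blast
  have b_lim: "(b \<longlongrightarrow> (- 1 / deriv f \<zeta>0) *s h \<zeta>0) (at z0)"
    unfolding b_def vector_scalar_mult_def by (intro tendsto_intros g_lim h_lim deriv_nz)
  have "eventually (\<lambda>z. z \<in> E) (at z0)" using \<open>open E\<close> z0 by (intro eventually_at_in_open') auto
  moreover have "eventually (\<lambda>z. g (\<rho> z) \<noteq> 0) (at z0)"
    using tendsto_imp_eventually_ne[OF g_lim deriv_nz] .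
  ultimately have "eventually (\<lambda>z. \<rho> z - \<rho> z0 = cdot (b z) (z - z0)) (at z0)"
  proof eventually_elim
    case (elim z)
    have "f (\<rho> z) = - cdot (h (\<rho> z)) (z - z0)" using \<rho>[OF elim(1)] by (simp add: f_def)
    then have "g (\<rho> z) * (\<rho> z - \<zeta>0) = - cdot (h (\<rho> z)) (z - z0)" using g(1)[of "\<rho> z"] \<zeta>0(2) by simp
    then have "\<rho> z - \<zeta>0 = - cdot (h (\<rho> z)) (z - z0) / g (\<rho> z)" using elim(2) by (simp add: field_simps)
    then show ?case unfolding b_def \<zeta>0_def cdot_simps by (simp add: diff_divide_distrib)
  qed
  then show ?thesis using has_derivative_cdotI[OF _ b_lim] that by blast
qed

text \<open>Zeros found in discs of radius close to \<open>1\<close> agree by uniqueness.\<close>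

lemma single_simple_zero_unit_disc:
  assumes "\<And>R0. R0 < 1 \<Longrightarrow> \<exists>R. R0 < R \<and> R < 1 \<and> single_simple_zero f R"
  shows "single_simple_zero f 1"
proof -
  obtain R1 where R1: "0 < R1" "R1 < 1" "single_simple_zero f R1" using assms[of 0] by auto
  then obtain a where a: "a \<in> ball 0 R1" "f a = 0" "deriv f a \<noteq> 0"
    unfolding single_simple_zero_def by blast
  have "z = a" if z: "z \<in> \<bbbD>" "f z = 0" for z
  proof -
    obtain R where R: "max R1 (cmod z) < R" "R < 1" "single_simple_zero f R"
      using assms[of "max R1 (cmod z)"] R1 z by auto
    then have "z \<in> ball 0 R" "a \<in> ball 0 R" using a(1) by auto
    then show ?thesis using R(3) z(2) a(2) unfolding single_simple_zero_def by blast
  qed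
  then show ?thesis using a R1 unfolding single_simple_zero_def by (intro bexI[of _ a]) auto
qed

lemma vec_holomorphic_has_derivative:
  fixes \<phi> :: "complex \<Rightarrow> complex^'n"
  assumes "vec_holomorphic_on \<phi> S" "open S" "\<zeta> \<in> S"
  shows "(\<phi> has_derivative (\<lambda>t. t *s (\<chi> i. deriv (\<lambda>\<xi>. \<phi> \<xi> $ i) \<zeta>))) (at \<zeta>)"
proof -
  have bl: "bounded_linear (\<lambda>c::complex. c *s (axis i 1 :: complex^'n))" for i
    by (rule bounded_linear_intro[of _ "norm (axis i 1 :: complex^'n)"])
       (simp_all add: vec_eq_iff algebra_simps norm_complex_scale scaleR_conv_of_real[where 'a=complex])
  have "((\<lambda>\<xi>. \<phi> \<xi> $ i) has_derivative (\<lambda>t. t * deriv (\<lambda>\<xi>. \<phi> \<xi> $ i) \<zeta>)) (at \<zeta>)" for i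
  proof -
    have "((\<lambda>\<xi>. \<phi> \<xi> $ i) has_field_derivative deriv (\<lambda>\<xi>. \<phi> \<xi> $ i) \<zeta>) (at \<zeta>)"
      using assms by (intro holomorphic_derivI) (auto simp: vec_holomorphic_on_def)
    then show ?thesis by (simp add: has_field_derivative_def mult_commute_abs)
  qed
  then have "((\<lambda>\<xi>. \<Sum>i\<in>UNIV. \<phi> \<xi> $ i *s axis i 1) has_derivative
      (\<lambda>t. \<Sum>i\<in>UNIV. (t * deriv (\<lambda>\<xi>. \<phi> \<xi> $ i) \<zeta>) *s axis i 1)) (at \<zeta>)"
    by (intro has_derivative_sum bounded_linear.has_derivative[OF bl])
  moreover have "(\<Sum>i\<in>UNIV. (t * deriv (\<lambda>\<xi>. \<phi> \<xi> $ i) \<zeta>) *s axis i 1)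
      = t *s (\<chi> i. deriv (\<lambda>\<xi>. \<phi> \<xi> $ i) \<zeta>)" for t
    using sum_scale_axis[of "t *s (\<chi> i. deriv (\<lambda>\<xi>. \<phi> \<xi> $ i) \<zeta>)"] by simp
  ultimately show ?thesis by (simp only: sum_scale_axis)
qed

lemma holomorphic_on_compose_vec:
  fixes \<phi> :: "complex \<Rightarrow> complex^'n"
  assumes \<phi>: "vec_holomorphic_on \<phi> S" and "open S"
    and \<rho>: "\<And>t. t \<in> S \<Longrightarrow> \<exists>a. (\<rho> has_derivative cdot a) (at (\<phi> t))"
  shows "(\<lambda>t. \<rho> (\<phi> t)) holomorphic_on S"
  unfolding holomorphic_on_open[OF \<open>open S\<close>]
proof
  fix t assume t: "t \<in> S"
  then obtain a where a: "(\<rho> has_derivative cdot a) (at (\<phi> t))" using \<rho> by blast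
  obtain d where "(\<phi> has_derivative (\<lambda>t. t *s d)) (at t)"
    using vec_holomorphic_has_derivative[OF \<phi> \<open>open S\<close> t] by blast
  from has_derivative_compose[OF this a]
  have "((\<lambda>t. \<rho> (\<phi> t)) has_derivative (\<lambda>t. t * cdot a d)) (at t)" by simp
  moreover have "(\<lambda>t. t * cdot a d) = (*) (cdot a d)" by (rule ext) simp
  ultimately have "((\<lambda>t. \<rho> (\<phi> t)) has_field_derivative cdot a d) (at t)"
    by (simp only: has_field_derivative_def)
  then show "\<exists>f'. ((\<lambda>t. \<rho> (\<phi> t)) has_field_derivative f') (at t)" by blast
qed

text \<open>The perturbed functions \<open>F z \<zeta> - \<eta> * \<zeta>\<close> point inwards on circles close to the unit circle, so they have one simple
zero \<open>\<rho> z\<close>, depending holomorphically on \<open>z\<close>. Along the complex line through \<open>z\<close> these zeros form a normal family in \<open>\<eta>\<close>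
of maps into the disc that take \<open>0\<close> to \<open>0\<close>, so a limit takes the value at \<open>z\<close> inside the disc. On circles that enclose
this limit, Rouche's theorem transfers the count of zeros from the perturbed functions to \<open>F z\<close>.\<close>

lemma single_zero_of_dual_map:
  fixes E :: "(complex^'n) set"
  assumes E: "open E" "convex E" and 0: "0 \<in> E" and r: "0 < r" "r < 1"
    and \<phi>: "vec_holomorphic_on \<phi> \<bbbD>" "\<phi> 0 = 0" "\<phi> (of_real r) = w"
    and h: "vec_holomorphic_on h \<bbbD>" "0 < Re (cdot (h (of_real r)) w)"
    and ineq: "\<And>z \<zeta>. z \<in> E \<Longrightarrow> \<zeta> \<in> \<bbbD> \<Longrightarrow> \<zeta> \<noteq> 0 \<Longrightarrow>
      Re (cdot (h \<zeta>) (z - \<phi> \<zeta>) / \<zeta> + (cnj \<zeta> - 1 / \<zeta>) * cdot (h 0) z) \<le> 0"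
    and z: "z \<in> E"
  shows "single_simple_zero (\<lambda>\<zeta>. cdot (h \<zeta>) z - cdot (h \<zeta>) (\<phi> \<zeta>)) 1"
proof -
  define F where "F = (\<lambda>z \<zeta>. cdot (h \<zeta>) z - cdot (h \<zeta>) (\<phi> \<zeta>))"
  have F_hol: "F z holomorphic_on \<bbbD>" for z
    unfolding F_def by (intro holomorphic_intros h(1) \<phi>(1) vec_holomorphic_on_const)
  \<comment> \<open>On the circle of radius \<open>R\<close> the inequality says that \<open>F z\<close> points inwards up to an error of order \<open>1 - R\<close>.\<close>
  have inward: "Re (F z \<zeta> * cnj \<zeta>) \<le> (1 - R\<^sup>2) * cmod (cdot (h 0) z)"
    if z: "z \<in> E" and \<zeta>: "cmod \<zeta> = R" and R: "0 < R" "R < 1" for z \<zeta> R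
  proof -
    have nz: "\<zeta> \<noteq> 0" using \<zeta> R by auto
    have sq: "\<zeta> * cnj \<zeta> = of_real (R\<^sup>2)" unfolding \<zeta>[symmetric] by (simp flip: complex_norm_square)
    define X where "X = F z \<zeta> / \<zeta> + (cnj \<zeta> - 1 / \<zeta>) * cdot (h 0) z"
    have "Re X \<le> 0" using ineq[OF z, of \<zeta>] \<zeta> R nz by (simp add: X_def F_def)
    have "of_real (R\<^sup>2) * X = F z \<zeta> * cnj \<zeta> + (of_real (R\<^sup>2) - 1) * (cnj \<zeta> * cdot (h 0) z)"
      unfolding X_def sq[symmetric] using nz by (simp add: field_simps)
    then have "R\<^sup>2 * Re X = Re (F z \<zeta> * cnj \<zeta>) + (R\<^sup>2 - 1) * Re (cnj \<zeta> * cdot (h 0) z)"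
      by (metis (no_types, lifting) Re_complex_of_real Im_complex_of_real plus_complex.simps(1) times_complex.simps(1)
          mult_zero_left diff_zero of_real_1 of_real_diff)
    moreover have "R\<^sup>2 * Re X \<le> 0" using \<open>Re X \<le> 0\<close> by (simp add: mult_nonneg_nonpos)
    ultimately have "Re (F z \<zeta> * cnj \<zeta>) \<le> (1 - R\<^sup>2) * Re (cnj \<zeta> * cdot (h 0) z)" by (simp add: algebra_simps)
    also have "\<dots> \<le> (1 - R\<^sup>2) * cmod (cdot (h 0) z)"
    proof (intro mult_left_mono)
      have "Re (cnj \<zeta> * cdot (h 0) z) \<le> R * cmod (cdot (h 0) z)"
        using complex_Re_le_cmod[of "cnj \<zeta> * cdot (h 0) z"] \<zeta> by (simp add: norm_mult)
      also have "\<dots> \<le> 1 * cmod (cdot (h 0) z)" using R by (intro mult_right_mono) auto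
      finally show "Re (cnj \<zeta> * cdot (h 0) z) \<le> cmod (cdot (h 0) z)" by simp
      show "0 \<le> 1 - R\<^sup>2" using R by (simp add: power_le_one)
    qed
    finally show ?thesis .
  qed
  let ?P = "\<lambda>(\<eta>::real) z \<zeta>. cdot (h \<zeta>) z - (cdot (h \<zeta>) (\<phi> \<zeta>) + of_real \<eta> * \<zeta>)"
  have single\<eta>: "single_simple_zero (?P \<eta> z) 1"
    if \<eta>: "0 < \<eta>" and z: "z \<in> E" for \<eta> :: real and z
  proof (rule single_simple_zero_unit_disc)
    fix R0 :: real assume "R0 < 1"
    have "((\<lambda>R::real. (1 - R\<^sup>2) * cmod (cdot (h 0) z) - \<eta> * R\<^sup>2) \<longlongrightarrow> (1 - 1\<^sup>2) * cmod (cdot (h 0) z) - \<eta> * 1\<^sup>2) (at_left 1)"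
      by (intro tendsto_intros)
    then have "eventually (\<lambda>R::real. (1 - R\<^sup>2) * cmod (cdot (h 0) z) - \<eta> * R\<^sup>2 < 0) (at_left 1)"
      by (rule order_tendstoD) (use \<eta> in simp)
    moreover have "eventually (\<lambda>R::real. R \<in> {max R0 0<..<1}) (at_left 1)"
      by (rule eventually_at_left_real) (use \<open>R0 < 1\<close> in simp)
    ultimately have "eventually (\<lambda>R::real. (1 - R\<^sup>2) * cmod (cdot (h 0) z) - \<eta> * R\<^sup>2 < 0 \<and> R \<in> {max R0 0<..<1}) (at_left 1)"
      by (rule eventually_conj)
    then obtain R where R: "(1 - R\<^sup>2) * cmod (cdot (h 0) z) < \<eta> * R\<^sup>2" "R0 < R" "0 < R" "R < 1"
      using eventually_happens'[OF trivial_limit_at_left_real] by fastforce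
    have "single_simple_zero (?P \<eta> z) R"
    proof (rule single_simple_zero_inward[OF _ R(3,4)])
      show "(?P \<eta> z) holomorphic_on \<bbbD>"
        by (intro holomorphic_intros h(1) \<phi>(1) vec_holomorphic_on_const)
      fix \<zeta> :: complex assume \<zeta>: "cmod \<zeta> = R"
      have sq: "\<zeta> * cnj \<zeta> = of_real (R\<^sup>2)" unfolding \<zeta>[symmetric] by (simp flip: complex_norm_square)
      have "(cdot (h \<zeta>) z - (cdot (h \<zeta>) (\<phi> \<zeta>) + of_real \<eta> * \<zeta>)) * cnj \<zeta> = F z \<zeta> * cnj \<zeta> - of_real \<eta> * (\<zeta> * cnj \<zeta>)"
        by (simp add: F_def algebra_simps)
      also have "\<dots> = F z \<zeta> * cnj \<zeta> - of_real (\<eta> * R\<^sup>2)" unfolding sq by simp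
      finally have "Re ((cdot (h \<zeta>) z - (cdot (h \<zeta>) (\<phi> \<zeta>) + of_real \<eta> * \<zeta>)) * cnj \<zeta>) = Re (F z \<zeta> * cnj \<zeta>) - \<eta> * R\<^sup>2"
        by (simp only: minus_complex.simps Re_complex_of_real)
      then show "Re ((cdot (h \<zeta>) z - (cdot (h \<zeta>) (\<phi> \<zeta>) + of_real \<eta> * \<zeta>)) * cnj \<zeta>) < 0"
        using inward[OF z \<zeta> R(3,4)] R(1) by linarith
    qed
    then show "\<exists>R. R0 < R \<and> R < 1 \<and> single_simple_zero (?P \<eta> z) R"
      using R by blast
  qed
  define \<eta> where "\<eta> = (\<lambda>n. inverse (real (Suc n)))"
  have \<eta>: "0 < \<eta> n" for n by (simp add: \<eta>_def)
  have "\<exists>\<rho>. \<forall>z\<in>E. \<rho> z \<in> \<bbbD> \<and> cdot (h (\<rho> z)) z = cdot (h (\<rho> z)) (\<phi> (\<rho> z)) + of_real (\<eta> n) * \<rho> z" for n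
  proof (rule bchoice)
    show "\<forall>z\<in>E. \<exists>x. x \<in> \<bbbD> \<and> cdot (h x) z = cdot (h x) (\<phi> x) + of_real (\<eta> n) * x"
    proof
      fix z assume "z \<in> E"
      from single_simple_zero_exists[OF single\<eta>[OF \<eta>[of n] this]]
      show "\<exists>x. x \<in> \<bbbD> \<and> cdot (h x) z = cdot (h x) (\<phi> x) + of_real (\<eta> n) * x"
        unfolding right_minus_eq by blast
    qed
  qed
  then obtain \<rho> where \<rho>: "\<And>n z. z \<in> E \<Longrightarrow> \<rho> n z \<in> \<bbbD> \<and>
      cdot (h (\<rho> n z)) z = cdot (h (\<rho> n z)) (\<phi> (\<rho> n z)) + of_real (\<eta> n) * \<rho> n z"
    by metis
  have \<rho>0: "\<rho> n 0 = 0" for n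
  proof -
    have "cdot (h (\<rho> n 0)) 0 - (cdot (h (\<rho> n 0)) (\<phi> (\<rho> n 0)) + of_real (\<eta> n) * \<rho> n 0) = 0"
      using \<rho>[OF 0, of n] by simp
    moreover have "cdot (h 0) 0 - (cdot (h 0) (\<phi> 0) + of_real (\<eta> n) * 0) = 0" by (simp add: \<phi>(2))
    moreover have "\<rho> n 0 \<in> \<bbbD>" "(0::complex) \<in> \<bbbD>" using \<rho>[OF 0] by auto
    ultimately show ?thesis using single_simple_zero_unique[OF single\<eta>[OF \<eta>[of n] 0]] by blast
  qed
  define S where "S = {t. t *s z \<in> E}"
  have S: "open S" "convex S" unfolding S_def by (rule open_convex_complex_line_slice[OF E])+
  have S01: "0 \<in> S" "1 \<in> S" using 0 z by (auto simp: S_def)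
  have \<rho>_hol: "(\<lambda>t. \<rho> n (t *s z)) holomorphic_on S" for n
  proof (rule holomorphic_on_compose_vec[OF _ S(1)])
    show "vec_holomorphic_on (\<lambda>t. t *s z) S"
      by (intro vec_holomorphic_on_scale vec_holomorphic_on_const holomorphic_intros)
    fix t assume "t \<in> S"
    then have "t *s z \<in> E" by (simp add: S_def)
    show "\<exists>a. (\<rho> n has_derivative cdot a) (at (t *s z))"
      by (rule single_zero_has_derivative[OF h(1) _ single\<eta>[OF \<eta>] \<rho> E(1) \<open>t *s z \<in> E\<close>])
         (auto intro!: holomorphic_intros h \<phi>)
  qed
  obtain g q where g: "g holomorphic_on S" and q: "strict_mono (q :: nat \<Rightarrow> nat)"
    and lim: "\<And>t. t \<in> S \<Longrightarrow> (\<lambda>n. \<rho> (q n) (t *s z)) \<longlonglongrightarrow> g t"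
  proof (rule Montel[of S "range (\<lambda>n t. \<rho> n (t *s z))" "\<lambda>n t. \<rho> n (t *s z)"])
    show "\<exists>B. \<forall>h\<in>range (\<lambda>n t. \<rho> n (t *s z)). \<forall>t\<in>K. cmod (h t) \<le> B" if "K \<subseteq> S" for K
    proof (intro exI[of _ 1] ballI)
      fix f t assume "f \<in> range (\<lambda>n t. \<rho> n (t *s z))" "t \<in> K"
      then show "cmod (f t) \<le> 1" using that \<rho>[of "t *s z"] by (auto simp: S_def less_imp_le)
    qed
  qed (use S \<rho>_hol in auto)
  have g_le: "cmod (g t) \<le> 1" if "t \<in> S" for t
    by (rule LIMSEQ_le_const2[OF tendsto_norm[OF lim[OF that]]])
       (use \<rho>[of "t *s z"] that in \<open>auto simp: S_def less_imp_le\<close>)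
  have g0: "g 0 = 0" using LIMSEQ_unique[OF lim[OF S01(1)], of 0] by (simp add: \<rho>0)
  define \<zeta>1 where "\<zeta>1 = g 1"
  have \<zeta>1: "cmod \<zeta>1 < 1"
  proof (rule ccontr)
    assume "\<not> cmod \<zeta>1 < 1"
    then have "cmod (g t) \<le> cmod (g 1)" if "t \<in> S" for t using g_le[OF that] by (simp add: \<zeta>1_def)
    then have "g constant_on S"
      using maximum_modulus_principle[OF g S(1) convex_connected[OF S(2)] S(1) order_refl S01(2)] by blast
    then have "g 1 = g 0" using S01 by (auto simp: constant_on_def)
    then show False using \<open>\<not> cmod \<zeta>1 < 1\<close> g0 by (simp add: \<zeta>1_def)
  qed
  have lim1: "(\<lambda>n. \<rho> (q n) z) \<longlonglongrightarrow> \<zeta>1" using lim[OF S01(2)] by (simp add: \<zeta>1_def)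
  have \<eta>q: "(\<lambda>n. \<eta> (q n)) \<longlonglongrightarrow> 0"
    using LIMSEQ_subseq_LIMSEQ[OF LIMSEQ_inverse_real_of_nat q] by (simp add: \<eta>_def o_def)
  \<comment> \<open>If \<open>F z\<close> vanished identically, the inequality at \<open>r\<close> for a point slightly beyond \<open>z\<close> on the ray from \<open>0\<close> would contradict \<open>h(2)\<close>.\<close>
  have nonzero: "\<exists>\<xi>\<in>\<bbbD>. F z \<xi> \<noteq> 0"
  proof (rule ccontr)
    assume "\<not> (\<exists>\<xi>\<in>\<bbbD>. F z \<xi> \<noteq> 0)"
    then have zero: "F z \<xi> = 0" if "\<xi> \<in> \<bbbD>" for \<xi> using that by blast
    have c0: "cdot (h 0) z = 0" using zero[of 0] \<phi>(2) by (simp add: F_def)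
    have rD: "complex_of_real r \<in> \<bbbD>" using r by simp
    have cr: "cdot (h (of_real r)) z = cdot (h (of_real r)) w" using zero[OF rD] \<phi>(3) by (simp add: F_def)
    obtain e where e: "0 < e" "cball z e \<subseteq> E" using E(1) z open_contains_cball by blast
    define \<kappa> where "\<kappa> = e / (norm z + 1)"
    have "0 < norm z + 1" using norm_ge_zero[of z] by linarith
    then have \<kappa>: "0 < \<kappa>" "\<kappa> * (norm z + 1) = e" using e(1) by (auto simp: \<kappa>_def)
    then have "\<kappa> * norm z \<le> e" by (simp add: distrib_left)
    have "z + \<kappa> *\<^sub>R z \<in> cball z e" using \<kappa>(1) \<open>\<kappa> * norm z \<le> e\<close> by (simp add: dist_norm)
    then have "z + \<kappa> *\<^sub>R z \<in> E" using e by blast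
    from ineq[OF this rD]
    have "Re (cdot (h (of_real r)) (\<kappa> *\<^sub>R z) / of_real r) \<le> 0"
      using r by (simp add: c0 \<phi>(3) cr)
    then have "Re (cdot (h (of_real r)) w) * (\<kappa> / r) \<le> 0" by (simp add: cr mult.commute)
    moreover have "0 < Re (cdot (h (of_real r)) w) * (\<kappa> / r)" using h(2) \<kappa>(1) r by (intro mult_pos_pos) auto
    ultimately show False by linarith
  qed
  have "single_simple_zero (F z) 1"
  proof (rule single_simple_zero_unit_disc)
    fix R0 :: real assume "R0 < 1"
    define R1 where "R1 = max (cmod \<zeta>1) (max R0 0)"
    have R1: "R1 < 1" "cmod \<zeta>1 \<le> R1" "R0 \<le> R1" "0 \<le> R1" using \<open>R0 < 1\<close> \<zeta>1 by (auto simp: R1_def)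
    define R2 where "R2 = (R1 + 1) / 2"
    have R2: "R1 < R2" "R2 < 1" using R1 by (auto simp: R2_def)
    obtain \<xi> where \<xi>: "\<xi> \<in> \<bbbD>" "F z \<xi> \<noteq> 0" using nonzero by blast
    have "finite {\<zeta> \<in> cball 0 R2. F z \<zeta> = 0}" by (rule finite_zeros_cball[OF F_hol R2(2) \<xi>])
    then have "infinite ({R1<..<R2} - cmod ` {\<zeta> \<in> cball 0 R2. F z \<zeta> = 0})"
      using infinite_Ioo[OF R2(1)] by (simp add: Diff_infinite_finite)
    then obtain R where "R \<in> {R1<..<R2} - cmod ` {\<zeta> \<in> cball 0 R2. F z \<zeta> = 0}"
      by (metis finite.emptyI ex_in_conv)
    then have R: "R1 < R" "R < R2" and nzR: "\<And>\<zeta>. cmod \<zeta> = R \<Longrightarrow> F z \<zeta> \<noteq> 0" by auto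
    have R01: "0 < R" "R < 1" using R R1 R2 by auto
    have "continuous_on (sphere 0 R) (\<lambda>\<zeta>. cmod (F z \<zeta>))"
      by (intro continuous_intros holomorphic_on_imp_continuous_on holomorphic_on_subset[OF F_hol]) (use R01 in auto)
    moreover have "sphere (0::complex) R \<noteq> {}" using R01 by simp
    ultimately obtain \<xi>0 where \<xi>0: "\<xi>0 \<in> sphere 0 R" "\<And>\<zeta>. \<zeta> \<in> sphere 0 R \<Longrightarrow> cmod (F z \<xi>0) \<le> cmod (F z \<zeta>)"
      using continuous_attains_inf[OF compact_sphere, of 0 R "\<lambda>\<zeta>. cmod (F z \<zeta>)"] by blast
    define m where "m = cmod (F z \<xi>0)"
    have m: "0 < m" using \<xi>0(1) nzR[of \<xi>0] by (simp add: m_def)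
    have "eventually (\<lambda>n. \<eta> (q n) < m / 2) sequentially" using m by (intro order_tendstoD(2)[OF \<eta>q]) simp
    moreover have "eventually (\<lambda>n. cmod (\<rho> (q n) z) < R) sequentially"
      using order_tendstoD(2)[OF tendsto_norm[OF lim1]] R R1 by simp
    ultimately have "eventually (\<lambda>n. \<eta> (q n) < m / 2 \<and> cmod (\<rho> (q n) z) < R) sequentially"
      by (rule eventually_conj)
    then obtain n where n: "\<eta> (q n) < m / 2" "cmod (\<rho> (q n) z) < R"
      using eventually_happens'[OF sequentially_bot] by blast
    let ?f = "?P (\<eta> (q n)) z"
    have "single_simple_zero ?f R"
    proof -
      have z0: "?f (\<rho> (q n) z) = 0" using \<rho>[OF z, of "q n"] by simp
      have "single_simple_zero ?f 1" by (rule single\<eta>[OF \<eta> z])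
      then obtain a where a: "a \<in> \<bbbD>" "deriv ?f a \<noteq> 0" "\<forall>\<zeta>\<in>\<bbbD>. ?f \<zeta> = 0 \<longrightarrow> \<zeta> = a"
        unfolding single_simple_zero_def by blast
      have "\<rho> (q n) z = a" using a(3) z0 \<rho>[OF z, of "q n"] by blast
      moreover have "ball 0 R \<subseteq> \<bbbD>" using R01 by auto
      moreover have "\<rho> (q n) z \<in> ball 0 R" using n(2) by simp
      ultimately show ?thesis unfolding single_simple_zero_def using a z0 by blast
    qed
    then have "single_simple_zero (\<lambda>\<zeta>. ?f \<zeta> + of_real (\<eta> (q n)) * \<zeta>) R"
    proof (rule single_simple_zero_Rouche[OF _ _ R01, rotated -1])
      fix \<zeta> :: complex assume \<zeta>: "cmod \<zeta> = R"
      have "?f \<zeta> = F z \<zeta> - of_real (\<eta> (q n)) * \<zeta>" by (simp add: F_def)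
      then have "cmod (F z \<zeta>) - cmod (of_real (\<eta> (q n)) * \<zeta>) \<le> cmod (?f \<zeta>)" 
        by (simp only: norm_triangle_ineq2)
      moreover have "m \<le> cmod (F z \<zeta>)" unfolding m_def using \<zeta> by (intro \<xi>0(2)) simp
      moreover have "cmod (of_real (\<eta> (q n)) * \<zeta>) < m / 2"
      proof -
        have "cmod (of_real (\<eta> (q n)) * \<zeta>) = \<eta> (q n) * R" using \<eta>[of "q n"] \<zeta> by (simp add: norm_mult)
        also have "\<dots> \<le> \<eta> (q n) * 1" using R01 \<eta>[of "q n"] by (intro mult_left_mono) auto
        finally show ?thesis using n(1) by simp
      qed
      ultimately show "cmod (of_real (\<eta> (q n)) * \<zeta>) < cmod (?f \<zeta>)" by linarith
    qed (intro holomorphic_intros h(1) \<phi>(1) vec_holomorphic_on_const)+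
    then have "single_simple_zero (F z) R" by (simp add: F_def)
    then show "\<exists>R>R0. R < 1 \<and> single_simple_zero (F z) R" using R R1 R01 by (intro exI[of _ R]) auto
  qed
  then show ?thesis by (simp add: F_def)
qed

section \<open>Existence of Lempert projection devices\<close>

text \<open>The map \<open>\<rho>\<close> is holomorphic into the disc, so it does not increase the length of any chain of discs, by the
Schwarz-Pick lemma and the triangle inequality; the disc \<open>\<phi>\<close> itself is a chain of length \<open>poincare_dist \<zeta> \<omega>\<close>.\<close>

lemma kobayashi_dist_retract:
  fixes D :: "(complex^'n) set"
  assumes \<phi>: "holomorphic_disc D \<phi>"
    and \<rho>: "\<And>z. z \<in> D \<Longrightarrow> \<rho> z \<in> \<bbbD>" "\<And>z. z \<in> D \<Longrightarrow> \<exists>a. (\<rho> has_derivative cdot a) (at z)"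
    and inv: "\<And>\<zeta>. \<zeta> \<in> \<bbbD> \<Longrightarrow> \<rho> (\<phi> \<zeta>) = \<zeta>"
    and \<zeta>: "\<zeta> \<in> \<bbbD>" and \<omega>: "\<omega> \<in> \<bbbD>"
  shows "kobayashi_dist D (\<phi> \<zeta>) (\<phi> \<omega>) = poincare_dist \<zeta> \<omega>"
proof -
  have step: "poincare_dist (\<rho> (\<psi> a)) (\<rho> (\<psi> b)) \<le> poincare_dist a b"
    if \<psi>: "holomorphic_disc D \<psi>" and "a \<in> \<bbbD>" "b \<in> \<bbbD>" for \<psi> a b
  proof (rule poincare_dist_contraction[of "\<lambda>\<zeta>. \<rho> (\<psi> \<zeta>)"])
    have im: "\<psi> \<zeta> \<in> D" if "\<zeta> \<in> \<bbbD>" for \<zeta> using \<psi> that by (auto simp: holomorphic_disc_def)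
    show "(\<lambda>\<zeta>. \<rho> (\<psi> \<zeta>)) holomorphic_on \<bbbD>"
      using \<psi> \<rho>(2) im by (intro holomorphic_on_compose_vec) (auto simp: holomorphic_disc_def vec_holomorphic_on_def)
    show "(\<lambda>\<zeta>. \<rho> (\<psi> \<zeta>)) ` \<bbbD> \<subseteq> \<bbbD>" using \<rho>(1) im by blast
  qed fact+
  have chain: "poincare_dist (\<rho> (p 0)) (\<rho> (p m)) \<le> (\<Sum>j<m. poincare_dist (\<zeta> j) (\<omega> j))"
    if "p 0 \<in> D" "\<forall>j<m. holomorphic_disc D (\<psi> j) \<and> \<zeta> j \<in> \<bbbD> \<and> \<omega> j \<in> \<bbbD> \<and> \<psi> j (\<zeta> j) = p j \<and> \<psi> j (\<omega> j) = p (Suc j)"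
    for m and p :: "nat \<Rightarrow> complex^'n" and \<psi> \<zeta> \<omega>
    using that
  proof (induction m)
    case 0
    then show ?case by (simp add: poincare_dist_self)
  next
    case (Suc m)
    have m: "holomorphic_disc D (\<psi> m)" "\<zeta> m \<in> \<bbbD>" "\<omega> m \<in> \<bbbD>" "p m = \<psi> m (\<zeta> m)" "p (Suc m) = \<psi> m (\<omega> m)"
      using Suc.prems(2) by (metis lessI)+
    have pD: "p m \<in> D" "p (Suc m) \<in> D" using m by (auto simp: holomorphic_disc_def)
    have "poincare_dist (\<rho> (p 0)) (\<rho> (p (Suc m)))
        \<le> poincare_dist (\<rho> (p 0)) (\<rho> (p m)) + poincare_dist (\<rho> (p m)) (\<rho> (p (Suc m)))"
      by (intro poincare_dist_triangle \<rho>(1) pD Suc.prems(1))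
    also have "\<dots> \<le> (\<Sum>j<m. poincare_dist (\<zeta> j) (\<omega> j)) + poincare_dist (\<zeta> m) (\<omega> m)"
    proof (rule add_mono)
      show "poincare_dist (\<rho> (p 0)) (\<rho> (p m)) \<le> (\<Sum>j<m. poincare_dist (\<zeta> j) (\<omega> j))"
        using Suc.prems by (intro Suc.IH) auto
      show "poincare_dist (\<rho> (p m)) (\<rho> (p (Suc m))) \<le> poincare_dist (\<zeta> m) (\<omega> m)"
        unfolding m(4,5) by (intro step m(1-3))
    qed
    finally show ?case by simp
  qed
  let ?lengths = "{\<Sum>j<m. poincare_dist (\<zeta>' j) (\<omega>' j) | (m::nat) p \<psi> \<zeta>' \<omega>'.
      p 0 = \<phi> \<zeta> \<and> p m = \<phi> \<omega> \<and> (\<forall>j<m. holomorphic_disc D (\<psi> j) \<and> \<zeta>' j \<in> \<bbbD> \<and> \<omega>' j \<in> \<bbbD> \<and>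
              \<psi> j (\<zeta>' j) = p j \<and> \<psi> j (\<omega>' j) = p (Suc j))}"
  show ?thesis
    unfolding kobayashi_dist_def
  proof (rule cInf_eq_minimum)
    show "poincare_dist \<zeta> \<omega> \<in> ?lengths"
      by (rule CollectI, rule exI[of _ 1], rule exI[of _ "\<lambda>n. if n = 0 then \<phi> \<zeta> else \<phi> \<omega>"],
          rule exI[of _ "\<lambda>_. \<phi>"], rule exI[of _ "\<lambda>_. \<zeta>"], rule exI[of _ "\<lambda>_. \<omega>"])
        (use \<phi> \<zeta> \<omega> in simp)
  next
    fix x
    assume "x \<in> ?lengths"
    then obtain m p \<psi> \<zeta>' \<omega>' where x: "x = (\<Sum>j<m. poincare_dist (\<zeta>' j) (\<omega>' j))"
      and p: "p 0 = \<phi> \<zeta>" "p m = \<phi> \<omega>"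
      and all: "\<forall>j<m. holomorphic_disc D (\<psi> j) \<and> \<zeta>' j \<in> \<bbbD> \<and> \<omega>' j \<in> \<bbbD> \<and>
              \<psi> j (\<zeta>' j) = p j \<and> \<psi> j (\<omega>' j) = p (Suc j)"
      by blast
    have "p 0 \<in> D" using p(1) \<phi> \<zeta> by (auto simp: holomorphic_disc_def)
    from chain[OF this all] show "poincare_dist \<zeta> \<omega> \<le> x" unfolding x p inv[OF \<zeta>] inv[OF \<omega>] .
  qed
qed

lemma lempert_device_from_left_inverse:
  fixes D :: "(complex^'n) set"
  assumes \<phi>: "holomorphic_disc D \<phi>"
    and \<rho>: "\<And>z. z \<in> D \<Longrightarrow> \<rho> z \<in> \<bbbD>" "\<And>z. z \<in> D \<Longrightarrow> \<exists>a. (\<rho> has_derivative cdot a) (at z)"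
    and inv: "\<And>\<zeta>. \<zeta> \<in> \<bbbD> \<Longrightarrow> \<rho> (\<phi> \<zeta>) = \<zeta>"
    and fibre: "\<And>\<zeta>. \<zeta> \<in> \<bbbD> \<Longrightarrow> \<exists>H. complex_hyperplane H \<and> {z \<in> D. \<rho> z = \<zeta>} = D \<inter> H"
  shows "lempert_device D \<phi> (\<lambda>z. \<phi> (\<rho> z)) \<rho>"
  unfolding lempert_device_def
proof (intro conjI ballI)
  show "complex_geodesic D \<phi>"
    unfolding complex_geodesic_def using \<phi> kobayashi_dist_retract[OF \<phi> \<rho> inv] by blast
  have im: "\<phi> \<zeta> \<in> D" if "\<zeta> \<in> \<bbbD>" for \<zeta> using \<phi> that by (auto simp: holomorphic_disc_def)
  have inj: "\<zeta> = \<omega>" if "\<phi> \<zeta> = \<phi> \<omega>" "\<zeta> \<in> \<bbbD>" "\<omega> \<in> \<bbbD>" for \<zeta> \<omega> using inv that by metis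
  show "\<rho> z = inv_into \<bbbD> \<phi> (\<phi> (\<rho> z))" if "z \<in> D" for z
    using inj \<rho>(1)[OF that] by (intro inv_into_f_f[symmetric] inj_onI) auto
  show "lempert_projection D \<phi> (\<lambda>z. \<phi> (\<rho> z))"
    unfolding lempert_projection_def
  proof (intro conjI ballI)
    show "holomorphic_self_map D (\<lambda>z. \<phi> (\<rho> z))"
      unfolding holomorphic_self_map_def holomorphic_map_on_def
    proof (intro conjI ballI)
      show "(\<lambda>z. \<phi> (\<rho> z)) ` D \<subseteq> D" using im \<rho>(1) by blast
      fix z assume z: "z \<in> D"
      obtain a where a: "(\<rho> has_derivative cdot a) (at z)" using \<rho>(2)[OF z] by blast
      obtain d where d: "(\<phi> has_derivative (\<lambda>t. t *s d)) (at (\<rho> z))"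
        using vec_holomorphic_has_derivative[OF _ open_ball \<rho>(1)[OF z], of \<phi>] \<phi>
        by (auto simp: holomorphic_disc_def vec_holomorphic_on_def)
      define J where "J = (\<chi> i j. d $ i * a $ j)"
      have "cdot a v *s d = J *v v" for v
        by (simp add: vec_eq_iff J_def matrix_vector_mult_def cdot_def sum_distrib_left mult_ac)
      then have "((\<lambda>z. \<phi> (\<rho> z)) has_derivative (\<lambda>v. J *v v)) (at z)"
        using has_derivative_compose[OF a d] by simp
      then show "\<exists>J. ((\<lambda>z. \<phi> (\<rho> z)) has_derivative (\<lambda>v. J *v v)) (at z within D)"
        using has_derivative_at_withinI by blast
    qed
    show "(\<lambda>z. \<phi> (\<rho> z)) ` D = \<phi> ` \<bbbD>"
    proof
      show "\<phi> ` \<bbbD> \<subseteq> (\<lambda>z. \<phi> (\<rho> z)) ` D"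
      proof safe
        fix \<zeta> :: complex assume \<zeta>: "\<zeta> \<in> \<bbbD>"
        then have "\<phi> \<zeta> = \<phi> (\<rho> (\<phi> \<zeta>))" using inv by simp
        then show "\<phi> \<zeta> \<in> (\<lambda>z. \<phi> (\<rho> z)) ` D" using im[OF \<zeta>] by blast
      qed
    qed (use \<rho>(1) in blast)
    show "\<phi> (\<rho> (\<phi> (\<rho> z))) = \<phi> (\<rho> z)" if "z \<in> D" for z using inv \<rho>(1)[OF that] by simp
    show "\<phi> (\<rho> z) = z" if "z \<in> \<phi> ` \<bbbD>" for z using that inv by auto
    show "\<exists>H. complex_hyperplane H \<and> {z \<in> D. \<phi> (\<rho> z) = \<phi> \<zeta>} = D \<inter> H" if \<zeta>: "\<zeta> \<in> \<bbbD>" for \<zeta>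
    proof -
      have "{z \<in> D. \<phi> (\<rho> z) = \<phi> \<zeta>} = {z \<in> D. \<rho> z = \<zeta>}" using inj \<rho>(1) \<zeta> by blast
      then show ?thesis using fibre[OF \<zeta>] by simp
    qed
  qed
qed

text \<open>The value \<open>\<rho> z\<close> is the unique zero of \<open>\<zeta> \<mapsto> cdot (h \<zeta>) (z - \<phi> \<zeta>)\<close>, where \<open>h\<close> is the dual map of the extremal disc \<open>\<phi>\<close>.
The fibre of \<open>\<rho>\<close> over \<open>\<zeta>\<close> is the hyperplane section defined by \<open>h \<zeta>\<close>, which is not \<open>0\<close> because otherwise \<open>\<rho>\<close> would be
constant.\<close>

theorem lempert_device_exists:
  fixes D :: "(complex^'n) set"
  assumes D: "open D" "convex D" "bounded D" and p: "p \<in> D" and q: "q \<in> D" "p \<noteq> q"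
  obtains r \<phi> \<rho> where "0 < r" "r < 1" "\<phi> 0 = p" "\<phi> (of_real r) = q" "holomorphic_disc D \<phi>"
    "\<And>z. z \<in> D \<Longrightarrow> \<rho> z \<in> \<bbbD>" "\<And>z. z \<in> D \<Longrightarrow> \<exists>a. (\<rho> has_derivative cdot a) (at z)"
    "\<And>\<zeta>. \<zeta> \<in> \<bbbD> \<Longrightarrow> \<rho> (\<phi> \<zeta>) = \<zeta>"
    "lempert_device D \<phi> (\<lambda>z. \<phi> (\<rho> z)) \<rho>"
proof -
  define E where "E = (\<lambda>x. x - p) ` D"
  have E_iff: "x \<in> E \<longleftrightarrow> x + p \<in> D" for x unfolding E_def by (auto intro: image_eqI[of _ _ "x + p"])
  have E: "open E" "convex E" "bounded E"
    using D open_translation_subtract[of D p] convex_translation_subtract_eq[of p D] bounded_translation_minus[of D p]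
    by (auto simp: E_def)
  have "0 \<in> E" "q - p \<in> E" "q - p \<noteq> 0" using p q by (auto simp: E_iff)
  then obtain r \<psi> h where r: "0 < r" "r < 1" and \<psi>: "disc_joining E (q - p) r \<psi>"
    and h: "vec_holomorphic_on h \<bbbD>" "0 < Re (cdot (h (of_real r)) (q - p))"
    and ineq: "\<And>z \<zeta>. z \<in> E \<Longrightarrow> \<zeta> \<in> \<bbbD> \<Longrightarrow> \<zeta> \<noteq> 0 \<Longrightarrow>
      Re (cdot (h \<zeta>) (z - \<psi> \<zeta>) / \<zeta> + (cnj \<zeta> - 1 / \<zeta>) * cdot (h 0) z) \<le> 0"
    using extremal_disc_with_dual_map[OF E] by metis
  have \<psi>': "vec_holomorphic_on \<psi> \<bbbD>" "\<psi> 0 = 0" "\<psi> (of_real r) = q - p"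
    and \<psi>E: "\<And>\<zeta>. \<zeta> \<in> \<bbbD> \<Longrightarrow> \<psi> \<zeta> \<in> E"
    using \<psi> by (auto simp: disc_joining_def)
  define \<phi> where "\<phi> = (\<lambda>\<zeta>. \<psi> \<zeta> + p)"
  have \<phi>_hol: "vec_holomorphic_on \<phi> \<bbbD>" unfolding \<phi>_def by (intro vec_holomorphic_on_add \<psi>' vec_holomorphic_on_const)
  have \<phi>D: "\<phi> \<zeta> \<in> D" if "\<zeta> \<in> \<bbbD>" for \<zeta> using \<psi>E[OF that] by (simp add: \<phi>_def E_iff)
  have \<phi>_disc: "holomorphic_disc D \<phi>"
    using \<phi>_hol \<phi>D by (auto simp: holomorphic_disc_def vec_holomorphic_on_def)
  define k where "k = (\<lambda>\<zeta>. cdot (h \<zeta>) (\<phi> \<zeta>))"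
  have k: "k holomorphic_on \<bbbD>" unfolding k_def by (intro holomorphic_intros h(1) \<phi>_hol)
  have single: "single_simple_zero (\<lambda>\<zeta>. cdot (h \<zeta>) z - k \<zeta>) 1" if z: "z \<in> D" for z
  proof -
    have "z - p \<in> E" using z by (simp add: E_iff)
    from single_zero_of_dual_map[OF E(1,2) \<open>0 \<in> E\<close> r \<psi>' h ineq this]
    show ?thesis by (simp add: k_def \<phi>_def algebra_simps)
  qed
  have "\<forall>z\<in>D. \<exists>\<zeta>. \<zeta> \<in> \<bbbD> \<and> cdot (h \<zeta>) z = k \<zeta>"
  proof
    fix z assume "z \<in> D"
    from single_simple_zero_exists[OF single[OF this]]
    show "\<exists>\<zeta>. \<zeta> \<in> \<bbbD> \<and> cdot (h \<zeta>) z = k \<zeta>" unfolding right_minus_eq by blast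
  qed
  then obtain \<rho> where \<rho>: "\<And>z. z \<in> D \<Longrightarrow> \<rho> z \<in> \<bbbD> \<and> cdot (h (\<rho> z)) z = k (\<rho> z)" by metis
  have \<rho>_iff: "\<rho> z = \<zeta> \<longleftrightarrow> cdot (h \<zeta>) z = k \<zeta>" if "z \<in> D" "\<zeta> \<in> \<bbbD>" for z \<zeta>
    using single_simple_zero_unique[OF single[OF that(1)], of "\<rho> z" \<zeta>] \<rho>[OF that(1)] that(2) by auto
  have inv: "\<rho> (\<phi> \<zeta>) = \<zeta>" if "\<zeta> \<in> \<bbbD>" for \<zeta>
    using \<rho>_iff[OF \<phi>D[OF that] that] by (simp add: k_def)
  have h_nz: "h \<zeta> \<noteq> 0" if \<zeta>: "\<zeta> \<in> \<bbbD>" for \<zeta>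
  proof
    assume "h \<zeta> = 0"
    then have "\<rho> z = \<zeta>" if "z \<in> D" for z using \<rho>_iff[OF that \<zeta>] by (simp add: k_def)
    then have "\<rho> (\<phi> 0) = \<zeta>" "\<rho> (\<phi> (of_real r)) = \<zeta>" using \<phi>D r by auto
    then show False using inv[of 0] inv[of "of_real r"] r by simp
  qed
  have der: "\<exists>a. (\<rho> has_derivative cdot a) (at z)" if "z \<in> D" for z
    using single_zero_has_derivative[OF h(1) k single \<rho> D(1) that] by blast
  have fibre: "\<exists>H. complex_hyperplane H \<and> {z \<in> D. \<rho> z = \<zeta>} = D \<inter> H" if \<zeta>: "\<zeta> \<in> \<bbbD>" for \<zeta>
  proof (intro exI[of _ "{z. (\<Sum>i\<in>UNIV. h \<zeta> $ i * z $ i) = k \<zeta>}"] conjI)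
    show "complex_hyperplane {z. (\<Sum>i\<in>UNIV. h \<zeta> $ i * z $ i) = k \<zeta>}"
      unfolding complex_hyperplane_def using h_nz[OF \<zeta>] by blast
    show "{z \<in> D. \<rho> z = \<zeta>} = D \<inter> {z. (\<Sum>i\<in>UNIV. h \<zeta> $ i * z $ i) = k \<zeta>}"
      using \<rho>_iff[OF _ \<zeta>] by (auto simp: cdot_def)
  qed
  show ?thesis
  proof (rule that[OF r _ _ \<phi>_disc _ der inv])
    show "\<phi> 0 = p" "\<phi> (of_real r) = q" using \<psi>' by (auto simp: \<phi>_def)
    show "\<rho> z \<in> \<bbbD>" if "z \<in> D" for z using \<rho>[OF that] by blast
    show "lempert_device D \<phi> (\<lambda>z. \<phi> (\<rho> z)) \<rho>"
      using \<rho> by (intro lempert_device_from_left_inverse \<phi>_disc der inv fibre) auto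
  qed
qed

section \<open>Contraction of iterated function systems\<close>

text \<open>The sequence \<open>x\<close> decreases by the Schwarz lemma. If its limit \<open>y\<close> were positive, a locally uniform limit of the
\<open>g n\<close> would fix both \<open>0\<close> and \<open>y\<close>, hence be a rotation; but by Hurwitz's theorem it omits a limit of the \<open>p n\<close>, whose
modulus is at most \<open>t\<close>.\<close>

lemma omitting_iteration_tendsto_0:
  fixes g :: "nat \<Rightarrow> complex \<Rightarrow> complex" and x :: "nat \<Rightarrow> real"
  assumes g: "\<And>n. g n holomorphic_on \<bbbD>" "\<And>n. g n ` \<bbbD> \<subseteq> \<bbbD>" "\<And>n. g n 0 = 0"
    and x: "\<And>n. 0 < x n" "\<And>n. x n < 1" "\<And>n. g n (of_real (x n)) = of_real (x (Suc n))"
    and omit: "\<And>n. cmod (p n) \<le> t" "t < 1" "\<And>n z. z \<in> \<bbbD> \<Longrightarrow> g n z \<noteq> p n"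
  shows "x \<longlonglongrightarrow> 0"
proof -
  have "x (Suc n) \<le> x n" for n
  proof -
    have "cmod (g n (of_real (x n))) \<le> cmod (of_real (x n))"
    proof (rule Schwarz_Lemma(1)[OF g(1) g(3)])
      show "cmod (g n z) < 1" if "cmod z < 1" for z
      proof -
        have "g n z \<in> \<bbbD>" using g(2) that by (auto simp: image_subset_iff)
        then show ?thesis by simp
      qed
      show "cmod (of_real (x n)) < 1" using x(1,2)[of n] by simp
    qed
    then show ?thesis using x(1)[of n] x(1)[of "Suc n"] x(3) by simp
  qed
  then have dec: "decseq x" by (rule decseq_SucI)
  obtain y where y: "x \<longlonglongrightarrow> y" "\<And>n. y \<le> x n"
    using decseq_convergent[OF dec, of 0] x(1) by (metis less_imp_le)
  have "0 \<le> y" by (rule LIMSEQ_le_const[OF y(1)]) (use x(1) in \<open>auto intro: less_imp_le\<close>)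
  have y1: "y < 1" using y(2)[of 0] x(2)[of 0] by simp
  have "y = 0"
  proof (rule ccontr)
    assume "y \<noteq> 0"
    obtain G q where G: "G holomorphic_on \<bbbD>" and q: "strict_mono (q :: nat \<Rightarrow> nat)"
      and pt: "\<And>z. z \<in> \<bbbD> \<Longrightarrow> (\<lambda>n. g (q n) z) \<longlonglongrightarrow> G z"
      and un: "\<And>K. \<lbrakk>compact K; K \<subseteq> \<bbbD>\<rbrakk> \<Longrightarrow> uniform_limit K (g \<circ> q) G sequentially"
    proof (rule Montel[of \<bbbD> "range g" g])
      show "\<exists>B. \<forall>h\<in>range g. \<forall>z\<in>K. cmod (h z) \<le> B" if "K \<subseteq> \<bbbD>" for K
      proof (intro exI[of _ 1] ballI)
        fix h z assume "h \<in> range g" "z \<in> K"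
        then have "h z \<in> \<bbbD>" using g(2) that by blast
        then show "cmod (h z) \<le> 1" by simp
      qed
    qed (use g(1) in auto)
    have G0: "G 0 = 0" using LIMSEQ_unique[OF pt[of 0], of 0] by (simp add: g(3))
    have G_le: "cmod (G z) \<le> 1" if "z \<in> \<bbbD>" for z
    proof (rule LIMSEQ_le_const2[OF tendsto_norm[OF pt[OF that]]])
      have "g (q n) z \<in> \<bbbD>" for n using g(2) that by blast
      then show "\<exists>N. \<forall>n\<ge>N. cmod (g (q n) z) \<le> 1" by (auto intro: less_imp_le)
    qed
    have Gy: "G (of_real y) = of_real y"
    proof -
      define R where "R = x 0"
      have K: "cball 0 R \<subseteq> (\<bbbD>::complex set)" using x(2)[of 0] by (auto simp: R_def)
      have "(\<lambda>n. (g \<circ> q) n (of_real (x (q n)))) \<longlonglongrightarrow> G (of_real y)"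
      proof (rule uniform_limit_at_convergent_points[OF un[OF compact_cball K]])
        show "continuous_on (cball 0 R) G"
          by (rule holomorphic_on_imp_continuous_on[OF holomorphic_on_subset[OF G K]])
        show "(\<lambda>n. complex_of_real (x (q n))) \<longlonglongrightarrow> of_real y"
          using LIMSEQ_subseq_LIMSEQ[OF y(1) q] by (intro tendsto_of_real) (simp add: o_def)
        show "complex_of_real (x (q n)) \<in> cball 0 R" for n
          using decseqD[OF dec, of 0 "q n"] x(1)[of "q n"] by (simp add: R_def)
        show "complex_of_real y \<in> cball 0 R" using y(2)[of 0] \<open>0 \<le> y\<close> by (simp add: R_def)
      qed
      moreover have "strict_mono (\<lambda>n. Suc (q n))" using q by (simp add: strict_mono_def)
      then have "(\<lambda>n. complex_of_real (x (Suc (q n)))) \<longlonglongrightarrow> of_real y"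
        using LIMSEQ_subseq_LIMSEQ[OF y(1)] by (intro tendsto_of_real) (auto simp: o_def)
      ultimately show ?thesis using LIMSEQ_unique by (auto simp: x(3))
    qed
    have "\<exists>\<alpha>. (\<forall>z. cmod z < 1 \<longrightarrow> G z = \<alpha> * z) \<and> cmod \<alpha> = 1"
    proof -
      have lt: "cmod (G z) < 1" if "cmod z < 1" for z
      proof (rule ccontr)
        assume "\<not> cmod (G z) < 1"
        then have le: "cmod (G u) \<le> cmod (G z)" if "u \<in> \<bbbD>" for u using G_le[OF that] by simp
        have "G constant_on \<bbbD>"
          by (rule maximum_modulus_principle[OF G open_ball connected_ball open_ball order_refl _ le])
             (use that in simp)
        then have "G z = G 0" using that by (auto simp: constant_on_def)
        then show False using \<open>\<not> cmod (G z) < 1\<close> G0 by simp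
      qed
      have "\<exists>z. cmod z < 1 \<and> z \<noteq> 0 \<and> cmod (G z) = cmod z"
        using Gy y1 \<open>0 \<le> y\<close> \<open>y \<noteq> 0\<close> by (intro exI[of _ "of_real y"]) simp
      then show ?thesis using Schwarz_Lemma'[OF G G0 lt] by blast
    qed
    then obtain \<alpha> where \<alpha>: "\<And>z. cmod z < 1 \<Longrightarrow> G z = \<alpha> * z" "cmod \<alpha> = 1" by blast
    have "p n \<in> cball 0 t" for n using omit(1) by simp
    then have "\<forall>n. (p \<circ> q) n \<in> cball 0 t" by simp
    then obtain P s where P: "P \<in> cball 0 t" and s: "strict_mono (s :: nat \<Rightarrow> nat)" "((p \<circ> q) \<circ> s) \<longlonglongrightarrow> P"
      using compact_cball[unfolded compact_def] by metis
    have "G (P / \<alpha>) - P \<noteq> 0"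
    proof (rule Hurwitz_no_zeros[where S = \<bbbD> and \<F> = "\<lambda>n z. g (q (s n)) z - p (q (s n))" and g = "\<lambda>z. G z - P"])
      show "(\<lambda>z. g (q (s n)) z - p (q (s n))) holomorphic_on \<bbbD>" for n by (intro holomorphic_intros g)
      show "(\<lambda>z. G z - P) holomorphic_on \<bbbD>" by (intro holomorphic_intros G)
      show "uniform_limit K (\<lambda>n z. g (q (s n)) z - p (q (s n))) (\<lambda>z. G z - P) sequentially"
        if "compact K" "K \<subseteq> \<bbbD>" for K
      proof (rule uniform_limit_minus)
        show "uniform_limit K (\<lambda>n z. g (q (s n)) z) G sequentially"
          using filterlim_compose[OF un[OF that] filterlim_subseq[OF s(1)]] by (simp add: o_def)
        show "uniform_limit K (\<lambda>n z. p (q (s n))) (\<lambda>z. P) sequentially"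
        proof (rule uniform_limitI)
          fix e :: real assume "0 < e"
          from tendstoD[OF s(2) this] show "\<forall>\<^sub>F n in sequentially. \<forall>z\<in>K. dist (p (q (s n))) P < e"
            by eventually_elim simp
        qed
      qed
      show "\<not> (\<lambda>z. G z - P) constant_on \<bbbD>"
      proof
        assume "(\<lambda>z. G z - P) constant_on \<bbbD>"
        moreover have "(1/2::complex) \<in> \<bbbD>" "(0::complex) \<in> \<bbbD>" by (simp_all add: norm_divide)
        ultimately have "G (1/2) - P = G 0 - P" unfolding constant_on_def by metis
        then show False using \<alpha>(1)[of "1/2"] \<alpha>(2) G0 by auto
      qed
      show "g (q (s n)) z - p (q (s n)) \<noteq> 0" if "z \<in> \<bbbD>" for n z using omit(3)[OF that] by simp
      show "P / \<alpha> \<in> \<bbbD>" using P omit(2) \<alpha>(2) by (simp add: norm_divide)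
    qed auto
    moreover have "cmod (P / \<alpha>) < 1" using P omit(2) \<alpha>(2) by (simp add: norm_divide)
    moreover have "\<alpha> \<noteq> 0" using \<alpha>(2) by force
    ultimately show False using \<alpha>(1)[of "P / \<alpha>"] by simp
  qed
  then show ?thesis using y(1) by simp
qed

text \<open>The hyperbolic ball of radius \<open>C\<close> around \<open>0\<close> is the Euclidean disc of radius \<open>tanh C\<close>, and it is not contained in \<open>U\<close>.\<close>

lemma bloch_radius_omitted_point:
  assumes "bloch_radius poincare_dist \<bbbD> U < ereal C" and C: "0 < C"
  obtains p where "p \<in> \<bbbD>" "p \<notin> U" "cmod p \<le> tanh C"
proof -
  have "\<not> dist_ball poincare_dist \<bbbD> 0 C \<subseteq> U"
  proof
    assume "dist_ball poincare_dist \<bbbD> 0 C \<subseteq> U"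
    then have "ereal C \<le> bloch_radius poincare_dist \<bbbD> U"
      unfolding bloch_radius_def using C by (intro Sup_upper) (auto intro!: exI[of _ C] bexI[of _ 0])
    then show False using assms(1) by simp
  qed
  then obtain p where p: "p \<in> \<bbbD>" "poincare_dist p 0 < C" "p \<notin> U" by (auto simp: dist_ball_def)
  have "cmod p \<le> tanh C"
  proof (rule ccontr)
    assume "\<not> cmod p \<le> tanh C"
    then have "artanh (tanh C) \<le> artanh (cmod p)" using C p(1) by (intro artanh_real_mono) auto
    then show False using p(2) by (simp add: poincare_dist_zero artanh_tanh_real)
  qed
  then show ?thesis using that p by blast
qed

lemma holomorphic_self_map_compose_disc:
  assumes "open D" and f: "holomorphic_self_map D f" and \<phi>: "holomorphic_disc D \<phi>"
  shows "vec_holomorphic_on (\<lambda>\<zeta>. f (\<phi> \<zeta>)) \<bbbD>"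
  unfolding vec_holomorphic_on_def
proof
  fix i
  have "\<exists>a. ((\<lambda>z. f z $ i) has_derivative cdot a) (at z)" if "z \<in> D" for z
  proof -
    have "\<exists>J. (f has_derivative (\<lambda>v. J *v v)) (at z within D)"
      using f that by (simp add: holomorphic_self_map_def holomorphic_map_on_def)
    then obtain J where "(f has_derivative (\<lambda>v. J *v v)) (at z within D)" by (rule exE)
    then have "(f has_derivative (\<lambda>v. J *v v)) (at z)"
      unfolding at_within_open[OF that \<open>open D\<close>] .
    then have "((\<lambda>z. f z $ i) has_derivative (\<lambda>v. (J *v v) $ i)) (at z)"
      by (rule bounded_linear.has_derivative[OF bounded_linear_vec_nth])
    moreover have "(\<lambda>v. (J *v v) $ i) = cdot (J $ i)"
      by (rule ext) (simp add: matrix_vector_mult_def cdot_def)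
    ultimately show ?thesis by auto
  qed
  then show "(\<lambda>\<zeta>. f (\<phi> \<zeta>) $ i) holomorphic_on \<bbbD>"
    using \<phi> by (intro holomorphic_on_compose_vec[of \<phi> \<bbbD> "\<lambda>z. f z $ i"])
      (auto simp: holomorphic_disc_def vec_holomorphic_on_def image_subset_iff)
qed

lemma ifs_mem:
  assumes "\<And>j. f j ` D \<subseteq> D" "z \<in> D"
  shows "ifs f j z \<in> D"
  using assms by (induction j) auto

theorem theorem1p7:
  fixes D X :: "(complex^'n) set"
  assumes "is_domain D" and "bounded D" and "convex D"
    and "X \<subseteq> D"
    and "one_bloch D X"
  shows "degenerate D X"
  unfolding degenerate_def
proof (intro allI impI)
  fix f G
  assume f: "\<forall>j. holomorphic_self_map D (f j) \<and> f j ` D \<subseteq> X" and sub: "subsequential_limit D (ifs f) G"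
  have D: "open D" "convex D" "bounded D" using assms by (auto simp: is_domain_def)
  obtain s where s: "strict_mono (s :: nat \<Rightarrow> nat)"
    and un: "\<And>K. compact K \<Longrightarrow> K \<subseteq> D \<Longrightarrow> uniform_limit K (\<lambda>j. ifs f (s j)) G sequentially"
    using sub by (auto simp: subsequential_limit_def)
  have lim: "(\<lambda>j. ifs f (s j) z) \<longlonglongrightarrow> G z" if "z \<in> D" for z
    using tendsto_uniform_limitI[OF un[of "{z}"], of z] that by simp
  have fD: "f j ` D \<subseteq> D" for j using f assms(4) by blast
  obtain C where C: "0 < C" and bloch: "\<And>\<phi> \<rho> \<rho>'. lempert_device D \<phi> \<rho> \<rho>' \<Longrightarrow>
      \<exists>U. bloch_subdomain poincare_dist \<bbbD> U \<and> \<rho>' ` X \<subseteq> U \<and> bloch_radius poincare_dist \<bbbD> U < ereal C"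
    using assms(5) by (auto simp: one_bloch_def)
  have "G z = G w" if z: "z \<in> D" and w: "w \<in> D" for z w
  proof (cases "\<exists>j. ifs f j z = ifs f j w")
    case True
    then obtain j where j: "ifs f j z = ifs f j w" by blast
    have eq: "ifs f k z = ifs f k w" if "j \<le> k" for k
      using that by (induction rule: dec_induct) (simp_all add: j)
    have "eventually (\<lambda>n. ifs f (s n) z = ifs f (s n) w) sequentially"
      using eventually_ge_at_top[of j]
      by eventually_elim (use eq order_trans[OF _ strict_mono_imp_increasing[OF s]] in blast)
    then have "(\<lambda>n. ifs f (s n) w) \<longlonglongrightarrow> G z" by (rule Lim_transform_eventually[OF lim[OF z]])
    then show ?thesis using LIMSEQ_unique lim[OF w] by blast
  next
    case False
    define A where "A = (\<lambda>j. ifs f j z)"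
    define B where "B = (\<lambda>j. ifs f j w)"
    have AB: "A j \<in> D" "B j \<in> D" "A j \<noteq> B j" for j
      using ifs_mem[OF fD z] ifs_mem[OF fD w] False by (auto simp: A_def B_def)
    have Suc: "A (Suc j) = f (Suc j) (A j)" "B (Suc j) = f (Suc j) (B j)" for j
      by (simp_all add: A_def B_def)
    define joins where "joins = (\<lambda>j r \<phi> \<rho>. 0 < r \<and> r < 1 \<and> \<phi> 0 = A j \<and> \<phi> (complex_of_real r) = B j \<and>
        holomorphic_disc D \<phi> \<and> (\<forall>z\<in>D. \<rho> z \<in> \<bbbD>) \<and> (\<forall>z\<in>D. \<exists>a. (\<rho> has_derivative cdot a) (at z)) \<and>
        (\<forall>\<zeta>\<in>\<bbbD>. \<rho> (\<phi> \<zeta>) = \<zeta>) \<and> lempert_device D \<phi> (\<lambda>z. \<phi> (\<rho> z)) \<rho>)"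
    have "\<exists>r \<phi> \<rho>. joins j r \<phi> \<rho>" for j
      unfolding joins_def by (rule lempert_device_exists[OF D AB[of j]]) blast
    then obtain r \<phi> \<rho> where joins: "\<And>j. joins j (r j) (\<phi> j) (\<rho> j)" by metis
    have r: "0 < r j" "r j < 1" and \<phi>: "\<phi> j 0 = A j" "\<phi> j (of_real (r j)) = B j" "holomorphic_disc D (\<phi> j)"
      and dev: "lempert_device D (\<phi> j) (\<lambda>z. \<phi> j (\<rho> j z)) (\<rho> j)" for j
      using joins[of j] by (simp_all add: joins_def)
    have \<rho>: "\<rho> j z \<in> \<bbbD>" "\<exists>a. (\<rho> j has_derivative cdot a) (at z)" if "z \<in> D" for j z
      using joins[of j] that unfolding joins_def by blast+
    have inv: "\<rho> j (\<phi> j \<zeta>) = \<zeta>" if "\<zeta> \<in> \<bbbD>" for j \<zeta>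
      using joins[of j] that unfolding joins_def by blast
    have \<phi>D: "\<phi> j \<zeta> \<in> D" if "\<zeta> \<in> \<bbbD>" for j \<zeta> using \<phi>(3)[of j] that by (auto simp: holomorphic_disc_def)
    \<comment> \<open>The map \<open>f (Suc j)\<close>, read in the geodesics through the \<open>j\<close>-th and through the next pair of points.\<close>
    define g where "g = (\<lambda>j \<zeta>. \<rho> (Suc j) (f (Suc j) (\<phi> j \<zeta>)))"
    have "\<exists>p. p \<in> \<bbbD> \<and> cmod p \<le> tanh C \<and> (\<forall>\<zeta>\<in>\<bbbD>. g j \<zeta> \<noteq> p)" for j
    proof -
      obtain U where U: "\<rho> (Suc j) ` X \<subseteq> U" "bloch_radius poincare_dist \<bbbD> U < ereal C"
        using bloch[OF dev[of "Suc j"]] by blast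
      obtain p where "p \<in> \<bbbD>" "p \<notin> U" "cmod p \<le> tanh C" using bloch_radius_omitted_point[OF U(2) C] by blast
      moreover have "g j \<zeta> \<in> U" if "\<zeta> \<in> \<bbbD>" for \<zeta> using U(1) f \<phi>D[OF that] unfolding g_def by blast
      ultimately show ?thesis by metis
    qed
    then obtain p where p: "\<And>j. cmod (p j) \<le> tanh C" "\<And>j \<zeta>. \<zeta> \<in> \<bbbD> \<Longrightarrow> g j \<zeta> \<noteq> p j" by metis
    have rD: "of_real (r j) \<in> \<bbbD>" for j using r[of j] by simp
    have "r \<longlonglongrightarrow> 0"
    proof (rule omitting_iteration_tendsto_0[of g r p "tanh C"])
      show "g j holomorphic_on \<bbbD>" for j
        unfolding g_def
      proof (rule holomorphic_on_compose_vec)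
        show "vec_holomorphic_on (\<lambda>\<zeta>. f (Suc j) (\<phi> j \<zeta>)) \<bbbD>"
          using holomorphic_self_map_compose_disc[OF D(1) _ \<phi>(3)] f by blast
        show "\<exists>a. (\<rho> (Suc j) has_derivative cdot a) (at (f (Suc j) (\<phi> j \<zeta>)))" if "\<zeta> \<in> \<bbbD>" for \<zeta>
          using \<rho>(2) fD \<phi>D[OF that] by blast
      qed simp
      show "g j ` \<bbbD> \<subseteq> \<bbbD>" for j unfolding g_def using \<rho>(1) fD \<phi>D by blast
      show "g j 0 = 0" for j
        using inv[of 0 "Suc j"] by (simp add: g_def \<phi>(1) flip: Suc)
      show "g j (of_real (r j)) = of_real (r (Suc j))" for j
        using inv[OF rD[of "Suc j"], of "Suc j"] by (simp add: g_def \<phi>(2) flip: Suc)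
      show "tanh C < 1" by (rule tanh_real_lt_1)
    qed (use r p in auto)
    obtain M where "\<forall>x\<in>D. norm x \<le> M" using D(3) bounded_iff by blast
    then have M: "norm x \<le> M" if "x \<in> D" for x using that by blast
    define N where "N = real CARD('n) * (2 * M + 1)"
    have bound: "norm (B j - A j) \<le> N * r j" for j
    proof -
      have "norm (\<phi> j (of_real (r j)) - A j) \<le> real CARD('n) * (2 * M + 1) * cmod (of_real (r j))"
      proof (rule vec_Schwarz[of "\<lambda>\<zeta>. \<phi> j \<zeta> - A j"])
        show "vec_holomorphic_on (\<lambda>\<zeta>. \<phi> j \<zeta> - A j) \<bbbD>"
          using \<phi>(3)[of j] by (intro vec_holomorphic_on_diff vec_holomorphic_on_const)
            (auto simp: holomorphic_disc_def vec_holomorphic_on_def)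
        show "norm (\<phi> j \<zeta> - A j) < 2 * M + 1" if "\<zeta> \<in> \<bbbD>" for \<zeta>
          using norm_triangle_ineq4[of "\<phi> j \<zeta>" "A j"] M[OF \<phi>D[OF that, of j]] M[OF AB(1)[of j]] by linarith
      qed (use \<phi>(1) rD in auto)
      then show ?thesis using r(1)[of j] by (simp add: \<phi>(2) N_def)
    qed
    have "(\<lambda>j. N * r j) \<longlonglongrightarrow> 0" using tendsto_mult_right_zero[OF \<open>r \<longlonglongrightarrow> 0\<close>] .
    then have "(\<lambda>j. B j - A j) \<longlonglongrightarrow> 0" by (rule Lim_null_comparison[rotated]) (use bound in simp)
    then have "(\<lambda>j. B (s j) - A (s j)) \<longlonglongrightarrow> 0" using LIMSEQ_subseq_LIMSEQ[OF _ s] by (simp add: o_def)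
    moreover have "(\<lambda>j. B (s j) - A (s j)) \<longlonglongrightarrow> G w - G z"
      unfolding A_def B_def by (intro tendsto_diff lim z w)
    ultimately have "G w - G z = 0" using LIMSEQ_unique by blast
    then show ?thesis by simp
  qed
  then show "G constant_on D" unfolding constant_on_def by metis
qed

end
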